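(* Let $(\mathcal{P},\mathcal{N})$ be a Beurling generalized number system whose integer-counting function satisfies $N_{\mathcal{P}}(x) = Ax + O(x^{\theta})$ for some constants $A>0$ and $\theta\in[0,1)$. Then, uniformly for $\alpha \ge \frac{1+\theta}{2}$ and $T\ge 2$, \[ N(\zeta_{\mathcal{P}};\alpha,T) \ll T^{\frac{4(1-\alpha)}{3-2\alpha-\theta}}(\log T)^{9}, \] where the implied constant depends only on the number system (and not on $\alpha$ or $T$).
   Context: A Beurling generalized number system $(\mathcal{P},\mathcal{N})$ consists of a sequence of generalized primes $\mathcal{P}=(p_j)_j$ of real numbers with $1<p_1\le p_2\le\dotsb$, $p_j\to\infty$, and the sequence $\mathcal{N}=(n_j)_j$ of generalized integers, consisting of all finite products of generalized primes (including the empty product $1$), listed in non-decreasing order and counted with multiplicity (a real number appears as many times as it has distinct factorizations into generalized primes). $N_{\mathcal{P}}(x)=\#\{j: n_j\le x\}$. The Beurling zeta function is $\zeta_{\mathcal{P}}(s)=\sum_j n_j^{-s}=\prod_j(1-p_j^{-s})^{-1}$ for $\Re s>1$; under the hypothesis $N_{\mathcal{P}}(x)=Ax+O(x^\theta)$, $\zeta_{\mathcal{P}}(s)-\frac{A}{s-1}$ extends analytically to $\Re s>\theta$. For $\alpha>\theta$ and $T>0$, $N(\zeta_{\mathcal{P}};\alpha,T)$ denotes the number of zeros $\rho=\beta+\mathrm{i}\gamma$ of (the continuation of) $\zeta_{\mathcal{P}}$ with $\beta\ge\alpha$ and $|\gamma|\le T$, counted with multiplicity. *)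

theory Defs
  imports
    "HOL-Complex_Analysis.Complex_Analysis"
    "HOL-Library.Landau_Symbols"
    "HOL-Library.Multiset"
begin

(* Generalized primes p and generalized integers n, both indexed from 0.  A factorization is a
   finite multiset of indices of generalized primes, so equal primes at different positions count
   as different, and {#} gives the empty product 1.  The bijection e makes n list every
   factorization exactly once, i.e. every generalized integer with its multiplicity. *)
definition beurling_system :: "(nat \<Rightarrow> real) \<Rightarrow> (nat \<Rightarrow> real) \<Rightarrow> bool" where
  "beurling_system p n \<longleftrightarrow>
     1 < p 0 \<and> mono p \<and> filterlim p at_top sequentially \<and>
     mono n \<and>
     (\<exists>e :: nat \<Rightarrow> nat multiset. bij e \<and> (\<forall>j. n j = (\<Prod>i\<in>#e j. p i)))"

definition beurling_count :: "(nat \<Rightarrow> real) \<Rightarrow> real \<Rightarrow> nat" where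
  "beurling_count n x = card {j. n j \<le> x}"

(* Meaningful for Re s > 1 only. *)
definition beurling_zeta :: "(nat \<Rightarrow> real) \<Rightarrow> complex \<Rightarrow> complex" where
  "beurling_zeta n s = (\<Sum>j. complex_of_real (n j) powr (- s))"

(* The analytic extension of zeta(s) - A/(s-1) to Re s > theta; for theta < 1 it is unique there by
   the identity theorem, and its values elsewhere are irrelevant. *)
definition beurling_zeta_regular_part ::
    "(nat \<Rightarrow> real) \<Rightarrow> real \<Rightarrow> real \<Rightarrow> complex \<Rightarrow> complex" where
  "beurling_zeta_regular_part n A \<theta> =
     (SOME F. F holomorphic_on {s. Re s > \<theta>} \<and>
              (\<forall>s. Re s > 1 \<longrightarrow> F s = beurling_zeta n s - complex_of_real A / (s - 1)))"

(* For A > 0 the point s = 1 is a pole; the value at s = 1 is an artefact of division by zero. *)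
definition beurling_zeta_cont ::
    "(nat \<Rightarrow> real) \<Rightarrow> real \<Rightarrow> real \<Rightarrow> complex \<Rightarrow> complex" where
  "beurling_zeta_cont n A \<theta> s =
     beurling_zeta_regular_part n A \<theta> s + complex_of_real A / (s - 1)"

definition beurling_zeros ::
    "(nat \<Rightarrow> real) \<Rightarrow> real \<Rightarrow> real \<Rightarrow> real \<Rightarrow> real \<Rightarrow> complex set" where
  "beurling_zeros n A \<theta> \<alpha> T =
     {\<rho>. \<rho> \<noteq> 1 \<and> beurling_zeta_cont n A \<theta> \<rho> = 0 \<and> Re \<rho> \<ge> \<alpha> \<and> \<bar>Im \<rho>\<bar> \<le> T}"

(* Zeros counted with multiplicity.  The sum is 0 by convention on an infinite set of zeros, so
   bounds on this quantity should be accompanied by finiteness of beurling_zeros. *)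
definition beurling_zero_count ::
    "(nat \<Rightarrow> real) \<Rightarrow> real \<Rightarrow> real \<Rightarrow> real \<Rightarrow> real \<Rightarrow> nat" where
  "beurling_zero_count n A \<theta> \<alpha> T =
     (\<Sum>\<rho>\<in>beurling_zeros n A \<theta> \<alpha> T. nat (zorder (beurling_zeta_cont n A \<theta>) \<rho>))"

end

theory Submission
  imports Defs
begin

text \<open>
  Let M be the sum of \<mu>(n) n^(-s) over n \<le> X = T^(1/(1-\<theta>)) and f = \<zeta> M - 1, so that f = -1 at every zero of \<zeta>.
  Cauchy's formula with the kernel Y^w exp(w^2) / w on a rectangle around a zero \<rho> bounds 1 by averages of |f|
  near height Im \<rho> on the lines Re s = 1 + 1/log T and Re s = (1+\<theta>)/2 - 1/log T, with weights
  Y^(1 - Re \<rho>) and Y^((1+\<theta>)/2 - Re \<rho>).  On the right line f has mean square O((log T)^4), since it only involves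
  integers beyond X; on the left line the integral of |f| is O(T log T), since both \<zeta> and M have mean square
  O(T log T).  Summing over zeros in different windows of bounded height and choosing
  Y = T^(2/(3-2\<alpha>-\<theta>)) gives the estimate.

  The integers need not be well spaced, but [x, x exp(1/T)] contains only O(x/T + x^\<theta>) of them, so the mean value
  theorem for Dirichlet polynomials of length N holds with N + T N^\<theta> in place of N + T; both terms balance
  at N = X.  Beyond X the mean square of \<zeta> is estimated by summation by parts against N(x) - A x, sampled on a
  grid that is well spaced on the logarithmic scale.
\<close>

subsection \<open>Mean squares of exponential sums\<close>

text \<open>The zeros fill the closed strip (1 + \<theta>) / 2 \<le> Re s \<le> 1, so both lines are
  moved out of it by 1 / log T. This bounds the kernel's denominator below by 1 / log T, while X^(1
  / log T) and Y^(1 / log T) stay bounded. The factor exp(w^2) makes the horizontal sides negligible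
  already at distance log T from the zero. Zeros with |Im s| < 2 log T, whose rectangles could meet
  the pole at 1, are set aside; they occupy only O(log T) windows.

  The nine logarithms: two from the squared kernel, one from the length of the segments in
  Cauchy-Schwarz, one from their overlap, four from the mean square on the right, one from the
  number of zeros in a window.

  No functional equation is at hand, and N(x) - A x is known only by its size. Summation by parts
  costs a factor |s|, so the part of zeta beyond X has integrated mean square T^2 X^(\<theta> - 1)
  on the left line, which is T for X = T^(1 / (1 - \<theta>)). The same X is the longest for which
  the polynomials up to X still have mean square O(T log T).\<close>

lemma has_integral_fejer_kernel:
  fixes V x :: real
  assumes "V > 0" "x \<noteq> 0"
  shows "((\<lambda>t. of_real (1 - \<bar>t\<bar> / V) * exp (\<i> * of_real (x * t))) has_integral
     (exp (\<i> * of_real (x * V)) + exp (- \<i> * of_real (x * V)) - 2) / ((\<i> * of_real x)\<^sup>2 * of_real V)) {-V..V}"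
proof -
  define a where "a = \<i> * complex_of_real x"
  have a: "a \<noteq> 0" using assms by (simp add: a_def)
  have V: "complex_of_real V \<noteq> 0" using assms by simp
  \<comment> \<open>\<open>G1\<close> and \<open>G2\<close> are antiderivatives of the integrand on
    the two sides of 0, where the triangle is linear; their terms 1 / a cancel at 0.\<close>
  define G1 where "G1 = (\<lambda>t::complex. (1 - t / of_real V) * exp (a * t) / a + exp (a * t) / (a\<^sup>2 * of_real V))"
  define G2 where "G2 = (\<lambda>t::complex. (1 + t / of_real V) * exp (a * t) / a - exp (a * t) / (a\<^sup>2 * of_real V))"
  have "((\<lambda>t. (1 - of_real t / of_real V) * exp (a * of_real t)) has_integral (G1 (of_real V) - G1 (of_real 0))) {0..V}"
  proof (rule fundamental_theorem_of_calculus[where f = "\<lambda>t. G1 (of_real t)"])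
    fix t :: real
    have "(G1 has_field_derivative ((- 1 / of_real V) * exp (a * of_real t) / a
        + (1 - of_real t / of_real V) * (a * exp (a * of_real t)) / a + a * exp (a * of_real t) / (a\<^sup>2 * of_real V))) (at (of_real t))"
      unfolding G1_def using a V by (auto intro!: derivative_eq_intros simp: field_simps)
    moreover have "(- 1 / of_real V) * exp (a * of_real t) / a
        + (1 - of_real t / of_real V) * (a * exp (a * of_real t)) / a + a * exp (a * of_real t) / (a\<^sup>2 * of_real V)
        = (1 - of_real t / of_real V) * exp (a * of_real t)"
      using a V by (simp add: field_simps power2_eq_square)
    ultimately show "((\<lambda>t. G1 (of_real t)) has_vector_derivative (1 - of_real t / of_real V) * exp (a * of_real t)) (at t within {0..V})"
      by (intro has_vector_derivative_real_field) simp
  qed (use assms in auto)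
  then have 1: "((\<lambda>t. of_real (1 - \<bar>t\<bar> / V) * exp (\<i> * of_real (x * t))) has_integral (G1 (of_real V) - G1 (of_real 0))) {0..V}"
    by (rule has_integral_eq[rotated]) (auto simp: a_def mult.assoc)
  have "((\<lambda>t. (1 + of_real t / of_real V) * exp (a * of_real t)) has_integral (G2 (of_real 0) - G2 (of_real (- V)))) {-V..0}"
  proof (rule fundamental_theorem_of_calculus[where f = "\<lambda>t. G2 (of_real t)"])
    fix t :: real
    have "(G2 has_field_derivative ((1 / of_real V) * exp (a * of_real t) / a
        + (1 + of_real t / of_real V) * (a * exp (a * of_real t)) / a - a * exp (a * of_real t) / (a\<^sup>2 * of_real V))) (at (of_real t))"
      unfolding G2_def using a V by (auto intro!: derivative_eq_intros simp: field_simps)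
    moreover have "(1 / of_real V) * exp (a * of_real t) / a
        + (1 + of_real t / of_real V) * (a * exp (a * of_real t)) / a - a * exp (a * of_real t) / (a\<^sup>2 * of_real V)
        = (1 + of_real t / of_real V) * exp (a * of_real t)"
      using a V by (simp add: field_simps power2_eq_square)
    ultimately show "((\<lambda>t. G2 (of_real t)) has_vector_derivative (1 + of_real t / of_real V) * exp (a * of_real t)) (at t within {-V..0})"
      by (intro has_vector_derivative_real_field) simp
  qed (use assms in auto)
  then have 2: "((\<lambda>t. of_real (1 - \<bar>t\<bar> / V) * exp (\<i> * of_real (x * t))) has_integral (G2 (of_real 0) - G2 (of_real (- V)))) {-V..0}"
    by (rule has_integral_eq[rotated]) (auto simp: a_def mult.assoc)
  have "((\<lambda>t. of_real (1 - \<bar>t\<bar> / V) * exp (\<i> * of_real (x * t))) has_integral (G2 (of_real 0) - G2 (of_real (- V)) + (G1 (of_real V) - G1 (of_real 0)))) {-V..V}"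
    by (rule has_integral_combine[OF _ _ 2 1]) (use assms in auto)
  moreover have "G1 (of_real V) = exp (a * of_real V) / (a\<^sup>2 * of_real V)" "G1 (of_real 0) = 1 / a + 1 / (a\<^sup>2 * of_real V)"
      "G2 (of_real 0) = 1 / a - 1 / (a\<^sup>2 * of_real V)" "G2 (of_real (- V)) = - exp (- (a * of_real V)) / (a\<^sup>2 * of_real V)"
    using V by (simp_all add: G1_def G2_def)
  moreover have "exp (\<i> * of_real (x * V)) = exp (a * of_real V)" "exp (- \<i> * of_real (x * V)) = exp (- (a * of_real V))"
    by (simp_all add: a_def mult.assoc)
  ultimately show ?thesis by (simp add: a_def[symmetric] diff_divide_distrib add_divide_distrib add_diff_eq add.commute mult.commute del: of_real_minus)
qed

text \<open>The Fourier transform of a triangle decays quadratically, unlike that of an interval,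
  and this decay makes the sum over shells of close frequencies converge. The second bound is read
  off the closed form, whose numerator is at most 4.\<close>

lemma fejer_kernel_bounds:
  fixes V x :: real
  assumes "V > 0"
  defines "k \<equiv> norm (integral {-V..V} (\<lambda>t. of_real (1 - \<bar>t\<bar> / V) * exp (\<i> * of_real (x * t)) :: complex))"
  shows "k \<le> 2 * V" and "x \<noteq> 0 \<Longrightarrow> k \<le> 4 / (x\<^sup>2 * V)"
proof -
  have "k \<le> integral {-V..V} (\<lambda>t. 1)"
    unfolding k_def
  proof (rule integral_norm_bound_integral)
    show "(\<lambda>t. of_real (1 - \<bar>t\<bar> / V) * exp (\<i> * of_real (x * t)) :: complex) integrable_on {-V..V}"
      by (intro integrable_continuous_real continuous_intros) (use assms in auto)
    fix t assume t: "t \<in> {-V..V}"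
    then have "\<bar>1 - \<bar>t\<bar> / V\<bar> \<le> 1" using assms by (auto simp: field_simps abs_le_iff)
    then show "norm (of_real (1 - \<bar>t\<bar> / V) * exp (\<i> * of_real (x * t)) :: complex) \<le> 1"
      by (simp add: norm_mult del: of_real_diff)
  qed auto
  then show "k \<le> 2 * V" using assms by simp
  assume x: "x \<noteq> 0"
  have "k = norm ((exp (\<i> * of_real (x * V)) + exp (- \<i> * of_real (x * V)) - 2) / ((\<i> * of_real x)\<^sup>2 * of_real V :: complex))"
    unfolding k_def using has_integral_fejer_kernel[OF assms(1) x] by (simp add: integral_unique)
  also have "\<dots> = norm (exp (\<i> * of_real (x * V)) + exp (- \<i> * of_real (x * V)) - 2 :: complex) / (x\<^sup>2 * V)"
    using assms by (simp add: norm_divide norm_mult norm_power)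
  also have "norm (exp (\<i> * of_real (x * V)) + exp (- \<i> * of_real (x * V)) - 2 :: complex) \<le> 1 + 1 + 2"
    by (intro order.trans[OF norm_triangle_ineq4] add_mono order.trans[OF norm_triangle_ineq]) simp_all
  finally show "k \<le> 4 / (x\<^sup>2 * V)" using assms by (simp add: divide_right_mono)
qed

lemma ln_ge_half: "x \<ge> 2 \<Longrightarrow> ln x \<ge> (1 / 2 :: real)"
proof -
  assume "x \<ge> 2"
  then have "ln 2 \<le> ln x" by simp
  then show ?thesis using ln2_ge_two_thirds by linarith
qed

lemma continuous_on_Complex: "continuous_on S (Complex \<sigma>)"
proof -
  have "continuous_on S (\<lambda>t. of_real \<sigma> + \<i> * of_real t)" by (intro continuous_intros)
  then show ?thesis by (simp add: Complex_eq[abs_def])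
qed

lemma sum_inverse_squares_le: "(\<Sum>r=1..R. 1 / real r ^ 2) \<le> 2"
proof -
  \<comment> \<open>The subtracted 1 / R makes the induction telescope. For R = 0 it is 0 by
    convention, so the step from 0 to 1 is treated separately.\<close>
  have "(\<Sum>r=1..R. 1 / real r ^ 2) \<le> 2 - 1 / real R"
  proof (induction R)
    case (Suc R)
    show ?case
    proof (cases "R = 0")
      case False
      have "1 / real (Suc R) ^ 2 \<le> 1 / real R - 1 / real (Suc R)"
        using False by (simp add: divide_simps power2_eq_square)
      then show ?thesis using Suc by simp
    qed simp
  qed simp
  then show ?thesis by (smt (verit) divide_nonneg_nonneg of_nat_0_le_iff)
qed

text \<open>Frequencies more than 1 apart enter only through the trivial bound 2 / U for the Fejer kernel;
  close frequencies are counted in shells, so that no spacing condition is needed.\<close>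
lemma mean_square_exponential_sum:
  fixes c :: "'a \<Rightarrow> complex" and l B :: "'a \<Rightarrow> real"
  assumes J: "finite J" and U: "U > 0"
    and B: "\<And>j r. j \<in> J \<Longrightarrow> real (card {k \<in> J. \<bar>l j - l k\<bar> \<le> 1 \<and> real r \<le> U * \<bar>l j - l k\<bar> \<and> U * \<bar>l j - l k\<bar> < real r + 1}) \<le> B j"
  shows "integral {-U..U} (\<lambda>t. (norm (\<Sum>j\<in>J. c j * exp (\<i> * of_real (l j * t))))\<^sup>2)
     \<le> 16 * U * (\<Sum>j\<in>J. (norm (c j))\<^sup>2 * B j) + 4 / U * (\<Sum>j\<in>J. norm (c j))\<^sup>2"
proof -
  \<comment> \<open>With V = 2 U the weight 1 - |t| / V is at least 1 / 2 on [-U, U], so the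
    weighted integral over [-V, V] dominates up to a factor 2.\<close>
  define V where "V = 2 * U"
  have V: "V > 0" using U by (simp add: V_def)
  define S where "S = (\<lambda>t. \<Sum>j\<in>J. c j * exp (\<i> * of_real (l j * t)))"
  define K where "K = (\<lambda>x. integral {-V..V} (\<lambda>t. of_real (1 - \<bar>t\<bar> / V) * exp (\<i> * of_real (x * t)) :: complex))"
  let ?K = "\<lambda>j k. if \<bar>l j - l k\<bar> \<le> 1 then norm (K (l j - l k)) else 0"
  let ?W = "\<lambda>t. (1 - \<bar>t\<bar> / V) * (norm (S t))\<^sup>2"
  \<comment> \<open>Bound for the kernel on the shell r \<le> U |x| < r + 1: the trivial 2 V on
    shell 0, and 4 / (x^2 V) = 2 U / (U |x|)^2 further out.\<close>
  define \<phi> where "\<phi> = (\<lambda>r::nat. if r = 0 then 4 * U else 2 * U / real r ^ 2)"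
  have K_near: "norm (K x) \<le> \<phi> r" if "real r \<le> U * \<bar>x\<bar>" for x r
  proof (cases "r = 0")
    case True
    then show ?thesis using fejer_kernel_bounds(1)[OF V, of x] by (simp add: K_def \<phi>_def V_def)
  next
    case False
    then have x: "x \<noteq> 0" using that U by auto
    have "norm (K x) \<le> 4 / (x\<^sup>2 * V)" using fejer_kernel_bounds(2)[OF V x] by (simp add: K_def)
    also have "\<dots> = 2 * U / (U * \<bar>x\<bar>) ^ 2"
      using U x by (simp add: V_def field_simps power2_eq_square)
    also have "\<dots> \<le> 2 * U / real r ^ 2"
      by (intro divide_left_mono power_mono that) (use U x False in auto)
    finally show ?thesis using False by (simp add: \<phi>_def)
  qed
  have K_far: "norm (K x) \<le> 2 / U" if "\<bar>x\<bar> > 1" for x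
  proof -
    have x: "x \<noteq> 0" using that by auto
    have "norm (K x) \<le> 4 / (x\<^sup>2 * V)" using fejer_kernel_bounds(2)[OF V x] by (simp add: K_def)
    also have "4 / (x\<^sup>2 * V) \<le> 4 / (1 * V)"
    proof -
    have "1 \<le> \<bar>x\<bar>\<^sup>2" using that by (intro one_le_power) auto
    then show ?thesis
      by (intro divide_left_mono mult_right_mono) (use V x in auto)
    qed
    finally show ?thesis by (simp add: V_def)
  qed
  have \<phi>_nonneg: "\<phi> r \<ge> 0" for r using U by (simp add: \<phi>_def)
  have \<phi>_sum: "(\<Sum>r\<le>R. \<phi> r) \<le> 8 * U" for R
  proof -
    have "(\<Sum>r\<le>R. \<phi> r) = \<phi> 0 + (\<Sum>r=1..R. \<phi> r)"
      by (simp add: sum.atMost_shift atMost_atLeast0 sum.atLeast_Suc_atMost)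
    also have "(\<Sum>r=1..R. \<phi> r) = 2 * U * (\<Sum>r=1..R. 1 / real r ^ 2)"
      unfolding sum_distrib_left by (rule sum.cong) (auto simp: \<phi>_def)
    also have "\<dots> \<le> 2 * U * 2" by (intro mult_left_mono sum_inverse_squares_le) (use U in auto)
    finally show ?thesis by (simp add: \<phi>_def)
  qed
  have near: "(\<Sum>k\<in>{k\<in>J. \<bar>l j - l k\<bar> \<le> 1}. norm (K (l j - l k))) \<le> 8 * U * B j" if j: "j \<in> J" for j
  proof -
    let ?N = "{k\<in>J. \<bar>l j - l k\<bar> \<le> 1}"
    define r where "r = (\<lambda>k. nat \<lfloor>U * \<bar>l j - l k\<bar>\<rfloor>)"
    have fin: "finite ?N" using J by auto
    have r: "real (r k) = of_int \<lfloor>U * \<bar>l j - l k\<bar>\<rfloor>" for k using U by (simp add: r_def)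
    define R where "R = Max (insert 0 (r ` ?N))"
    have R: "r ` ?N \<subseteq> {..R}" using fin by (auto simp: R_def)
    have "B j \<ge> 0" using B[OF j, of 0] by (meson of_nat_0_le_iff order.trans)
    have "(\<Sum>k\<in>?N. norm (K (l j - l k))) \<le> (\<Sum>k\<in>?N. \<phi> (r k))"
      by (intro sum_mono K_near) (simp add: r)
    also have "\<dots> = (\<Sum>q\<le>R. \<Sum>k\<in>{k\<in>?N. r k = q}. \<phi> (r k))"
      using sum.group[OF fin _ R, of "\<lambda>k. \<phi> (r k)"] by simp
    also have "\<dots> \<le> (\<Sum>q\<le>R. B j * \<phi> q)"
    proof (rule sum_mono)
      fix q
      have "{k\<in>?N. r k = q} = {k \<in> J. \<bar>l j - l k\<bar> \<le> 1 \<and> real q \<le> U * \<bar>l j - l k\<bar> \<and> U * \<bar>l j - l k\<bar> < real q + 1}"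
        using U by (auto simp: r_def nat_eq_iff floor_eq_iff)
      then have "real (card {k\<in>?N. r k = q}) \<le> B j" using B[OF j, of q] by simp
      then show "(\<Sum>k\<in>{k\<in>?N. r k = q}. \<phi> (r k)) \<le> B j * \<phi> q"
        using \<phi>_nonneg by (simp add: mult_right_mono)
    qed
    also have "\<dots> \<le> B j * (8 * U)"
      unfolding sum_distrib_left[symmetric] by (intro mult_left_mono \<phi>_sum \<open>B j \<ge> 0\<close>)
    finally show ?thesis by (simp add: mult_ac)
  qed
  have S_cont: "continuous_on X S" for X unfolding S_def by (intro continuous_intros)
  have half: "integral {-U..U} (\<lambda>t. (norm (S t))\<^sup>2) \<le> 2 * integral {-V..V} (\<lambda>t. ?W t)"
  proof -
    have i: "(\<lambda>t. 2 * (?W t)) integrable_on {a..b}" for a b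
      by (intro integrable_continuous_real continuous_intros S_cont) (use V in auto)
    have "integral {-U..U} (\<lambda>t. (norm (S t))\<^sup>2) \<le> integral {-U..U} (\<lambda>t. 2 * (?W t))"
    proof (rule integral_le[OF _ i])
      show "(\<lambda>t. (norm (S t))\<^sup>2) integrable_on {-U..U}"
        by (intro integrable_continuous_real continuous_intros S_cont)
      fix t assume "t \<in> {-U..U}"
      then have "1 \<le> 2 * (1 - \<bar>t\<bar> / V)" using U by (auto simp: V_def field_simps)
      then have "1 * (norm (S t))\<^sup>2 \<le> (2 * (1 - \<bar>t\<bar> / V)) * (norm (S t))\<^sup>2" by (intro mult_right_mono) auto
      then show "(norm (S t))\<^sup>2 \<le> 2 * (?W t)"
        by (simp only: mult.assoc mult_1_left)
    qed
    also have "\<dots> \<le> integral {-V..V} (\<lambda>t. 2 * (?W t))"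
    proof (rule integral_subset_le[OF _ i i], goal_cases)
      case 2
      have "0 \<le> 2 * (?W t)" if "t \<in> {-V..V}" for t
      proof -
        from that have "\<bar>t\<bar> / V \<le> 1" using V by (auto simp: field_simps)
        then show ?thesis by simp
      qed
      then show ?case by blast
    qed (use U in \<open>auto simp: V_def\<close>)
    finally show ?thesis by simp
  qed
  have "complex_of_real (integral {-V..V} (\<lambda>t. ?W t))
     = integral {-V..V} (\<lambda>t. of_real (?W t))"
  proof -
    have "((\<lambda>t. ?W t) has_integral integral {-V..V} (\<lambda>t. ?W t)) {-V..V}"
      by (intro integrable_integral integrable_continuous_real continuous_intros S_cont) (use V in auto)
    from has_integral_linear[OF this bounded_linear_of_real[where 'a=complex]] show ?thesis by (simp add: integral_unique o_def)
  qed
  also have "(\<lambda>t. complex_of_real (?W t)) =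
      (\<lambda>t. \<Sum>j\<in>J. \<Sum>k\<in>J. c j * cnj (c k) * (of_real (1 - \<bar>t\<bar> / V) * exp (\<i> * of_real ((l j - l k) * t))))"
  proof
    fix t
    have "complex_of_real ((norm (S t))\<^sup>2) = S t * cnj (S t)" by (simp only: complex_norm_square)
    also have "\<dots> = (\<Sum>j\<in>J. \<Sum>k\<in>J. c j * cnj (c k) * exp (\<i> * of_real ((l j - l k) * t)))"
      unfolding S_def cnj_sum sum_product
    proof (intro sum.cong refl)
      fix j k
      have "exp (\<i> * of_real (l j * t)) * cnj (exp (\<i> * of_real (l k * t))) = exp (\<i> * of_real ((l j - l k) * t))"
        by (simp add: exp_cnj flip: exp_add) (simp add: algebra_simps)
      then show "c j * exp (\<i> * of_real (l j * t)) * cnj (c k * exp (\<i> * of_real (l k * t)))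
          = c j * cnj (c k) * exp (\<i> * of_real ((l j - l k) * t))"
        by (metis (no_types, lifting) complex_cnj_mult mult.commute mult.left_commute)
    qed
    finally show "complex_of_real (?W t) =
      (\<Sum>j\<in>J. \<Sum>k\<in>J. c j * cnj (c k) * (of_real (1 - \<bar>t\<bar> / V) * exp (\<i> * of_real ((l j - l k) * t))))"
      unfolding of_real_mult sum_distrib_left by (simp add: sum_distrib_left mult_ac)
  qed
  also have "integral {-V..V} \<dots> = (\<Sum>j\<in>J. \<Sum>k\<in>J. c j * cnj (c k) * K (l j - l k))"
    unfolding K_def
    by (subst integral_sum integral_mult_right; (intro J integrable_sum integrable_continuous_real continuous_intros)?; (use V in simp)?)+
  finally have eq: "complex_of_real (integral {-V..V} (\<lambda>t. ?W t))
      = (\<Sum>j\<in>J. \<Sum>k\<in>J. c j * cnj (c k) * K (l j - l k))" .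
  have "integral {-V..V} (\<lambda>t. ?W t)
      \<le> norm (complex_of_real (integral {-V..V} (\<lambda>t. ?W t)))" by simp
  also have "\<dots> \<le> (\<Sum>j\<in>J. \<Sum>k\<in>J. norm (c j) * norm (c k) * norm (K (l j - l k)))"
    unfolding eq by (intro sum_norm_le order.refl order.trans[OF norm_sum] sum_mono) (simp add: norm_mult)
  \<comment> \<open>Close pairs are split by a b \<le> (a^2 + b^2) / 2, so that for each j only the
    total kernel mass near \<open>l j\<close> matters. Pairs further apart than 1 carry a kernel of
    at most 2 / U and together give the squared l1 norm.\<close>
  also have "\<dots> \<le> (\<Sum>j\<in>J. \<Sum>k\<in>J. (((norm (c j))\<^sup>2 + (norm (c k))\<^sup>2) / 2) * ?K j k
      + 2 / U * (norm (c j) * norm (c k)))"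
  proof (intro sum_mono)
    fix j k
    have am: "norm (c j) * norm (c k) \<le> ((norm (c j))\<^sup>2 + (norm (c k))\<^sup>2) / 2"
      using sum_squares_bound[of "norm (c j)" "norm (c k)"] by simp
    show "norm (c j) * norm (c k) * norm (K (l j - l k)) \<le> (((norm (c j))\<^sup>2 + (norm (c k))\<^sup>2) / 2) * ?K j k
      + 2 / U * (norm (c j) * norm (c k))"
    proof (cases "\<bar>l j - l k\<bar> \<le> 1")
      case True
      have "norm (c j) * norm (c k) * norm (K (l j - l k)) \<le> ((norm (c j))\<^sup>2 + (norm (c k))\<^sup>2) / 2 * norm (K (l j - l k))"
        by (intro mult_right_mono am) auto
      moreover have "2 / U * (norm (c j) * norm (c k)) \<ge> 0" using U by simp
      ultimately show ?thesis using True by simp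
    next
      case False
      then have "norm (c j) * norm (c k) * norm (K (l j - l k)) \<le> norm (c j) * norm (c k) * (2 / U)"
        by (intro mult_left_mono K_far) auto
      then show ?thesis using False by (simp add: mult_ac)
    qed
  qed
  also have "\<dots> = (\<Sum>j\<in>J. \<Sum>k\<in>J. (norm (c j))\<^sup>2 * ?K j k / 2)
      + (\<Sum>j\<in>J. \<Sum>k\<in>J. (norm (c k))\<^sup>2 * ?K j k / 2)
      + 2 / U * (\<Sum>j\<in>J. norm (c j))\<^sup>2"
    by (simp only: power2_eq_square[of "sum _ _"] sum_product)
       (simp add: sum.distrib sum_distrib_left add_divide_distrib ring_distribs)
  \<comment> \<open>The kernel is even, so exchanging j and k turns the second half into the
    first.\<close>
  also have "(\<Sum>j\<in>J. \<Sum>k\<in>J. (norm (c k))\<^sup>2 * ?K j k / 2)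
      = (\<Sum>j\<in>J. \<Sum>k\<in>J. (norm (c j))\<^sup>2 * ?K j k / 2)"
  proof -
    have "norm (K (- x)) = norm (K x)" for x
    proof -
      define g where "g = (\<lambda>t. of_real (1 - \<bar>t\<bar> / V) * exp (\<i> * of_real (x * t)) :: complex)"
      have "K (- x) = integral {-V..V} (\<lambda>t. g (- t))" by (simp add: K_def g_def)
      also have "\<dots> = K x" using Henstock_Kurzweil_Integration.integral_reflect_real[where a = "-V" and b = V and f = g] by (simp add: K_def g_def)
      finally show ?thesis by simp
    qed
    from this[of "l i - l j" for i j] have sym: "norm (K (l j - l i)) = norm (K (l i - l j))" for i j by simp
    show ?thesis
      by (subst sum.swap, intro sum.cong refl) (metis (no_types) abs_minus_commute sym)
  qed
  also have "(\<Sum>j\<in>J. \<Sum>k\<in>J. (norm (c j))\<^sup>2 * ?K j k / 2)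
      \<le> (\<Sum>j\<in>J. (norm (c j))\<^sup>2 * (8 * U * B j) / 2)"
  proof (intro sum_mono)
    fix j assume j: "j \<in> J"
    have "(\<Sum>k\<in>J. (norm (c j))\<^sup>2 * ?K j k / 2)
        = (norm (c j))\<^sup>2 * (\<Sum>k\<in>{k\<in>J. \<bar>l j - l k\<bar> \<le> 1}. norm (K (l j - l k))) / 2"
      using J by (simp add: sum.inter_filter sum_distrib_left sum_divide_distrib)
    also have "\<dots> \<le> (norm (c j))\<^sup>2 * (8 * U * B j) / 2"
      by (intro divide_right_mono mult_left_mono near j) auto
    finally show "(\<Sum>k\<in>J. (norm (c j))\<^sup>2 * ?K j k / 2)
      \<le> (norm (c j))\<^sup>2 * (8 * U * B j) / 2" .
  qed
  finally have "integral {-V..V} (\<lambda>t. ?W t)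
     \<le> 8 * U * (\<Sum>j\<in>J. (norm (c j))\<^sup>2 * B j) + 2 / U * (\<Sum>j\<in>J. norm (c j))\<^sup>2"
    by (simp add: sum_distrib_left sum_divide_distrib mult_ac flip: sum.distrib)
  with half show ?thesis unfolding S_def by simp
qed

subsection \<open>Beurling integers in short intervals\<close>

text \<open>Going through the real logarithm makes this the exponential of a linear function of s,
  hence entire in s; for x > 0 it agrees with complex \<open>powr\<close>.\<close>

definition cpow :: "real \<Rightarrow> complex \<Rightarrow> complex" where
  "cpow x s = exp (s * of_real (ln x))"

lemma norm_cpow: "x > 0 \<Longrightarrow> norm (cpow x s) = x powr Re s"
  by (simp add: cpow_def powr_def mult.commute)

lemma cpow_mult: "x > 0 \<Longrightarrow> y > 0 \<Longrightarrow> cpow (x * y) s = cpow x s * cpow y s"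
  by (simp add: cpow_def ln_mult algebra_simps exp_add)

lemma cpow_1 [simp]: "cpow 1 s = 1" "cpow x 0 = 1"
  by (simp_all add: cpow_def)

lemma cpow_add: "cpow x (s + t) = cpow x s * cpow x t"
  by (simp add: cpow_def algebra_simps exp_add)

lemma cpow_of_real: "x > 0 \<Longrightarrow> cpow x (of_real t) = of_real (x powr t)"
  by (simp add: cpow_def powr_def exp_of_real mult.commute flip: of_real_mult)

text \<open>Separates size from oscillation on a vertical line: a Dirichlet polynomial becomes an
  exponential sum in t with frequencies - ln x.\<close>

lemma cpow_complex: "x > 0 \<Longrightarrow> cpow x (- Complex a t) = of_real (x powr (- a)) * exp (\<i> * of_real (- ln x * t))"
proof -
  assume "x > 0"
  have "- Complex a t = of_real (-a) + - \<i> * of_real t" by (simp add: complex_eq_iff)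
  then show ?thesis using \<open>x > 0\<close> by (simp only: cpow_add cpow_of_real) (simp add: cpow_def algebra_simps)
qed

lemma powr_complex_eq_cpow: "x > 0 \<Longrightarrow> complex_of_real x powr s = cpow x s"
  by (simp add: powr_def cpow_def Ln_of_real)

lemma holomorphic_on_cpow [holomorphic_intros]:
  "f holomorphic_on S \<Longrightarrow> (\<lambda>s. cpow x (f s)) holomorphic_on S"
  unfolding cpow_def by (intro holomorphic_intros)

lemma continuous_on_cpow [continuous_intros]:
  "continuous_on S f \<Longrightarrow> continuous_on S (\<lambda>s. cpow x (f s))"
  unfolding cpow_def by (intro continuous_intros)

text \<open>The derivative of exp has modulus at most 1 on the convex half-plane Re \<le> 0, so exp
  is 1-Lipschitz there.\<close>

lemma norm_exp_diff_le:
  assumes "Re w \<le> 0" "Re z \<le> 0"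
  shows "norm (exp w - exp z) \<le> norm (w - z)"
proof -
  have "convex {w. Re w \<le> 0}" by (rule convex_halfspace_Re_le)
  from field_differentiable_bound[OF this, of exp exp 1 w z] assms show ?thesis
    by (auto intro: DERIV_exp has_field_derivative_at_within)
qed

lemma norm_cpow_diff_le:
  assumes "Re s \<ge> 0" "x \<ge> 1" "y \<ge> 1"
  shows "norm (cpow x (-s) - cpow y (-s)) \<le> norm s * \<bar>ln x - ln y\<bar>"
proof -
  have "norm (cpow x (-s) - cpow y (-s)) \<le> norm (- s * of_real (ln x) - - s * of_real (ln y))"
    unfolding cpow_def by (rule norm_exp_diff_le) (use assms in auto)
  also have "- s * of_real (ln x) - - s * of_real (ln y) = - s * of_real (ln x - ln y)"
    by (simp add: algebra_simps)
  finally show ?thesis by (simp only: norm_mult norm_minus_cancel norm_of_real)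
qed

lemma has_integral_cpow:
  assumes "0 < y" "y \<le> z" "s \<noteq> 1"
  shows "((\<lambda>x. cpow x (-s)) has_integral (cpow z (1 - s) - cpow y (1 - s)) / (1 - s)) {y..z}"
proof -
  have "((\<lambda>x. cpow x (-s)) has_integral (cpow z (1 - s) / (1 - s) - cpow y (1 - s) / (1 - s))) {y..z}"
  proof (rule fundamental_theorem_of_calculus)
    fix x assume x: "x \<in> {y..z}"
    then have "x > 0" using assms by auto
    have "((\<lambda>x. (1 - s) * of_real (ln x)) has_vector_derivative (1 - s) * of_real (1 / x)) (at x within {y..z})"
      by (intro has_vector_derivative_mult_right has_vector_derivative_of_real)
         (use \<open>x > 0\<close> in \<open>auto intro!: derivative_eq_intros simp: has_real_derivative_iff_has_vector_derivative[symmetric]\<close>)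
    then have "((exp \<circ> (\<lambda>x. (1 - s) * of_real (ln x))) has_vector_derivative ((1 - s) * of_real (1 / x)) * exp ((1 - s) * of_real (ln x))) (at x within {y..z})"
      by (rule field_vector_diff_chain_within) (auto intro: has_field_derivative_at_within DERIV_exp)
    then have "((\<lambda>x. cpow x (1 - s)) has_vector_derivative ((1 - s) * of_real (1 / x)) * cpow x (1 - s)) (at x within {y..z})"
      by (simp add: cpow_def o_def)
    from has_vector_derivative_divide[OF this, of "1 - s"]
    have "((\<lambda>x. cpow x (1 - s) / (1 - s)) has_vector_derivative of_real (1 / x) * cpow x (1 - s)) (at x within {y..z})"
      using assms by simp
    moreover have "of_real (1 / x) * cpow x (1 - s) = cpow x (-s)"
      using \<open>x > 0\<close> cpow_add[of x 1 "-s"] cpow_of_real[of x 1] by simp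
    ultimately show "((\<lambda>x. cpow x (1 - s) / (1 - s)) has_vector_derivative cpow x (-s)) (at x within {y..z})" by simp
  qed (use assms in auto)
  then show ?thesis by (simp add: diff_divide_distrib)
qed

text \<open>The quotient is the integral of \<open>cpow x (-s)\<close> over [y, z]; the integrand is
  frozen at the left end y.\<close>

lemma cpow_integral_approx:
  assumes "1 \<le> y" "y \<le> z" "s \<noteq> 1" "Re s \<ge> 0"
  shows "norm ((cpow z (1 - s) - cpow y (1 - s)) / (1 - s) - of_real (z - y) * cpow y (-s))
      \<le> norm s * (ln z - ln y) * (z - y)"
proof -
  have "((\<lambda>x. cpow x (-s) - cpow y (-s)) has_integral
     ((cpow z (1 - s) - cpow y (1 - s)) / (1 - s) - (z - y) *\<^sub>R cpow y (-s))) {y..z}"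
    using has_integral_diff[OF has_integral_cpow[of y z s] has_integral_const_real[of "cpow y (-s)" y z]] assms by simp
  note int = this
  have "norm ((cpow z (1 - s) - cpow y (1 - s)) / (1 - s) - (z - y) *\<^sub>R cpow y (-s))
     \<le> norm s * (ln z - ln y) * measure lborel {y..z}"
  proof (rule has_integral_bound_real[OF _ finite.emptyI int], goal_cases)
    case (2 x)
    then have x: "x \<in> {y..z}" by simp
    have "norm (cpow x (-s) - cpow y (-s)) \<le> norm s * \<bar>ln x - ln y\<bar>"
      by (rule norm_cpow_diff_le) (use x assms in auto)
    also have "\<dots> \<le> norm s * (ln z - ln y)" using x assms by (intro mult_left_mono) auto
    finally show ?case .
  qed (use assms in auto)
  then show ?thesis using assms by (simp add: scaleR_conv_of_real)
qed

text \<open>Geometric series together with 1 - exp (- a) \<ge> a / (1 + a), which is exp a \<ge> 1 +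
  a rearranged. The bound behaves like 1 / a for small a, as fine grids require.\<close>

lemma geometric_exp_bound:
  fixes a :: real assumes "a > 0"
  shows "(\<Sum>m<K. exp (- a * real m)) \<le> (1 + a) / a"
proof -
  have e: "exp (-a) < 1" using assms by simp
  have "(\<Sum>m<K. exp (- a * real m)) = (\<Sum>m<K. exp (-a) ^ m)"
    by (simp add: exp_of_nat_mult mult.commute flip: exp_of_nat_mult)
  also have "\<dots> \<le> (\<Sum>m. exp (-a) ^ m)" by (intro sum_le_suminf summable_geometric) (use e in auto)
  also have "\<dots> = 1 / (1 - exp (-a))" using e by (simp add: suminf_geometric)
  also have "\<dots> \<le> (1 + a) / a"
  proof -
    have "exp (-a) * (1 + a) \<le> exp (-a) * exp a" by (intro mult_left_mono exp_ge_add_one_self) auto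
    then show ?thesis using assms e by (simp add: field_simps exp_minus)
  qed
  finally show ?thesis .
qed

text \<open>For geometric weights the differences are again multiples of the weights: a m - a (m +
  1) = (1 - q) a m. With weights \<open>cpow\<close> at grid points, 1 - q is of size |s| \<eta>,
  which offsets the roughly 1 / \<eta> grid points per unit of logarithm.\<close>

lemma abel_geometric:
  fixes a E :: "nat \<Rightarrow> 'a :: comm_ring_1"
  assumes "\<And>m. a (Suc m) = q * a m"
  shows "(\<Sum>m<K. (E (Suc m) - E m) * a m) = E K * a K - E 0 * a 0 + (1 - q) * (\<Sum>m<K. E (Suc m) * a m)"
  by (induction K) (simp_all add: assms algebra_simps)

section \<open>Generalized integers as multisets of prime indices\<close>

definition nrm :: "(nat \<Rightarrow> real) \<Rightarrow> nat multiset \<Rightarrow> real" where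
  "nrm p m = (\<Prod>i\<in>#m. p i)"

lemma nrm_empty [simp]: "nrm p {#} = 1"
  and nrm_add: "nrm p (m + k) = nrm p m * nrm p k"
  by (simp_all add: nrm_def)

text \<open>Multisets of indices replace the sequence n: multiplication is the sum of multisets and
  divisibility is \<open>\<subseteq>#\<close>. The error bound is asked for all x \<ge> 1 with a
  single constant, so that everything below is free of asymptotic notation.\<close>

locale beurling =
  fixes p :: "nat \<Rightarrow> real" and A \<theta> c0 :: real
  assumes p_gt_1: "\<And>i. 1 < p i"
    and A_pos: "A > 0" and th_nonneg: "0 \<le> \<theta>" and th_less: "\<theta> < 1" and c0: "c0 \<ge> 1"
    and finite_nrm_le [simp]: "\<And>x. finite {m. nrm p m \<le> x}"
    and count_bound: "\<And>x. x \<ge> 1 \<Longrightarrow> \<bar>real (card {m. nrm p m \<le> x}) - A * x\<bar> \<le> c0 * x powr \<theta>"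
begin

abbreviation "nm \<equiv> nrm p"

abbreviation crit :: real where "crit \<equiv> (1 + \<theta>) / 2"

definition N :: "real \<Rightarrow> real" where "N x = real (card {m. nm m \<le> x})"
definition E :: "real \<Rightarrow> real" where "E x = N x - A * x"

lemma nm_ge_1: "nm m \<ge> 1"
proof (induction m)
  case (add i m)
  have "1 * 1 \<le> p i * nm m" using add p_gt_1[of i] by (intro mult_mono) auto
  then show ?case by (simp add: nrm_def)
qed simp

lemma nm_pos [simp]: "nm m > 0" using nm_ge_1[of m] by linarith

lemma nm_gt_1:
  assumes "m \<noteq> {#}"
  shows "nm m > 1"
proof -
  obtain i m' where m: "m = add_mset i m'" using assms by (cases m) auto
  have "1 * nm m' < p i * nm m'" using p_gt_1 by (intro mult_strict_right_mono) auto
  then have "1 < p i * nm m'" using nm_ge_1[of m'] by linarith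
  then show ?thesis by (simp add: m nrm_def)
qed

lemma finite_nm_between [simp]: "finite {m. y < nm m \<and> nm m \<le> z}"
  by (rule finite_subset[OF _ finite_nrm_le[of z]]) auto

lemma E_bound: "x \<ge> 1 \<Longrightarrow> \<bar>E x\<bar> \<le> c0 * x powr \<theta>"
  using count_bound by (simp add: E_def N_def)

lemma N_diff: "y \<le> z \<Longrightarrow> real (card {m. y < nm m \<and> nm m \<le> z}) = N z - N y"
proof -
  assume "y \<le> z"
  then have "{m. nm m \<le> z} = {m. nm m \<le> y} \<union> {m. y < nm m \<and> nm m \<le> z}" by auto
  moreover have "card \<dots> = card {m. nm m \<le> y} + card {m. y < nm m \<and> nm m \<le> z}"
    by (rule card_Un_disjoint) auto
  ultimately show ?thesis by (simp add: N_def)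
qed

lemma N_le: "x \<ge> 1 \<Longrightarrow> N x \<le> (A + c0) * x"
proof -
  assume x: "x \<ge> 1"
  have "N x \<le> A * x + c0 * x powr \<theta>" using E_bound[OF x] by (simp add: E_def)
  also have "x powr \<theta> \<le> x powr 1" using x th_less by (intro powr_mono) auto
  finally show ?thesis using x c0 by (simp add: algebra_simps)
qed

text \<open>For y \<ge> 1 both errors are of size \<open>z powr \<theta>\<close>. Below 1 there are
  no integers, and A y is absorbed since \<open>z powr \<theta>\<close> \<ge> 1. Shells around small
  integers do reach below 1.\<close>

lemma N_diff_le:
  assumes "0 < y" "y \<le> z" "1 \<le> z"
  shows "N z - N y \<le> A * (z - y) + (2 * c0 + A) * z powr \<theta>"
proof (cases "y \<ge> 1")
  case True
  have "y powr \<theta> \<le> z powr \<theta>" using assms th_nonneg by (intro powr_mono2) auto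
  then have "c0 * y powr \<theta> \<le> c0 * z powr \<theta>" using c0 by simp
  moreover have "A * z powr \<theta> \<ge> 0" using A_pos by simp
  ultimately show ?thesis using E_bound[OF True] E_bound[OF assms(3)] by (simp add: E_def algebra_simps)
next
  case False
  have "{m. nm m \<le> y} = {}" using nm_ge_1 False by (smt (verit) empty_Collect_eq)
  then have "N y = 0" by (simp add: N_def)
  moreover have "1 \<le> z powr \<theta>" using assms th_nonneg by (simp add: ge_one_powr_ge_zero)
  then have "A * y \<le> A * z powr \<theta>" using False A_pos by (intro mult_left_mono) auto
  moreover have "c0 * z powr \<theta> \<ge> 0" using c0 by simp
  ultimately show ?thesis using E_bound[OF assms(3)] by (simp add: E_def algebra_simps)
qed

text \<open>On the logarithmic scale a shell consists of two intervals of length 1 / U, one on each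
  side of \<open>ln x\<close>. As their distance from \<open>ln x\<close> is at most 1, they become
  intervals of length O(x / U) within a constant factor of x.\<close>

lemma card_shell_le:
  assumes x: "x \<ge> 1" and U: "U \<ge> 1"
  shows "real (card {k \<in> J. \<bar>ln x - ln (nm k)\<bar> \<le> 1 \<and> real r \<le> U * \<bar>ln x - ln (nm k)\<bar> \<and> U * \<bar>ln x - ln (nm k)\<bar> < real r + 1})
    \<le> (A * (2 * exp 3 + 1) + (2 * c0 + A) * (exp 2 + 1)) * (x / U + x powr \<theta>)" (is "real (card ?S) \<le> ?C * _")
proof (cases "?S = {}")
  case True
  have "?C * (x / U + x powr \<theta>) \<ge> 0" using A_pos c0 x U by (intro mult_nonneg_nonneg add_nonneg_nonneg) auto
  then show ?thesis unfolding True by simp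
next
  case False
  then obtain k where k: "\<bar>ln x - ln (nm k)\<bar> \<le> 1" "real r \<le> U * \<bar>ln x - ln (nm k)\<bar>" by auto
  have "U * \<bar>ln x - ln (nm k)\<bar> \<le> U * 1" using k U by (intro mult_left_mono) auto
  then have "real r \<le> U" using k(2) by linarith
  then have rU: "real r / U \<le> 1" using U by (simp add: field_simps)
  define \<rho> where "\<rho> = real r / U"
  have \<rho>: "\<rho> \<ge> 0" "\<rho> \<le> 1" using U rU by (auto simp: \<rho>_def)
  define u where "u = 1 / U"
  have u: "u > 0" "u \<le> 1" using U by (auto simp: u_def)
  \<comment> \<open>\<open>y1\<close> lies an extra u below the right-hand interval: the counted
    interval is open at its lower end, whereas the shell contains its lower end \<rho>.\<close>
  define z1 y1 z2 y2 where "z1 = x * exp (\<rho> + u)" "y1 = x * exp (\<rho> - u)" "z2 = x * exp (- \<rho>)" "y2 = x * exp (- \<rho> - u)"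
  note defs = this
  have pos: "0 < y1" "0 < y2" "y1 \<le> z1" "y2 \<le> z2" using x u by (auto simp: defs)
  have "?S \<subseteq> {m. y1 < nm m \<and> nm m \<le> z1} \<union> {m. y2 < nm m \<and> nm m \<le> z2}"
  proof
    fix k assume k: "k \<in> ?S"
    define v where "v = ln (nm k) - ln x"
    have nk: "nm k = x * exp v" using x by (simp add: v_def exp_diff)
    have v: "\<rho> \<le> \<bar>v\<bar>" "\<bar>v\<bar> < \<rho> + u"
      using k U by (auto simp: v_def \<rho>_def u_def field_simps abs_minus_commute)
    show "k \<in> {m. y1 < nm m \<and> nm m \<le> z1} \<union> {m. y2 < nm m \<and> nm m \<le> z2}"
    proof (cases "v \<ge> 0")
      case True
      then have "y1 < nm k \<and> nm k \<le> z1" using v u x by (auto simp: nk defs)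
      then show ?thesis by simp
    next
      case False
      then have "y2 < nm k \<and> nm k \<le> z2" using v u x by (auto simp: nk defs)
      then show ?thesis by simp
    qed
  qed
  then have "card ?S \<le> card ({m. y1 < nm m \<and> nm m \<le> z1} \<union> {m. y2 < nm m \<and> nm m \<le> z2})"
    by (intro card_mono) auto
  also have "\<dots> \<le> card {m. y1 < nm m \<and> nm m \<le> z1} + card {m. y2 < nm m \<and> nm m \<le> z2}" by (rule card_Un_le)
  finally have "real (card ?S) \<le> (N z1 - N y1) + (N z2 - N y2)"
    using N_diff[OF pos(3)] N_diff[OF pos(4)] by linarith
  also have "N z1 - N y1 \<le> A * (2 * exp 3) * (x / U) + (2 * c0 + A) * (exp 2 * x powr \<theta>)"
  proof -
    have z1: "1 \<le> z1" using x \<rho> u mult_mono[of 1 x 1 "exp (\<rho> + u)"] by (auto simp: defs)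
    have "exp (2 * u) - 1 \<le> 2 * u * exp (2 * u)"
    proof -
      have "exp (2*u) * (1 + - (2 * u)) \<le> exp (2*u) * exp (-(2*u))" by (intro mult_left_mono exp_ge_add_one_self) auto
      then show ?thesis by (simp add: exp_minus algebra_simps)
    qed
    also have "\<dots> \<le> 2 * u * exp 2" using u by simp
    finally have "x * exp (\<rho> - u) * (exp (2 * u) - 1) \<le> x * exp 1 * (2 * u * exp 2)"
      using x u \<rho> by (intro mult_mono) auto
    then have "z1 - y1 \<le> x * exp 1 * (2 * u * exp 2)"
      by (simp add: defs algebra_simps flip: exp_add)
    also have "\<dots> = 2 * exp 3 * (x / U)" by (simp add: u_def flip: exp_add)
    finally have "A * (z1 - y1) \<le> A * (2 * exp 3 * (x / U))" using A_pos by (intro mult_left_mono) auto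
    moreover have "z1 powr \<theta> \<le> exp 2 * x powr \<theta>"
    proof -
      have "z1 powr \<theta> = exp (\<rho> + u) powr \<theta> * x powr \<theta>" using x by (simp add: defs powr_mult)
      moreover have "exp (\<rho> + u) powr \<theta> \<le> exp (\<rho> + u) powr 1" using \<rho> u th_less by (intro powr_mono) auto
      moreover have "exp (\<rho> + u) powr 1 \<le> exp 2" using \<rho> u by simp
      ultimately have "exp (\<rho> + u) powr \<theta> \<le> exp 2" by linarith
      then show ?thesis unfolding \<open>z1 powr \<theta> = _\<close> by (intro mult_right_mono) auto
    qed
    then have "(2 * c0 + A) * z1 powr \<theta> \<le> (2 * c0 + A) * (exp 2 * x powr \<theta>)" using c0 A_pos by (intro mult_left_mono) auto
    ultimately show ?thesis using N_diff_le[OF pos(1) pos(3) z1] by (simp add: mult.assoc)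
  qed
  also have "N z2 - N y2 \<le> A * (x / U) + (2 * c0 + A) * x powr \<theta>"
  proof (cases "z2 \<ge> 1")
    case True
    have "z2 - y2 = z2 * (1 - exp (- u))" by (simp add: defs algebra_simps flip: exp_add)
    also have "\<dots> \<le> x * u"
      using x \<rho> u exp_ge_add_one_self[of "-u"] mult_left_le[of "exp (- \<rho>)" x] by (intro mult_mono) (auto simp: defs)
    finally have "A * (z2 - y2) \<le> A * (x / U)" using A_pos by (intro mult_left_mono) (auto simp: u_def)
    moreover have "z2 powr \<theta> \<le> x powr \<theta>" using x \<rho> th_nonneg mult_left_le[of "exp (- \<rho>)" x] by (intro powr_mono2) (auto simp: defs)
    then have "(2 * c0 + A) * z2 powr \<theta> \<le> (2 * c0 + A) * x powr \<theta>" using c0 A_pos by (intro mult_left_mono) auto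
    ultimately show ?thesis using N_diff_le[OF pos(2) pos(4) True] by linarith
  next
    case False
    then have "{m. nm m \<le> z2} = {}" using nm_ge_1 by (smt (verit) empty_Collect_eq)
    then have "N z2 = 0" by (simp add: N_def)
    moreover have "N y2 \<ge> 0" by (simp add: N_def)
    moreover have "A * (x / U) + (2 * c0 + A) * x powr \<theta> \<ge> 0" using A_pos c0 x U by simp
    ultimately show ?thesis by linarith
  qed
  finally have *: "real (card ?S) \<le> A * (2 * exp 3 + 1) * (x / U) + (2 * c0 + A) * (exp 2 + 1) * x powr \<theta>"
    by (simp add: algebra_simps)
  have "0 \<le> A * (2 * exp 3 + 1) * x powr \<theta>" "0 \<le> (2 * c0 + A) * (exp 2 + 1) * (x / U)"
    using A_pos c0 x U by auto
  with * show ?thesis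
    unfolding distrib_left[of _ "x / U"] distrib_right[of "A * (2 * exp 3 + 1)"] by linarith
qed

text \<open>The shell count n / U + n^\<theta> enters the general inequality multiplied by U, which
  produces the weight n + U n^\<theta>. Well spaced integers would give n + U.\<close>

lemma mean_square_dirichlet:
  obtains C where "C > 0" "\<And>J c U. finite J \<Longrightarrow> U \<ge> 1 \<Longrightarrow>
     integral {-U..U} (\<lambda>t. (norm (\<Sum>m\<in>J. c m * exp (\<i> * of_real (- ln (nm m) * t))))\<^sup>2)
      \<le> C * ((\<Sum>m\<in>J. (norm (c m))\<^sup>2 * (nm m + U * nm m powr \<theta>)) + (\<Sum>m\<in>J. norm (c m))\<^sup>2 / U)"
proof
  define B where "B = A * (2 * exp 3 + 1) + (2 * c0 + A) * (exp 2 + 1)"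
  have B: "B > 0" using A_pos c0 by (auto simp: B_def intro!: add_pos_pos mult_pos_pos)
  show "16 * B + 4 > 0" using B by simp
  fix J :: "nat multiset set" and c :: "nat multiset \<Rightarrow> complex" and U :: real
  assume J: "finite J" and U: "U \<ge> 1"
  have "integral {-U..U} (\<lambda>t. (norm (\<Sum>m\<in>J. c m * exp (\<i> * of_real (- ln (nm m) * t))))\<^sup>2)
     \<le> 16 * U * (\<Sum>m\<in>J. (norm (c m))\<^sup>2 * (B * (nm m / U + nm m powr \<theta>))) + 4 / U * (\<Sum>m\<in>J. norm (c m))\<^sup>2"
    using card_shell_le[OF nm_ge_1 U]
    by (intro mean_square_exponential_sum J) (use U in \<open>auto simp: B_def abs_minus_commute add.commute\<close>)
  also have "16 * U * (\<Sum>m\<in>J. (norm (c m))\<^sup>2 * (B * (nm m / U + nm m powr \<theta>)))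
       = 16 * B * (\<Sum>m\<in>J. (norm (c m))\<^sup>2 * (nm m + U * nm m powr \<theta>))"
    unfolding sum_distrib_left using U by (intro sum.cong) (auto simp: field_simps)
  finally have *: "integral {-U..U} (\<lambda>t. (norm (\<Sum>m\<in>J. c m * exp (\<i> * of_real (- ln (nm m) * t))))\<^sup>2)
     \<le> 16 * B * (\<Sum>m\<in>J. (norm (c m))\<^sup>2 * (nm m + U * nm m powr \<theta>)) + 4 * ((\<Sum>m\<in>J. norm (c m))\<^sup>2 / U)" by simp
  have "(\<Sum>m\<in>J. (norm (c m))\<^sup>2 * (nm m + U * nm m powr \<theta>)) \<ge> 0"
    by (intro sum_nonneg mult_nonneg_nonneg add_nonneg_nonneg) (use U in \<open>auto simp: less_imp_le\<close>)
  moreover have "16 * B * ((\<Sum>m\<in>J. norm (c m))\<^sup>2 / U) \<ge> 0" using B U by simp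
  ultimately show "integral {-U..U} (\<lambda>t. (norm (\<Sum>m\<in>J. c m * exp (\<i> * of_real (- ln (nm m) * t))))\<^sup>2)
      \<le> (16 * B + 4) * ((\<Sum>m\<in>J. (norm (c m))\<^sup>2 * (nm m + U * nm m powr \<theta>)) + (\<Sum>m\<in>J. norm (c m))\<^sup>2 / U)"
    using * unfolding distrib_left distrib_right by linarith
qed

end

subsection \<open>Analytic continuation of the zeta function\<close>

lemma tendsto_Suc_powr_neg:
  assumes "a < 0"
  shows "(\<lambda>k. c * real (Suc k) powr a) \<longlonglongrightarrow> 0"
  by (intro tendsto_mult_right_zero tendsto_neg_powr[OF assms]
      filterlim_compose[OF filterlim_real_sequentially filterlim_Suc])

section \<open>Tails of the Dirichlet series by summation by parts\<close>

context beurling begin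

text \<open>The Stieltjes integral of x^(-s) against d(N(x) - A x) over (y, z], with its smooth part
  integrated in closed form.\<close>

definition D :: "real \<Rightarrow> real \<Rightarrow> complex \<Rightarrow> complex" where
  "D y z s = (\<Sum>m | y < nm m \<and> nm m \<le> z. cpow (nm m) (-s)) - of_real A * ((cpow z (1 - s) - cpow y (1 - s)) / (1 - s))"

lemma D_refl [simp]: "D y y s = 0"
proof -
  have "{m. y < nm m \<and> nm m \<le> y} = {}" by auto
  then show ?thesis by (simp only: D_def) simp
qed

lemma D_split:
  assumes "y \<le> x" "x \<le> z"
  shows "D y z s = D y x s + D x z s"
proof -
  have "{m. y < nm m \<and> nm m \<le> z} = {m. y < nm m \<and> nm m \<le> x} \<union> {m. x < nm m \<and> nm m \<le> z}"
    using assms by auto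
  then have "(\<Sum>m | y < nm m \<and> nm m \<le> z. cpow (nm m) (-s)) =
     (\<Sum>m | y < nm m \<and> nm m \<le> x. cpow (nm m) (-s)) + (\<Sum>m | x < nm m \<and> nm m \<le> z. cpow (nm m) (-s))"
    by (simp only:) (rule sum.union_disjoint, auto)
  then show ?thesis by (simp add: D_def diff_divide_distrib algebra_simps)
qed

text \<open>On a short block x^(-s) is replaced by its value at the left end, in the sum and in the
  integral alike; what remains is the increment of E. The error is proportional to the mass of the
  block, so over a grid the errors add up to the total mass times the common logarithmic
  step.\<close>

lemma D_block:
  assumes "1 \<le> y" "y \<le> z" "s \<noteq> 1" "Re s \<ge> 0"
  shows "norm (D y z s - of_real (E z - E y) * cpow y (-s)) \<le> norm s * (ln z - ln y) * ((N z - N y) + A * (z - y))"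
proof -
  let ?S = "{m. y < nm m \<and> nm m \<le> z}"
  have 1: "norm (\<Sum>m\<in>?S. cpow (nm m) (-s) - cpow y (-s)) \<le> real (card ?S) * (norm s * (ln z - ln y))"
  proof (rule sum_norm_bound)
    fix m assume m: "m \<in> ?S"
    have "norm (cpow (nm m) (-s) - cpow y (-s)) \<le> norm s * \<bar>ln (nm m) - ln y\<bar>"
      by (rule norm_cpow_diff_le) (use m assms in auto)
    also have "\<dots> \<le> norm s * (ln z - ln y)" using m assms by (intro mult_left_mono) auto
    finally show "norm (cpow (nm m) (-s) - cpow y (-s)) \<le> norm s * (ln z - ln y)" .
  qed
  have 2: "norm (of_real A * ((cpow z (1 - s) - cpow y (1 - s)) / (1 - s) - of_real (z - y) * cpow y (-s)))
      \<le> A * (norm s * (ln z - ln y) * (z - y))"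
    unfolding norm_mult norm_of_real using A_pos cpow_integral_approx[OF assms] by (simp add: norm_mult)
  have "D y z s - of_real (E z - E y) * cpow y (-s) = (\<Sum>m\<in>?S. cpow (nm m) (-s) - cpow y (-s))
     - of_real A * ((cpow z (1 - s) - cpow y (1 - s)) / (1 - s) - of_real (z - y) * cpow y (-s))"
  proof -
    have card: "of_nat (card ?S) = complex_of_real (N z - N y)"
      using N_diff[OF assms(2)] by (metis of_real_of_nat_eq)
    show ?thesis by (simp only: D_def sum_subtractf sum_constant card) (simp add: E_def algebra_simps)
  qed
  also have "norm \<dots> \<le> real (card ?S) * (norm s * (ln z - ln y)) + A * (norm s * (ln z - ln y) * (z - y))"
    by (intro order.trans[OF norm_triangle_ineq4] add_mono 1 2)
  finally show ?thesis using N_diff[OF assms(2)] by (simp add: algebra_simps)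
qed

text \<open>Values of N(x) - A x on a geometric grid of ratio exp \<eta> serve as coefficients in a summation by parts.
  The grid can be taken so fine that replacing integers by grid points costs nothing.\<close>
context
  fixes y \<eta> :: real and Y :: "nat \<Rightarrow> real"
  assumes y: "y \<ge> 1" and eta: "\<eta> > 0"
  defines "Y \<equiv> \<lambda>m. y * exp (\<eta> * real m)"
begin

lemma Y_0: "Y 0 = y" and Y_Suc: "Y (Suc m) = exp \<eta> * Y m"
  by (simp_all add: Y_def algebra_simps exp_add)

lemma Y_ge_1: "Y m \<ge> 1" and Y_ge: "Y m \<ge> y" and Y_mono: "Y m \<le> Y (Suc m)"
proof -
  have "y * 1 \<le> y * exp (\<eta> * real m)" using y eta by (intro mult_left_mono) auto
  then show "Y m \<ge> y" by (simp add: Y_def)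
  then show "Y m \<ge> 1" using y by simp
  show "Y m \<le> Y (Suc m)" using y eta by (auto simp: Y_def intro!: mult_left_mono)
qed

lemma ln_Y: "ln (Y m) = ln y + \<eta> * real m"
  using y by (simp add: Y_def ln_mult)

lemma cpow_Y_Suc: "cpow (Y (Suc m)) (-s) = exp (- s * of_real \<eta>) * cpow (Y m) (-s)"
  by (simp only: cpow_def ln_Y) (simp add: algebra_simps exp_add exp_diff exp_minus divide_simps)

lemma D_grid:
  assumes "s \<noteq> 1" "Re s \<ge> 0"
  shows "norm (D y (Y K) s - (\<Sum>m<K. (of_real (E (Y (Suc m))) - of_real (E (Y m))) * cpow (Y m) (-s)))
     \<le> norm s * \<eta> * ((N (Y K) - N y) + A * (Y K - y))"
proof (induction K)
  case 0
  then show ?case by (simp add: Y_0)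
next
  case (Suc K)
  have "D y (Y (Suc K)) s = D y (Y K) s + D (Y K) (Y (Suc K)) s"
    by (rule D_split) (use Y_ge Y_mono in auto)
  then have "D y (Y (Suc K)) s - (\<Sum>m<Suc K. (of_real (E (Y (Suc m))) - of_real (E (Y m))) * cpow (Y m) (-s))
    = (D y (Y K) s - (\<Sum>m<K. (of_real (E (Y (Suc m))) - of_real (E (Y m))) * cpow (Y m) (-s)))
     + (D (Y K) (Y (Suc K)) s - of_real (E (Y (Suc K)) - E (Y K)) * cpow (Y K) (-s))"
    by simp
  also have "norm \<dots> \<le> norm s * \<eta> * ((N (Y K) - N y) + A * (Y K - y))
     + norm s * (ln (Y (Suc K)) - ln (Y K)) * ((N (Y (Suc K)) - N (Y K)) + A * (Y (Suc K) - Y K))"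
    by (intro order.trans[OF norm_triangle_ineq] add_mono Suc.IH D_block Y_ge_1 Y_mono assms)
  also have "ln (Y (Suc K)) - ln (Y K) = \<eta>" by (simp add: ln_Y algebra_simps)
  finally show ?case by (simp add: algebra_simps)
qed

lemma E_cpow_bound: "norm (of_real (E (Y m)) * cpow (Y m) (-s)) \<le> c0 * Y m powr (\<theta> - Re s)"
proof -
  have "norm (of_real (E (Y m)) * cpow (Y m) (-s)) = \<bar>E (Y m)\<bar> * Y m powr (- Re s)"
    using Y_ge_1[of m] by (simp add: norm_mult norm_cpow)
  also have "\<dots> \<le> c0 * Y m powr \<theta> * Y m powr (- Re s)"
    by (intro mult_right_mono E_bound Y_ge_1) auto
  also have "\<dots> = c0 * Y m powr (\<theta> - Re s)" by (simp add: powr_add[symmetric])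
  finally show ?thesis .
qed

text \<open>Abel summation moves the differences from E to the geometric weights. The first error
  consists of the two boundary terms, the second is the discretization, which vanishes with \<eta>
  when the end point \<open>Y K\<close> is fixed. The main sum is kept because it is estimated
  twice: pointwise for the continuation, and in mean square on the left line.\<close>

lemma D_main:
  assumes "s \<noteq> 1" "Re s \<ge> \<theta>"
  shows "norm (D y (Y K) s - (1 - exp (- s * of_real \<eta>)) * (\<Sum>m<K. of_real (E (Y (Suc m))) * cpow (Y m) (-s)))
     \<le> 2 * c0 * y powr (\<theta> - Re s) + (2 * A + c0) * norm s * \<eta> * Y K"
proof -
  have le: "norm (of_real (E (Y m)) * cpow (Y m) (-s)) \<le> c0 * y powr (\<theta> - Re s)" for m
  proof -
    have "Y m powr (\<theta> - Re s) \<le> y powr (\<theta> - Re s)"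
      using assms y Y_ge[of m] by (intro powr_mono2') auto
    then have "c0 * Y m powr (\<theta> - Re s) \<le> c0 * y powr (\<theta> - Re s)" using c0 by simp
    with E_cpow_bound[of m s] show ?thesis by linarith
  qed
  let ?S = "\<Sum>m<K. (of_real (E (Y (Suc m))) - of_real (E (Y m))) * cpow (Y m) (-s)"
  have *: "?S - (1 - exp (- s * of_real \<eta>)) * (\<Sum>m<K. of_real (E (Y (Suc m))) * cpow (Y m) (-s))
     = of_real (E (Y K)) * cpow (Y K) (-s) - of_real (E (Y 0)) * cpow (Y 0) (-s)"
    by (subst abel_geometric[where a = "\<lambda>m. cpow (Y m) (-s)" and E = "\<lambda>m. of_real (E (Y m))", OF cpow_Y_Suc]) simp
  have "D y (Y K) s - (1 - exp (- s * of_real \<eta>)) * (\<Sum>m<K. of_real (E (Y (Suc m))) * cpow (Y m) (-s))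
     = (D y (Y K) s - ?S) + (of_real (E (Y K)) * cpow (Y K) (-s) - of_real (E (Y 0)) * cpow (Y 0) (-s))"
    using * by (simp add: algebra_simps)
  also have "norm \<dots> \<le> norm s * \<eta> * ((N (Y K) - N y) + A * (Y K - y)) + (c0 * y powr (\<theta> - Re s) + c0 * y powr (\<theta> - Re s))"
    by (intro order.trans[OF norm_triangle_ineq] add_mono D_grid order.trans[OF norm_triangle_ineq4] le)
       (use assms th_nonneg in auto)
  also have "norm s * \<eta> * ((N (Y K) - N y) + A * (Y K - y)) \<le> norm s * \<eta> * ((2 * A + c0) * Y K)"
  proof -
    have "N y \<ge> 0" "A * y \<ge> 0" using A_pos y by (auto simp: N_def)
    then have "(N (Y K) - N y) + A * (Y K - y) \<le> (2 * A + c0) * Y K"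
      using N_le[OF Y_ge_1[of K]] by (simp add: algebra_simps)
    then show ?thesis using eta by (intro mult_left_mono) auto
  qed
  finally show ?thesis by (simp add: algebra_simps)
qed

lemma E_coeff_bound:
  "\<bar>E (Y (Suc m))\<bar> * Y m powr (- \<sigma>) \<le> c0 * exp \<eta> * y powr (\<theta> - \<sigma>) * exp (- (\<eta> * (\<sigma> - \<theta>)) * real m)"
proof -
  have "\<bar>E (Y (Suc m))\<bar> * Y m powr (- \<sigma>) \<le> c0 * Y (Suc m) powr \<theta> * Y m powr (- \<sigma>)"
    by (intro mult_right_mono E_bound Y_ge_1) auto
  also have "Y (Suc m) powr \<theta> = exp \<eta> powr \<theta> * Y m powr \<theta>"
    using Y_ge_1[of m] by (simp only: Y_Suc) (simp add: powr_mult)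
  also have "c0 * (exp \<eta> powr \<theta> * Y m powr \<theta>) * Y m powr (- \<sigma>) = c0 * exp \<eta> powr \<theta> * Y m powr (\<theta> - \<sigma>)"
    by (simp add: powr_add[symmetric])
  also have "Y m powr (\<theta> - \<sigma>) = y powr (\<theta> - \<sigma>) * exp (- (\<eta> * (\<sigma> - \<theta>)) * real m)"
    using y by (simp add: Y_def powr_mult) (simp add: powr_def algebra_simps)
  also have "c0 * exp \<eta> powr \<theta> * (y powr (\<theta> - \<sigma>) * exp (- (\<eta> * (\<sigma> - \<theta>)) * real m))
     \<le> c0 * exp \<eta> powr 1 * (y powr (\<theta> - \<sigma>) * exp (- (\<eta> * (\<sigma> - \<theta>)) * real m))"
    using c0 eta th_less by (intro mult_right_mono mult_left_mono powr_mono) auto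
  finally show ?thesis by (simp add: mult.assoc)
qed

lemma norm_one_minus_exp: "Re s \<ge> 0 \<Longrightarrow> norm (1 - exp (- s * of_real \<eta>)) \<le> norm s * \<eta>"
  using norm_exp_diff_le[of 0 "- s * of_real \<eta>"] eta by (simp add: norm_mult)

lemma D_bound_eta:
  assumes "s \<noteq> 1" "Re s > \<theta>"
  shows "norm (D y (Y K) s) \<le> 2 * c0 * y powr (\<theta> - Re s) + (2 * A + c0) * norm s * \<eta> * Y K
     + norm s * (c0 * exp \<eta> * y powr (\<theta> - Re s) * ((1 + \<eta> * (Re s - \<theta>)) / (Re s - \<theta>)))"
proof -
  let ?d = "Re s - \<theta>"
  let ?P = "\<Sum>m<K. of_real (E (Y (Suc m))) * cpow (Y m) (-s)"
  have "norm ?P \<le> (\<Sum>m<K. c0 * exp \<eta> * y powr (\<theta> - Re s) * exp (- (\<eta> * ?d) * real m))"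
  proof (rule sum_norm_le)
    fix m
    have "norm (of_real (E (Y (Suc m))) * cpow (Y m) (-s)) = \<bar>E (Y (Suc m))\<bar> * Y m powr (- Re s)"
      using Y_ge_1[of m] by (simp add: norm_mult norm_cpow)
    with E_coeff_bound[of m "Re s"] show "norm (of_real (E (Y (Suc m))) * cpow (Y m) (-s)) \<le> c0 * exp \<eta> * y powr (\<theta> - Re s) * exp (- (\<eta> * ?d) * real m)"
      by simp
  qed
  also have "\<dots> = c0 * exp \<eta> * y powr (\<theta> - Re s) * (\<Sum>m<K. exp (- (\<eta> * ?d) * real m))"
    by (simp add: sum_distrib_left)
  also have "\<dots> \<le> c0 * exp \<eta> * y powr (\<theta> - Re s) * ((1 + \<eta> * ?d) / (\<eta> * ?d))"
    by (intro mult_left_mono geometric_exp_bound) (use eta assms c0 in auto)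
  finally have P: "norm ?P \<le> c0 * exp \<eta> * y powr (\<theta> - Re s) * ((1 + \<eta> * ?d) / (\<eta> * ?d))" .
  have "norm ((1 - exp (- s * of_real \<eta>)) * ?P) \<le> (norm s * \<eta>) * (c0 * exp \<eta> * y powr (\<theta> - Re s) * ((1 + \<eta> * ?d) / (\<eta> * ?d)))"
    unfolding norm_mult[of "1 - exp (- s * of_real \<eta>)"]
    by (intro mult_mono P norm_one_minus_exp) (use assms th_nonneg eta in auto)
  also have "\<dots> = norm s * (c0 * exp \<eta> * y powr (\<theta> - Re s) * ((1 + \<eta> * ?d) / ?d))"
    using eta assms by simp
  finally have "norm ((1 - exp (- s * of_real \<eta>)) * ?P) \<le> norm s * (c0 * exp \<eta> * y powr (\<theta> - Re s) * ((1 + \<eta> * ?d) / ?d))" .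
  moreover have "norm (D y (Y K) s) \<le> norm (D y (Y K) s - (1 - exp (- s * of_real \<eta>)) * ?P) + norm ((1 - exp (- s * of_real \<eta>)) * ?P)"
    using norm_triangle_sub[of "D y (Y K) s" "(1 - exp (- s * of_real \<eta>)) * ?P"] by linarith
  ultimately show ?thesis using D_main[of s K] assms by linarith
qed

end

text \<open>A grid with K + 1 equal logarithmic steps from y ends exactly at z; letting K tend to
  infinity removes the discretization error and the factor exp \<eta>. The limit is what partial
  integration of the Stieltjes integral gives: two boundary terms and |s| times the integral of c0
  x^(\<theta> - Re s - 1).\<close>

lemma D_bound:
  assumes "1 \<le> y" "y \<le> z" "s \<noteq> 1" "Re s > \<theta>"
  shows "norm (D y z s) \<le> c0 * (2 + norm s / (Re s - \<theta>)) * y powr (\<theta> - Re s)"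
proof (cases "y = z")
  case True
  then have "D y z s = 0" by simp
  then show ?thesis using c0 assms by simp
next
  case False
  define l where "l = ln z - ln y"
  have l: "l > 0" using False assms by (simp add: l_def)
  define \<eta> where "\<eta> = (\<lambda>K. l / real (Suc K))"
  have \<eta>: "\<eta> \<longlonglongrightarrow> 0" unfolding \<eta>_def by (rule LIMSEQ_Suc[OF lim_const_over_n])
  have "norm (D y z s) \<le> 2 * c0 * y powr (\<theta> - Re s) + (2 * A + c0) * norm s * \<eta> K * z
     + norm s * (c0 * exp (\<eta> K) * y powr (\<theta> - Re s) * ((1 + \<eta> K * (Re s - \<theta>)) / (Re s - \<theta>)))" for K
  proof -
    have "z = y * exp (\<eta> K * real (Suc K))"
      using assms by (simp add: \<eta>_def l_def exp_diff del: of_nat_Suc)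
    then show ?thesis using D_bound_eta[of y "\<eta> K" s "Suc K"] assms l by (simp add: \<eta>_def del: of_nat_Suc)
  qed
  moreover have "(\<lambda>K. 2 * c0 * y powr (\<theta> - Re s) + (2 * A + c0) * norm s * \<eta> K * z
     + norm s * (c0 * exp (\<eta> K) * y powr (\<theta> - Re s) * ((1 + \<eta> K * (Re s - \<theta>)) / (Re s - \<theta>))))
     \<longlonglongrightarrow> 2 * c0 * y powr (\<theta> - Re s) + (2 * A + c0) * norm s * 0 * z
     + norm s * (c0 * exp 0 * y powr (\<theta> - Re s) * ((1 + 0 * (Re s - \<theta>)) / (Re s - \<theta>)))"
    by (intro tendsto_intros \<eta>) (use assms in auto)
  ultimately have "norm (D y z s) \<le> 2 * c0 * y powr (\<theta> - Re s) + (2 * A + c0) * norm s * 0 * z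
     + norm s * (c0 * exp 0 * y powr (\<theta> - Re s) * ((1 + 0 * (Re s - \<theta>)) / (Re s - \<theta>)))"
    by (intro LIMSEQ_le_const) auto
  also have "\<dots> = c0 * (2 + norm s / (Re s - \<theta>)) * y powr (\<theta> - Re s)"
    by (simp add: algebra_simps)
  finally show ?thesis .
qed

text \<open>The factor s - 1 removes the pole, so that the limit of \<Phi> is holomorphic for Re s > \<theta>.\<close>
definition \<Phi> :: "real \<Rightarrow> complex \<Rightarrow> complex" where
  "\<Phi> y s = (s - 1) * (\<Sum>m | nm m \<le> y. cpow (nm m) (-s)) + of_real A * cpow y (1 - s)"

lemma \<Phi>_diff:
  assumes "1 \<le> y" "y \<le> z" "s \<noteq> 1"
  shows "\<Phi> z s - \<Phi> y s = (s - 1) * D y z s"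
proof -
  have "{m. nm m \<le> z} = {m. nm m \<le> y} \<union> {m. y < nm m \<and> nm m \<le> z}" using assms by auto
  then have "(\<Sum>m | nm m \<le> z. cpow (nm m) (-s)) = (\<Sum>m | nm m \<le> y. cpow (nm m) (-s)) + (\<Sum>m | y < nm m \<and> nm m \<le> z. cpow (nm m) (-s))"
    by (simp only:) (rule sum.union_disjoint, auto)
  then show ?thesis using assms by (simp add: \<Phi>_def D_def field_simps)
qed

definition G :: "complex \<Rightarrow> real" where
  "G s = c0 * norm (s - 1) * (2 + norm s / (Re s - \<theta>))"

lemma \<Phi>_diff_bound:
  assumes "1 \<le> y" "y \<le> z" "Re s > \<theta>"
  shows "norm (\<Phi> z s - \<Phi> y s) \<le> G s * y powr (\<theta> - Re s)"
proof (cases "s = 1")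
  case True
  then show ?thesis by (simp add: \<Phi>_def G_def)
next
  case False
  then have "norm (\<Phi> z s - \<Phi> y s) \<le> norm (s - 1) * (c0 * (2 + norm s / (Re s - \<theta>)) * y powr (\<theta> - Re s))"
    using assms by (simp add: \<Phi>_diff norm_mult mult_left_mono D_bound)
  then show ?thesis by (simp add: G_def mult_ac)
qed

text \<open>This is (s - 1) zeta(s), continued to Re s > \<theta>. The cut-offs are
  \<open>Suc k\<close> because the tail estimates hold for y \<ge> 1.\<close>

definition Z :: "complex \<Rightarrow> complex" where
  "Z s = lim (\<lambda>k. \<Phi> (real (Suc k)) s)"

lemma Z_tendsto:
  assumes "Re s > \<theta>"
  shows "(\<lambda>k. \<Phi> (real (Suc k)) s) \<longlonglongrightarrow> Z s"
proof -
  have "Cauchy (\<lambda>k. \<Phi> (real (Suc k)) s)"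
  proof (rule CauchyI')
    fix e :: real assume e: "e > 0"
    have "(\<lambda>k. G s * real (Suc k) powr (\<theta> - Re s)) \<longlonglongrightarrow> 0"
      by (rule tendsto_Suc_powr_neg) (use assms in auto)
    then have "eventually (\<lambda>k. G s * real (Suc k) powr (\<theta> - Re s) < e) sequentially"
      using e by (rule order_tendstoD)
    then obtain M where M: "\<And>k. k \<ge> M \<Longrightarrow> G s * real (Suc k) powr (\<theta> - Re s) < e"
      by (auto simp: eventually_sequentially)
    show "\<exists>M. \<forall>m\<ge>M. \<forall>n>m. dist (\<Phi> (real (Suc m)) s) (\<Phi> (real (Suc n)) s) < e"
    proof (intro exI allI impI)
      fix m n assume mn: "M \<le> m" "m < n"
      have "norm (\<Phi> (real (Suc n)) s - \<Phi> (real (Suc m)) s) \<le> G s * real (Suc m) powr (\<theta> - Re s)"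
        by (rule \<Phi>_diff_bound) (use mn assms in auto)
      with M[OF mn(1)] show "dist (\<Phi> (real (Suc m)) s) (\<Phi> (real (Suc n)) s) < e"
        by (simp add: dist_norm norm_minus_commute)
    qed
  qed
  then show ?thesis unfolding Z_def by (simp add: Cauchy_convergent_iff convergent_LIMSEQ_iff)
qed

lemma Z_approx:
  assumes "Re s > \<theta>" "y \<ge> 1"
  shows "norm (Z s - \<Phi> y s) \<le> G s * y powr (\<theta> - Re s)"
proof (rule Lim_bounded)
  show "(\<lambda>k. norm (\<Phi> (real (Suc k)) s - \<Phi> y s)) \<longlonglongrightarrow> norm (Z s - \<Phi> y s)"
    by (intro tendsto_intros Z_tendsto assms)
  show "\<forall>k\<ge>nat \<lceil>y\<rceil>. norm (\<Phi> (real (Suc k)) s - \<Phi> y s) \<le> G s * y powr (\<theta> - Re s)"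
  proof (intro allI impI \<Phi>_diff_bound assms)
    fix k assume "nat \<lceil>y\<rceil> \<le> k"
    then show "y \<le> real (Suc k)" by linarith
  qed
qed

text \<open>Every \<open>\<Phi> y\<close> takes the value A at 1, so A is the residue of zeta and Z
  does not vanish identically.\<close>

lemma Z_1: "Z 1 = of_real A"
proof -
  have "(\<lambda>k. \<Phi> (real (Suc k)) 1) \<longlonglongrightarrow> Z 1" using th_less by (intro Z_tendsto) auto
  then show ?thesis by (simp add: \<Phi>_def LIMSEQ_const_iff)
qed

lemma Z_bound:
  assumes "Re s > \<theta>"
  shows "norm (Z s) \<le> norm (s - 1) * (1 + c0 * (2 + norm s / (Re s - \<theta>))) + A"
proof -
  \<comment> \<open>Only the empty product is at most 1, so \<open>\<Phi> 1 s\<close> is s - 1 + A,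
    and approximating Z from y = 1 gives a bound of quadratic growth in s.\<close>
  have e: "{m. nm m \<le> 1} = {{#}}"
  proof -
    have "m = {#}" if "nm m \<le> 1" for m using nm_gt_1[of m] that by linarith
    then show ?thesis by auto
  qed
  have "norm (Z s) \<le> norm (Z s - \<Phi> 1 s) + norm (\<Phi> 1 s)" using norm_triangle_sub[of "Z s" "\<Phi> 1 s"] by linarith
  also have "norm (Z s - \<Phi> 1 s) \<le> G s" using Z_approx[OF assms, of 1] by simp
  also have "norm (\<Phi> 1 s) \<le> norm (s - 1) + A"
    unfolding \<Phi>_def e using A_pos by (auto intro: order.trans[OF norm_triangle_ineq])
  finally show ?thesis by (simp add: G_def algebra_simps)
qed

lemma holomorphic_\<Phi>: "\<Phi> y holomorphic_on S"
  unfolding \<Phi>_def by (intro holomorphic_intros)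

lemma open_halfplane: "open {s. Re s > a}"
  by (rule open_halfspace_Re_gt)

lemma holomorphic_Z: "Z holomorphic_on {s. Re s > \<theta>}"
proof (rule holomorphic_uniform_sequence[OF open_halfplane])
  show "(\<lambda>s. \<Phi> (real (Suc k)) s) holomorphic_on {s. Re s > \<theta>}" for k by (rule holomorphic_\<Phi>)
  fix x assume x: "x \<in> {s. Re s > \<theta>}"
  \<comment> \<open>Half the distance to the boundary line: the closed disc of radius d then stays
    at distance d from that line, where the tail bound is uniform.\<close>
  define d where "d = (Re x - \<theta>) / 2"
  have d: "d > 0" using x by (simp add: d_def)
  have re: "Re s \<ge> \<theta> + d" if "s \<in> cball x d" for s
  proof -
    have "\<bar>Re (x - s)\<bar> \<le> d" using that abs_Re_le_cmod[of "x - s"] by (simp add: dist_norm)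
    then have "Re x - Re s \<le> d" by simp
    then show ?thesis unfolding d_def by (simp add: field_simps)
  qed
  define R where "R = norm x + d + 1"
  define B where "B = c0 * R * (2 + R / d)"
  have "uniform_limit (cball x d) (\<lambda>k s. \<Phi> (real (Suc k)) s) Z sequentially"
  proof (rule uniform_limitI)
    fix e :: real assume e: "e > 0"
    have "(\<lambda>k. B * real (Suc k) powr (- d)) \<longlonglongrightarrow> 0"
      by (rule tendsto_Suc_powr_neg) (use d in auto)
    then have "eventually (\<lambda>k. B * real (Suc k) powr (- d) < e) sequentially"
      using e by (rule order_tendstoD)
    then show "\<forall>\<^sub>F k in sequentially. \<forall>s\<in>cball x d. dist (\<Phi> (real (Suc k)) s) (Z s) < e"
    proof eventually_elim
      case (elim k)
      show ?case
      proof
        fix s assume s: "s \<in> cball x d"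
        have ns: "norm s \<le> norm x + d" using s norm_triangle_sub[of s x] by (simp add: dist_norm norm_minus_commute)
        have ns1: "norm (s - 1) \<le> R" using ns norm_triangle_ineq4[of s 1] by (simp add: R_def)
        have "norm (Z s - \<Phi> (real (Suc k)) s) \<le> G s * real (Suc k) powr (\<theta> - Re s)"
          by (rule Z_approx) (use re[OF s] d in auto)
        also have "\<dots> \<le> B * real (Suc k) powr (- d)"
        proof (rule mult_mono)
          have "norm s / (Re s - \<theta>) \<le> R / d" using ns re[OF s] d by (intro frac_le) (auto simp: R_def)
          then show "G s \<le> B" unfolding G_def B_def
            by (intro mult_mono) (use ns1 c0 re[OF s] d in \<open>auto simp: R_def intro!: add_nonneg_nonneg divide_nonneg_nonneg\<close>)
          show "real (Suc k) powr (\<theta> - Re s) \<le> real (Suc k) powr (- d)"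
            using re[OF s] by (intro powr_mono) auto
          show "0 \<le> B" using c0 d by (auto simp: B_def R_def)
        qed auto
        finally show "dist (\<Phi> (real (Suc k)) s) (Z s) < e" using elim by (simp add: dist_norm norm_minus_commute)
      qed
    qed
  qed
  moreover have "cball x d \<subseteq> {s. Re s > \<theta>}" using re d by force
  ultimately show "\<exists>d>0. cball x d \<subseteq> {s. Re s > \<theta>} \<and> uniform_limit (cball x d) (\<lambda>k s. \<Phi> (real (Suc k)) s) Z sequentially"
    using d by blast
qed

end

subsection \<open>The Moebius mollifier\<close>

lemma has_sum_finite_sum:
  fixes f :: "'a \<Rightarrow> 'b \<Rightarrow> 'c::topological_comm_monoid_add"
  assumes "finite F" "\<And>d. d \<in> F \<Longrightarrow> (f d has_sum S d) B"
  shows "((\<lambda>k. \<Sum>d\<in>F. f d k) has_sum (\<Sum>d\<in>F. S d)) B"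
  using assms by (induction F) (auto intro: has_sum_add has_sum_0)

lemma infsum_tail_small:
  fixes f :: "'a \<Rightarrow> real"
  assumes f: "f summable_on UNIV" "\<And>x. f x \<ge> 0" and e: "e > 0"
  obtains F where "finite F" "\<And>H. finite H \<Longrightarrow> H \<inter> F = {} \<Longrightarrow> sum f H \<le> e"
proof -
  have "(sum f \<longlongrightarrow> infsum f UNIV) (finite_subsets_at_top UNIV)"
    using has_sum_infsum[OF f(1)] by (simp add: has_sum_def)
  then have "eventually (\<lambda>F. sum f F > infsum f UNIV - e) (finite_subsets_at_top UNIV)"
    by (rule order_tendstoD) (use e in auto)
  then obtain F where F: "finite F" "sum f F > infsum f UNIV - e"
    by (auto simp: eventually_finite_subsets_at_top)
  show thesis
  proof
    fix H assume H: "finite H" "H \<inter> F = {}"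
    have "sum f H + sum f F = sum f (H \<union> F)" using H F by (simp add: sum.union_disjoint)
    also have "\<dots> \<le> infsum f UNIV" using H F f by (intro finite_sum_le_infsum) auto
    finally show "sum f H \<le> e" using F by linarith
  qed fact
qed

lemma sum_Pow_alternating:
  assumes "finite A"
  shows "(\<Sum>X\<in>Pow A. (-1) ^ card X) = (if A = {} then 1 else 0 :: real)"
  using prod_diff_conv_sum[OF assms, of "\<lambda>_. 1::real" "\<lambda>_. 1"] assms by (auto simp: card_eq_0_iff power_0_left)

section \<open>The Dirichlet series for Re s > 1\<close>

context beurling begin

definition Zr :: "real \<Rightarrow> real" where "Zr \<sigma> = (\<Sum>\<^sub>\<infinity>m. nm m powr (- \<sigma>))"
definition zt :: "complex \<Rightarrow> complex" where "zt s = (\<Sum>\<^sub>\<infinity>m. cpow (nm m) (-s))"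

text \<open>On the real axis all terms are nonnegative, so \<sigma> - 1 times the partial sum is at
  most the modulus of \<open>\<Phi> y \<sigma>\<close>, which Z controls uniformly in y. This yields
  absolute convergence and the order 1 / (\<sigma> - 1) at once.\<close>

lemma partial_sum_bound:
  assumes "\<sigma> > 1" "y \<ge> 1"
  shows "(\<Sum>m | nm m \<le> y. nm m powr (- \<sigma>)) \<le> 1 + A / (\<sigma> - 1) + 2 * c0 * (2 + \<sigma> / (\<sigma> - \<theta>))"
proof -
  let ?s = "complex_of_real \<sigma>" and ?S = "\<Sum>m | nm m \<le> y. nm m powr (- \<sigma>)"
  have th: "Re ?s > \<theta>" using assms th_less by simp
  have e1: "(\<Sum>m | nm m \<le> y. cpow (nm m) (- ?s)) = of_real ?S"
    unfolding of_real_sum by (intro sum.cong refl) (metis cpow_of_real nm_pos of_real_minus)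
  have e2: "cpow y (1 - ?s) = of_real (y powr (1 - \<sigma>))"
    using cpow_of_real[of y "1 - \<sigma>"] assms by simp
  have "\<Phi> y ?s = of_real ((\<sigma> - 1) * ?S + A * y powr (1 - \<sigma>))"
    by (simp add: \<Phi>_def e1 e2)
  moreover have "(\<sigma> - 1) * ?S \<le> (\<sigma> - 1) * ?S + A * y powr (1 - \<sigma>)" using A_pos by simp
  moreover have "(\<sigma> - 1) * ?S \<ge> 0" using assms by (intro mult_nonneg_nonneg sum_nonneg) auto
  ultimately have "(\<sigma> - 1) * ?S \<le> norm (\<Phi> y ?s)" by (simp only: norm_of_real)
  also have "\<dots> \<le> norm (Z ?s) + norm (Z ?s - \<Phi> y ?s)" using norm_triangle_sub[of "\<Phi> y ?s" "Z ?s"] by (simp add: norm_minus_commute)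
  also have "norm (Z ?s - \<Phi> y ?s) \<le> G ?s * 1"
  proof (rule order.trans[OF Z_approx[OF th assms(2)]], rule mult_left_mono)
    have "y powr (\<theta> - Re ?s) \<le> y powr 0" using assms th by (intro powr_mono) auto
    then show "y powr (\<theta> - Re ?s) \<le> 1" using assms by simp
    show "G ?s \<ge> 0" unfolding G_def using c0 th assms by (intro mult_nonneg_nonneg add_nonneg_nonneg) auto
  qed
  also have "norm (Z ?s) \<le> norm (?s - 1) * (1 + c0 * (2 + norm ?s / (Re ?s - \<theta>))) + A" by (rule Z_bound[OF th])
  also have "norm (?s - 1) = \<sigma> - 1" using assms by (metis norm_of_real of_real_1 of_real_diff abs_of_pos diff_gt_0_iff_gt)
  also have "(\<sigma> - 1) * (1 + c0 * (2 + norm ?s / (Re ?s - \<theta>))) + A + G ?s * 1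
     = (\<sigma> - 1) * (1 + A / (\<sigma> - 1) + 2 * c0 * (2 + \<sigma> / (\<sigma> - \<theta>)))"
  proof -
    have "norm (?s - 1) = \<sigma> - 1" using assms by (metis norm_of_real of_real_1 of_real_diff abs_of_pos diff_gt_0_iff_gt)
    moreover have "norm ?s = \<sigma>" using assms by simp
    moreover have "u * (1 + c * (2 + r)) + u * a + c * u * (2 + r) * 1 = u * (1 + a + 2 * c * (2 + r))" for u c r a :: real
      by (simp add: algebra_simps)
    from this[of "\<sigma> - 1" c0 "\<sigma> / (\<sigma> - \<theta>)" "A / (\<sigma> - 1)"]
    have "(\<sigma> - 1) * (1 + c0 * (2 + \<sigma> / (\<sigma> - \<theta>))) + A + c0 * (\<sigma> - 1) * (2 + \<sigma> / (\<sigma> - \<theta>)) * 1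
       = (\<sigma> - 1) * (1 + A / (\<sigma> - 1) + 2 * c0 * (2 + \<sigma> / (\<sigma> - \<theta>)))" using assms by simp
    ultimately show ?thesis unfolding G_def by simp
  qed
  finally show ?thesis using assms by (simp add: mult_le_cancel_left_pos)
qed

lemma finite_subset_nm: "finite F \<Longrightarrow> \<exists>y\<ge>1. F \<subseteq> {m. nm m \<le> y}"
proof (intro exI conjI)
  assume F: "finite F"
  show "Max (insert 1 (nm ` F)) \<ge> 1" using F by simp
  show "F \<subseteq> {m. nm m \<le> Max (insert 1 (nm ` F))}" using F by auto
qed

lemma sum_le_Zr_aux:
  assumes "\<sigma> > 1" "finite F"
  shows "(\<Sum>m\<in>F. nm m powr (- \<sigma>)) \<le> 1 + A / (\<sigma> - 1) + 2 * c0 * (2 + \<sigma> / (\<sigma> - \<theta>))"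
proof -
  obtain y where y: "y \<ge> 1" "F \<subseteq> {m. nm m \<le> y}" using finite_subset_nm[OF assms(2)] by blast
  have "(\<Sum>m\<in>F. nm m powr (- \<sigma>)) \<le> (\<Sum>m | nm m \<le> y. nm m powr (- \<sigma>))" by (rule sum_mono2) (use y in auto)
  with partial_sum_bound[OF assms(1) y(1)] show ?thesis by linarith
qed

lemma summable_nm: "\<sigma> > 1 \<Longrightarrow> (\<lambda>m. nm m powr (- \<sigma>)) summable_on UNIV"
  by (rule nonneg_bdd_above_summable_on) (auto intro!: bdd_aboveI sum_le_Zr_aux)

lemma sum_le_Zr: "\<sigma> > 1 \<Longrightarrow> finite F \<Longrightarrow> (\<Sum>m\<in>F. nm m powr (- \<sigma>)) \<le> Zr \<sigma>"
  unfolding Zr_def by (rule finite_sum_le_infsum) (auto intro: summable_nm)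

lemma Zr_bound:
  obtains c where "c \<ge> 1" "\<And>\<sigma>. 1 < \<sigma> \<Longrightarrow> \<sigma> \<le> 3 \<Longrightarrow> Zr \<sigma> \<le> c / (\<sigma> - 1)"
proof
  define B where "B = 1 + 2 * c0 * (2 + 3 / (1 - \<theta>))"
  have B: "B \<ge> 1" using c0 th_less by (auto simp: B_def intro!: mult_nonneg_nonneg add_nonneg_nonneg)
  show "A + 2 * B \<ge> 1" using B A_pos by simp
  fix \<sigma> :: real assume s: "1 < \<sigma>" "\<sigma> \<le> 3"
  have "Zr \<sigma> \<le> 1 + A / (\<sigma> - 1) + 2 * c0 * (2 + \<sigma> / (\<sigma> - \<theta>))"
    unfolding Zr_def by (rule infsum_le_finite_sums[OF summable_nm[OF s(1)]]) (rule sum_le_Zr_aux[OF s(1)])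
  moreover have "\<sigma> / (\<sigma> - \<theta>) \<le> 3 / (1 - \<theta>)" using s th_less by (intro frac_le) auto
  then have "2 * c0 * (2 + \<sigma> / (\<sigma> - \<theta>)) \<le> 2 * c0 * (2 + 3 / (1 - \<theta>))" using c0 by (intro mult_left_mono) auto
  moreover have "B * 1 \<le> B * (2 / (\<sigma> - 1))" using s B by (intro mult_left_mono) (auto simp: field_simps)
  ultimately show "Zr \<sigma> \<le> (A + 2 * B) / (\<sigma> - 1)" by (simp add: B_def add_divide_distrib)
qed

lemma abs_summable_cpow: "Re s > 1 \<Longrightarrow> (\<lambda>m. norm (cpow (nm m) (-s))) summable_on UNIV"
  using summable_nm[of "Re s"] by (simp add: norm_cpow)

lemma has_sum_zt: "Re s > 1 \<Longrightarrow> ((\<lambda>m. cpow (nm m) (-s)) has_sum zt s) UNIV"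
  unfolding zt_def by (rule has_sum_infsum[OF abs_summable_summable[OF abs_summable_cpow]])

text \<open>The sets of integers up to k + 1 eventually contain every finite set, so the
  unconditional sum is also the limit of these partial sums. The other term of \<Phi> has modulus A
  (k + 1)^(1 - Re s) and disappears.\<close>

lemma Z_eq_zt:
  assumes "Re s > 1"
  shows "Z s = (s - 1) * zt s"
proof -
  have lim: "filterlim (\<lambda>k. {m. nm m \<le> real (Suc k)}) (finite_subsets_at_top UNIV) sequentially"
  proof -
    have "eventually (\<lambda>k. X \<subseteq> {m. nm m \<le> real (Suc k)}) sequentially" if "finite X" for X
    proof -
      obtain y where y: "y \<ge> 1" "X \<subseteq> {m. nm m \<le> y}" using finite_subset_nm[OF \<open>finite X\<close>] by blast
      have "X \<subseteq> {m. nm m \<le> real (Suc k)}" if "k \<ge> nat \<lceil>y\<rceil>" for k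
      proof -
        have "y \<le> real (Suc k)" using that by linarith
        then show ?thesis using y by force
      qed
      then show ?thesis unfolding eventually_sequentially by blast
    qed
    then show ?thesis by (auto simp: filterlim_finite_subsets_at_top)
  qed
  have "(sum (\<lambda>m. cpow (nm m) (-s)) \<longlongrightarrow> zt s) (finite_subsets_at_top UNIV)"
    using has_sum_zt[OF assms] by (simp add: has_sum_def)
  from filterlim_compose[OF this lim]
  have 1: "(\<lambda>k. \<Sum>m | nm m \<le> real (Suc k). cpow (nm m) (-s)) \<longlonglongrightarrow> zt s" .
  have 2: "(\<lambda>k. cpow (real (Suc k)) (1 - s)) \<longlonglongrightarrow> 0"
  proof (rule tendsto_norm_zero_cancel)
    have "(\<lambda>k. 1 * real (Suc k) powr (1 - Re s)) \<longlonglongrightarrow> 0" by (rule tendsto_Suc_powr_neg) (use assms in auto)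
    then show "(\<lambda>k. norm (cpow (real (Suc k)) (1 - s))) \<longlonglongrightarrow> 0" by (simp add: norm_cpow del: of_nat_Suc)
  qed
  have "(\<lambda>k. \<Phi> (real (Suc k)) s) \<longlonglongrightarrow> (s - 1) * zt s + of_real A * 0"
    unfolding \<Phi>_def by (intro tendsto_intros 1 2)
  moreover have "(\<lambda>k. \<Phi> (real (Suc k)) s) \<longlonglongrightarrow> Z s" using assms th_less by (intro Z_tendsto) auto
  ultimately show ?thesis using LIMSEQ_unique by fastforce
qed

text \<open>Far to the right the term 1 of the empty product dominates. This supplies the lower
  bound at the centre of the disc in Jensen's estimate.\<close>

lemma zt_lower_bound:
  obtains c where "c \<ge> 3" "\<And>s. Re s = c \<Longrightarrow> norm (zt s) \<ge> 1 / 2"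
proof -
  \<comment> \<open>A bound greater than 1 below all integers other than the empty product; the cap
    2 reduces the minimum to a finite set.\<close>
  define q where "q = Min (insert 2 (nm ` ({m. nm m \<le> 2} - {{#}})))"
  have q1: "q > 1" unfolding q_def using nm_gt_1 by (subst Min_gr_iff) auto
  have q2: "q \<le> nm m" if "m \<noteq> {#}" for m
  proof (cases "nm m \<le> 2")
    case True then show ?thesis unfolding q_def using that by (intro Min_le) auto
  next
    case False
    have "q \<le> 2" unfolding q_def by (intro Min_le) auto
    with False show ?thesis by simp
  qed
  have Zr2: "Zr 2 \<ge> 1" using sum_le_Zr[of 2 "{{#}}"] by simp
  \<comment> \<open>Chosen so that q^(-(c - 2)) times \<open>Zr 2\<close> is at most 1 / 2; the
    exponent 2 held back keeps the remaining series convergent.\<close>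
  define c where "c = 3 + log q (2 * Zr 2)"
  have l: "log q (2 * Zr 2) \<ge> 0" using q1 Zr2 by simp
  have c3: "c \<ge> 3" using l by (simp add: c_def)
  have qc: "q powr (- (c - 2)) \<le> 1 / (2 * Zr 2)"
  proof -
    have "q powr (- (c - 2)) \<le> q powr (- log q (2 * Zr 2))" using q1 by (intro powr_mono) (auto simp: c_def)
    also have "\<dots> = 1 / (2 * Zr 2)" using q1 Zr2 by (simp add: powr_minus_divide)
    finally show ?thesis .
  qed
  show thesis
  proof (rule that[OF c3])
    fix s assume s: "Re s = c"
    have "norm (zt s - cpow (nm {#}) (-s)) \<le> 1 / 2"
    proof -
      have "((\<lambda>m. cpow (nm m) (-s)) has_sum (zt s - cpow (nm {#}) (-s))) (UNIV - {{#}})"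
        by (rule has_sum_Diff[OF has_sum_zt]) (use s c3 in \<open>auto intro: has_sum_finiteI\<close>)
      moreover have "((\<lambda>m. (1 / (2 * Zr 2)) * nm m powr (- 2)) has_sum ((1 / (2 * Zr 2)) * (Zr 2 - nm {#} powr (- 2)))) (UNIV - {{#}})"
        unfolding Zr_def by (intro has_sum_cmult_right has_sum_Diff has_sum_infsum summable_nm) (auto intro: has_sum_finiteI)
      ultimately have "norm (zt s - cpow (nm {#}) (-s)) \<le> (1 / (2 * Zr 2)) * (Zr 2 - nm {#} powr (- 2))"
      proof (rule norm_infsum_le)
        fix m :: "nat multiset" assume m: "m \<in> UNIV - {{#}}"
        have "norm (cpow (nm m) (-s)) = nm m powr (- (c - 2)) * nm m powr (- 2)"
          using s by (simp add: norm_cpow powr_add[symmetric])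
        also have "\<dots> \<le> q powr (- (c - 2)) * nm m powr (- 2)"
          using q1 q2[of m] m c3 by (intro mult_right_mono powr_mono2') auto
        also have "\<dots> \<le> (1 / (2 * Zr 2)) * nm m powr (- 2)" using qc by (intro mult_right_mono) auto
        finally show "norm (cpow (nm m) (-s)) \<le> (1 / (2 * Zr 2)) * nm m powr (- 2)" .
      qed
      also have "\<dots> \<le> (1 / (2 * Zr 2)) * Zr 2" using Zr2 by (intro mult_left_mono) auto
      finally show ?thesis using Zr2 by simp
    qed
    then have "norm (1 - zt s) \<le> 1 / 2" by (simp add: norm_minus_commute)
    then show "norm (zt s) \<ge> 1 / 2" using norm_triangle_ineq2[of 1 "zt s"] by simp
  qed
qed

text \<open>Rankin's trick: for d = 1 / ln x the factor n^d is at most e when n \<le> x, so the sum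
  is at most e times the full series at 1 + d, which is of order ln x.\<close>

lemma sum_inverse_bound:
  obtains c where "c \<ge> 1" "\<And>x. x \<ge> 2 \<Longrightarrow> (\<Sum>m | nm m \<le> x. 1 / nm m) \<le> c * ln x"
proof -
  obtain c where c: "c \<ge> 1" "\<And>\<sigma>. 1 < \<sigma> \<Longrightarrow> \<sigma> \<le> 3 \<Longrightarrow> Zr \<sigma> \<le> c / (\<sigma> - 1)" using Zr_bound by blast
  show thesis
  proof (rule that[of "exp 1 * c"])
    have "1 * 1 \<le> exp 1 * c" using c by (intro mult_mono) auto
    then show "exp 1 * c \<ge> 1" by simp
    fix x :: real assume x: "x \<ge> 2"
    define d where "d = 1 / ln x"
    have lx: "ln x \<ge> 1 / 2" using x by (rule ln_ge_half)
    have d: "0 < d" "d \<le> 2" using lx by (auto simp: d_def field_simps)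
    have "(\<Sum>m | nm m \<le> x. 1 / nm m) \<le> (\<Sum>m | nm m \<le> x. exp 1 * nm m powr (- (1 + d)))"
    proof (rule sum_mono)
      fix m assume m: "m \<in> {m. nm m \<le> x}"
      have "nm m powr d \<le> x powr d" using m d by (intro powr_mono2) (auto simp: less_imp_le)
      also have "x powr d = exp 1" using x lx by (auto simp: powr_def d_def)
      finally have "nm m powr d * nm m powr (- (1 + d)) \<le> exp 1 * nm m powr (- (1 + d))" by (intro mult_right_mono) auto
      also have "nm m powr d * nm m powr (- (1 + d)) = 1 / nm m" by (simp add: powr_add[symmetric] powr_minus_divide abs_of_pos)
      finally show "1 / nm m \<le> exp 1 * nm m powr (- (1 + d))" .
    qed
    also have "\<dots> \<le> exp 1 * Zr (1 + d)" unfolding sum_distrib_left[symmetric]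
      by (intro mult_left_mono sum_le_Zr) (use d in auto)
    also have "Zr (1 + d) \<le> c / (1 + d - 1)" by (rule c(2)) (use d in auto)
    also have "c / (1 + d - 1) = c * ln x" by (simp add: d_def)
    finally show "(\<Sum>m | nm m \<le> x. 1 / nm m) \<le> exp 1 * c * ln x" by (simp add: mult.assoc)
  qed
qed

section \<open>Moebius function, mollifier and the coefficients of their product with zeta\<close>

definition moeb :: "nat multiset \<Rightarrow> real" where
  "moeb m = (if m = mset_set (set_mset m) then (-1) ^ card (set_mset m) else 0)"

definition mollifier :: "real \<Rightarrow> complex \<Rightarrow> complex" where
  "mollifier X s = (\<Sum>d | nm d \<le> X. of_real (moeb d) * cpow (nm d) (-s))"

text \<open>The coefficient at k of the product of mollifier and zeta: a divisor d of k takes part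
  if it is within the length X of the mollifier.\<close>

definition acoeff :: "real \<Rightarrow> nat multiset \<Rightarrow> real" where
  "acoeff X k = (\<Sum>d | nm d \<le> X. if d \<subseteq># k then moeb d else 0)"

text \<open>The number of squarefree divisors of k, which bounds the coefficients
  \<open>acoeff X k\<close> for every X.\<close>

definition tau :: "nat multiset \<Rightarrow> real" where "tau k = 2 ^ card (set_mset k)"

lemma abs_moeb_le: "\<bar>moeb m\<bar> \<le> 1"
  by (simp add: moeb_def)

lemma nm_mono: "d \<subseteq># k \<Longrightarrow> nm d \<le> nm k"
proof -
  assume "d \<subseteq># k"
  then obtain r where "k = d + r" by (metis subset_mset.le_iff_add)
  moreover have "nm d * 1 \<le> nm d * nm r" by (intro mult_left_mono nm_ge_1) (auto simp: less_imp_le)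
  ultimately show ?thesis by (simp add: nrm_add)
qed

text \<open>Only squarefree divisors have nonzero \<open>moeb\<close>, and \<open>mset_set\<close>
  identifies them with the subsets of the support of k.\<close>

lemma acoeff_eq:
  "acoeff X k = (\<Sum>S\<in>Pow (set_mset k). if nm (mset_set S) \<le> X then (-1) ^ card S else 0)"
proof -
  let ?T = "{S \<in> Pow (set_mset k). nm (mset_set S) \<le> X}"
  have fin: "finite S" if "S \<subseteq> set_mset k" for S using that finite_subset by blast
  have "(\<Sum>S\<in>Pow (set_mset k). if nm (mset_set S) \<le> X then (-1) ^ card S else (0::real)) = (\<Sum>S\<in>?T. (-1) ^ card S)"
    by (subst sum.inter_filter) auto
  also have "\<dots> = (\<Sum>S\<in>?T. moeb (mset_set S))"
    by (rule sum.cong) (auto simp: moeb_def fin)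
  also have "\<dots> = (\<Sum>d\<in>mset_set ` ?T. moeb d)"
  proof (rule sum.reindex_cong[symmetric, of mset_set])
    show "inj_on mset_set ?T" by (rule inj_onI) (metis (no_types, lifting) CollectD PowD fin finite_set_mset_mset_set)
  qed auto
  also have "\<dots> = (\<Sum>d | nm d \<le> X. if d \<subseteq># k then moeb d else 0)"
  proof (rule sum.mono_neutral_cong_left)
    show "mset_set ` ?T \<subseteq> {d. nm d \<le> X}" by auto
    show "\<forall>d\<in>{d. nm d \<le> X} - mset_set ` ?T. (if d \<subseteq># k then moeb d else 0) = 0"
    proof
      fix d assume d: "d \<in> {d. nm d \<le> X} - mset_set ` ?T"
      show "(if d \<subseteq># k then moeb d else 0) = 0"
      proof (rule ccontr)
        assume "\<not> ?thesis"
        then have *: "d \<subseteq># k" "d = mset_set (set_mset d)" by (auto simp: moeb_def split: if_splits)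
        then have "set_mset d \<in> ?T" using d set_mset_mono[OF *(1)] by auto
        with *(2) d show False by blast
      qed
    qed
    fix d assume "d \<in> mset_set ` ?T"
    then obtain S where S: "S \<subseteq> set_mset k" "d = mset_set S" by auto
    have "mset_set S \<subseteq># mset_set (set_mset k)" using S by (intro subset_imp_msubset_mset_set) auto
    then have "d \<subseteq># k" using mset_set_set_mset_msubset[of k] S by (metis subset_mset.order_trans)
    then show "moeb d = (if d \<subseteq># k then moeb d else 0)" by simp
  qed simp
  finally show ?thesis by (simp add: acoeff_def)
qed

text \<open>If k is within the cut-off, so are all its divisors, and the full alternating sum over
  subsets vanishes unless the support is empty. This is why the mollified zeta function minus 1
  starts only beyond X.\<close>

lemma acoeff_small:
  assumes "nm k \<le> X"
  shows "acoeff X k = (if k = {#} then 1 else 0)"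
proof -
  have "nm (mset_set S) \<le> X" if "S \<subseteq> set_mset k" for S
  proof -
    have "mset_set S \<subseteq># mset_set (set_mset k)" using that by (intro subset_imp_msubset_mset_set) auto
    then have "mset_set S \<subseteq># k" using mset_set_set_mset_msubset[of k] by (metis subset_mset.order_trans)
    from nm_mono[OF this] assms show ?thesis by linarith
  qed
  then have "acoeff X k = (\<Sum>S\<in>Pow (set_mset k). (-1) ^ card S)" unfolding acoeff_eq by (intro sum.cong) auto
  then show ?thesis by (simp add: sum_Pow_alternating)
qed

lemma abs_acoeff_le: "\<bar>acoeff X k\<bar> \<le> tau k"
proof -
  have "\<bar>acoeff X k\<bar> \<le> (\<Sum>S\<in>Pow (set_mset k). 1)"
    unfolding acoeff_eq by (rule order.trans[OF sum_abs], rule sum_mono) auto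
  then show ?thesis by (simp add: tau_def card_Pow)
qed

text \<open>For fixed d the multiples of d are the range of the injection m \<mapsto> d + m, so the
  share of d in the product is a sum over all k with d \<subseteq># k. Only finitely many d occur,
  hence the interchange of sums is harmless.\<close>

lemma has_sum_mollified:
  assumes "Re s > 1"
  shows "((\<lambda>k. of_real (acoeff X k) * cpow (nm k) (-s)) has_sum (mollifier X s * zt s)) UNIV"
proof -
  have 1: "((\<lambda>k. if d \<subseteq># k then of_real (moeb d) * cpow (nm k) (-s) else 0) has_sum
      (of_real (moeb d) * cpow (nm d) (-s)) * zt s) UNIV" for d
  proof -
    have "((\<lambda>m. (of_real (moeb d) * cpow (nm d) (-s)) * cpow (nm m) (-s)) has_sum (of_real (moeb d) * cpow (nm d) (-s)) * zt s) UNIV"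
      by (intro has_sum_cmult_right has_sum_zt assms)
    also have "(\<lambda>m. (of_real (moeb d) * cpow (nm d) (-s)) * cpow (nm m) (-s)) = (\<lambda>k. of_real (moeb d) * cpow (nm k) (-s)) \<circ> (\<lambda>m. d + m)"
      by (auto simp: nrm_add cpow_mult o_def)
    finally have "((\<lambda>k. of_real (moeb d) * cpow (nm k) (-s)) has_sum (of_real (moeb d) * cpow (nm d) (-s)) * zt s) (range (\<lambda>m. d + m))"
      by (rule has_sum_reindex[THEN iffD2, rotated]) (auto intro: injI)
    moreover have "range (\<lambda>m. d + m) = {k. d \<subseteq># k}" by (auto simp: subset_mset.le_iff_add image_def)
    ultimately show ?thesis
      by (subst has_sum_cong_neutral[where T = "{k. d \<subseteq># k}" and g = "\<lambda>k. of_real (moeb d) * cpow (nm k) (-s)"]) auto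
  qed
  have "((\<lambda>k. \<Sum>d | nm d \<le> X. if d \<subseteq># k then of_real (moeb d) * cpow (nm k) (-s) else 0) has_sum
      (\<Sum>d | nm d \<le> X. (of_real (moeb d) * cpow (nm d) (-s)) * zt s)) UNIV"
    by (intro has_sum_finite_sum 1) auto
  also have "(\<lambda>k. \<Sum>d | nm d \<le> X. if d \<subseteq># k then of_real (moeb d) * cpow (nm k) (-s) else 0)
     = (\<lambda>k. of_real (acoeff X k) * cpow (nm k) (-s))"
    unfolding acoeff_def of_real_sum sum_distrib_right by (intro ext sum.cong) auto
  finally show ?thesis by (simp add: mollifier_def sum_distrib_right)
qed

definition bcoeff :: "real \<Rightarrow> nat multiset \<Rightarrow> real" where
  "bcoeff X k = (if nm k \<le> X then 0 else acoeff X k)"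

lemma has_sum_mollified_minus_1:
  assumes "Re s > 1" "X \<ge> 1"
  shows "((\<lambda>k. of_real (bcoeff X k) * cpow (nm k) (-s)) has_sum (mollifier X s * zt s - 1)) UNIV"
proof -
  have "((\<lambda>k. if k = {#} then 1 else 0 :: complex) has_sum 1) UNIV"
    by (subst has_sum_cong_neutral[where T = "{{#}}" and g = "\<lambda>_. 1"]) (auto intro: has_sum_finiteI)
  from has_sum_cmult_right[OF this, of "-1"]
  have "((\<lambda>k. - (if k = {#} then 1 else 0) :: complex) has_sum - 1) UNIV" by simp
  from has_sum_add[OF has_sum_mollified[OF assms(1), of X] this]
  have "((\<lambda>k. of_real (acoeff X k) * cpow (nm k) (-s) - (if k = {#} then 1 else 0)) has_sum (mollifier X s * zt s - 1)) UNIV"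
    by (simp only: diff_conv_add_uminus)
  also have "(\<lambda>k. of_real (acoeff X k) * cpow (nm k) (-s) - (if k = {#} then 1 else 0)) = (\<lambda>k. of_real (bcoeff X k) * cpow (nm k) (-s))"
    using assms(2) by (auto simp: bcoeff_def acoeff_small)
  finally show ?thesis .
qed

lemma abs_bcoeff_le: "\<bar>bcoeff X k\<bar> \<le> tau k"
  using abs_acoeff_le[of X k] by (auto simp: bcoeff_def tau_def)

lemma tau_ge_1: "tau k \<ge> 1" by (simp add: tau_def)

text \<open>With tau squared in the majorant, \<open>sum_tau_sq_le\<close> alone controls tails and
  l1 norms as well as mean squares.\<close>

lemma norm_bcoeff_term_le: "norm (of_real (bcoeff X k) * cpow (nm k) (-s)) \<le> (tau k)\<^sup>2 * nm k powr (- Re s)"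
proof -
  have "\<bar>bcoeff X k\<bar> \<le> tau k * 1" using abs_bcoeff_le[of X k] by simp
  also have "\<dots> \<le> (tau k)\<^sup>2" unfolding power2_eq_square using tau_ge_1[of k] by (intro mult_left_mono) auto
  finally show ?thesis by (auto simp: norm_mult norm_cpow intro: mult_right_mono)
qed

text \<open>Splitting k at two sets S and S' of prime divisors into the part k - S \<union> S' and the three
  parts of the Venn diagram of S and S' is injective, so tau squared is dominated by the
  fourfold divisor function.\<close>
lemma sum_tau_sq_le:
  assumes "\<sigma> > 1" "finite F"
  shows "(\<Sum>k\<in>F. (tau k)\<^sup>2 * nm k powr (- \<sigma>)) \<le> Zr \<sigma> ^ 4"
proof -
  define P where "P = (SIGMA k:F. Pow (set_mset k) \<times> Pow (set_mset k))"
  define g where "g = (\<lambda>(k :: nat multiset, S, S'). (k - mset_set (S \<union> S'), mset_set (S \<inter> S'), mset_set (S - S'), mset_set (S' - S)))"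
  have P: "finite P" using assms unfolding P_def by (intro finite_SigmaI) auto
  have PD: "finite S \<and> finite S' \<and> mset_set (S \<union> S') \<subseteq># k" if "(k, S, S') \<in> P" for k S S'
  proof -
    have "S \<union> S' \<subseteq> set_mset k" using that by (auto simp: P_def)
    then have "mset_set (S \<union> S') \<subseteq># mset_set (set_mset k)" by (intro subset_imp_msubset_mset_set) auto
    then have "mset_set (S \<union> S') \<subseteq># k" using mset_set_set_mset_msubset[of k] by (metis subset_mset.order_trans)
    moreover have "finite (S \<union> S')" using \<open>S \<union> S' \<subseteq> set_mset k\<close> finite_subset by blast
    ultimately show ?thesis by auto
  qed
  have union: "mset_set (S \<union> S') = mset_set (S \<inter> S') + mset_set (S - S') + mset_set (S' - S)"
    if "finite S" "finite S'" for S S' :: "nat set"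
  proof -
    have "S \<union> S' = (S \<inter> S' \<union> (S - S')) \<union> (S' - S)" by auto
    then show ?thesis using that by (subst \<open>S \<union> S' = _\<close>, subst mset_set_Union, auto, subst mset_set_Union, auto)
  qed
  have inj: "inj_on g P"
  proof (rule inj_onI)
    fix x y assume xy: "x \<in> P" "y \<in> P" "g x = g y"
    obtain k S S' where x: "x = (k, S, S')" by (metis prod_cases3)
    obtain l T T' where y: "y = (l, T, T')" by (metis prod_cases3)
    have f: "finite S" "finite S'" "finite T" "finite T'" using PD xy x y by blast+
    have e: "k - mset_set (S \<union> S') = l - mset_set (T \<union> T')" "mset_set (S \<inter> S') = mset_set (T \<inter> T')"
      "mset_set (S - S') = mset_set (T - T')" "mset_set (S' - S) = mset_set (T' - T)"
      using xy(3) by (auto simp: g_def x y)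
    have "S \<inter> S' = T \<inter> T'" "S - S' = T - T'" "S' - S = T' - T"
      using arg_cong[OF e(2), of set_mset] arg_cong[OF e(3), of set_mset] arg_cong[OF e(4), of set_mset] f by auto
    then have "S = T" "S' = T'" by blast+
    moreover have "k = (k - mset_set (S \<union> S')) + mset_set (S \<union> S')" "l = (l - mset_set (T \<union> T')) + mset_set (T \<union> T')"
      using PD xy x y by (metis subset_mset.diff_add)+
    ultimately show "x = y" using e(1) x y by simp
  qed
  define w where "w = (\<lambda>m. nm m powr (- \<sigma>))"
  have w_mult: "w (a + b) = w a * w b" for a b by (simp add: w_def nrm_add powr_mult less_imp_le)
  define v where "v = (\<lambda>(a, b, c, d). w a * (w b * (w c * w d)))"
  \<comment> \<open>All coordinates occurring in the image of P; the image lies in the fourfold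
    product of B, over which the sum of v factors.\<close>
  define B where "B = fst ` (g ` P) \<union> (fst \<circ> snd) ` (g ` P) \<union> (fst \<circ> snd \<circ> snd) ` (g ` P) \<union> (snd \<circ> snd \<circ> snd) ` (g ` P)"
  have B: "finite B" using P by (simp add: B_def)
  have "(\<Sum>k\<in>F. (tau k)\<^sup>2 * nm k powr (- \<sigma>)) = (\<Sum>k\<in>F. \<Sum>q\<in>Pow (set_mset k) \<times> Pow (set_mset k). w k)"
    by (intro sum.cong refl) (simp add: tau_def card_cartesian_product card_Pow power2_eq_square w_def)
  also have "\<dots> = (\<Sum>(k, q)\<in>P. w k)" unfolding P_def by (rule sum.Sigma) (use assms in auto)
  also have "\<dots> = (\<Sum>x\<in>P. v (g x))"
  proof (rule sum.cong[OF refl])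
    fix x assume x: "x \<in> P"
    obtain k S S' where xk: "x = (k, S, S')" by (metis prod_cases3)
    have f: "finite S" "finite S'" "mset_set (S \<union> S') \<subseteq># k" using PD x xk by blast+
    have "k = (k - mset_set (S \<union> S')) + (mset_set (S \<inter> S') + mset_set (S - S') + mset_set (S' - S))"
      using f union by (metis subset_mset.diff_add)
    then have "w k = w ((k - mset_set (S \<union> S')) + (mset_set (S \<inter> S') + mset_set (S - S') + mset_set (S' - S)))" by simp
    then have "w k = v (g x)" by (simp add: w_mult v_def g_def xk mult.assoc)
    then show "(case x of (k, q) \<Rightarrow> w k) = v (g x)" by (simp add: xk)
  qed
  also have "\<dots> = sum v (g ` P)" by (simp add: sum.reindex[OF inj])
  also have "\<dots> \<le> sum v (B \<times> B \<times> B \<times> B)"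
  proof (rule sum_mono2)
    show "g ` P \<subseteq> B \<times> B \<times> B \<times> B"
    proof
      fix x assume x: "x \<in> g ` P"
      have "fst x \<in> B" "(fst \<circ> snd) x \<in> B" "(fst \<circ> snd \<circ> snd) x \<in> B" "(snd \<circ> snd \<circ> snd) x \<in> B"
        unfolding B_def using x by blast+
      then show "x \<in> B \<times> B \<times> B \<times> B" by (simp only: mem_Times_iff o_apply)
    qed
  qed (use B in \<open>auto simp: v_def w_def\<close>)
  also have "\<dots> = sum w B * (sum w B * (sum w B * sum w B))"
    by (simp add: v_def sum_product sum.cartesian_product case_prod_unfold)
  also have "\<dots> = sum w B ^ 4" by (simp add: power4_eq_xxxx)
  also have "\<dots> \<le> Zr \<sigma> ^ 4" unfolding w_def by (intro power_mono sum_le_Zr assms B sum_nonneg) auto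
  finally show ?thesis .
qed

end

subsection \<open>Mean values on two vertical lines\<close>

lemma card_nat_interval_le:
  fixes a l :: real
  assumes "a \<ge> 0" "l \<ge> 0"
  shows "real (card {n::nat. a \<le> real n \<and> real n < a + l}) \<le> l + 1" "finite {n::nat. a \<le> real n \<and> real n < a + l}"
proof -
  have sub: "{n::nat. a \<le> real n \<and> real n < a + l} \<subseteq> {nat \<lceil>a\<rceil>..<nat \<lceil>a + l\<rceil>}"
  proof
    fix n assume "n \<in> {n::nat. a \<le> real n \<and> real n < a + l}"
    then show "n \<in> {nat \<lceil>a\<rceil>..<nat \<lceil>a + l\<rceil>}" by (auto, linarith+)
  qed
  then show "finite {n::nat. a \<le> real n \<and> real n < a + l}" using finite_subset by blast
  have "card {n::nat. a \<le> real n \<and> real n < a + l} \<le> nat \<lceil>a + l\<rceil> - nat \<lceil>a\<rceil>"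
    using card_mono[OF _ sub] by simp
  also have "real \<dots> \<le> l + 1" using assms by linarith
  finally show "real (card {n::nat. a \<le> real n \<and> real n < a + l}) \<le> l + 1" by simp
qed

text \<open>With frequencies at spacing \<eta>, a shell around j consists of indices whose distance
  from j lies in a half-open interval of length 1 / (U \<eta>). Since U \<eta> \<le> 1, this length
  is at least 1 and absorbs the rounding.\<close>

lemma card_grid_shell_le:
  fixes l :: "nat \<Rightarrow> real"
  assumes "U > 0" "\<eta> > 0" "U * \<eta> \<le> 1" and l: "\<And>j k. \<bar>l j - l k\<bar> = \<eta> * \<bar>real j - real k\<bar>"
  shows "real (card {k \<in> J. \<bar>l j - l k\<bar> \<le> 1 \<and> real r \<le> U * \<bar>l j - l k\<bar> \<and> U * \<bar>l j - l k\<bar> < real r + 1}) \<le> 4 / (U * \<eta>)" (is "real (card ?S) \<le> _")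
proof -
  define a where "a = real r / (U * \<eta>)"
  define b where "b = 1 / (U * \<eta>)"
  have ab: "a \<ge> 0" "b \<ge> 1" using assms by (auto simp: a_def b_def field_simps)
  let ?I = "{n::nat. a \<le> real n \<and> real n < a + b}"
  have I: "real (card ?I) \<le> b + 1" "finite ?I" using card_nat_interval_le[of a b] ab by auto
  \<comment> \<open>Indices up to j have the form j - n and those above have the form j + n;
    truncation of j - n at 0 can only enlarge the cover.\<close>
  have "?S \<subseteq> (\<lambda>n. j - n) ` ?I \<union> (\<lambda>n. j + n) ` ?I"
  proof
    fix k assume k: "k \<in> ?S"
    then have *: "real r \<le> U * (\<eta> * \<bar>real j - real k\<bar>)" "U * (\<eta> * \<bar>real j - real k\<bar>) < real r + 1" by (auto simp: l)
    have "a \<le> \<bar>real j - real k\<bar>" "\<bar>real j - real k\<bar> < a + b"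
      using * assms by (auto simp: a_def b_def field_simps)
    then show "k \<in> (\<lambda>n. j - n) ` ?I \<union> (\<lambda>n. j + n) ` ?I"
    proof (cases "k \<le> j")
      case True
      then have "j - k \<in> ?I" using \<open>a \<le> _\<close> \<open>_ < a + b\<close> by (auto simp: of_nat_diff)
      then have "j - (j - k) \<in> (\<lambda>n. j - n) ` ?I" by blast
      then show ?thesis using True by simp
    next
      case False
      then have "k - j \<in> ?I" using \<open>a \<le> _\<close> \<open>_ < a + b\<close> by (auto simp: of_nat_diff)
      then have "j + (k - j) \<in> (\<lambda>n. j + n) ` ?I" by blast
      then show ?thesis using False by simp
    qed
  qed
  then have "card ?S \<le> card ((\<lambda>n. j - n) ` ?I \<union> (\<lambda>n. j + n) ` ?I)" using I by (intro card_mono) auto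
  also have "\<dots> \<le> card ?I + card ?I" using I by (intro order.trans[OF card_Un_le] add_mono card_image_le)
  finally have "real (card ?S) \<le> real (card ?I + card ?I)" by (rule of_nat_mono)
  also have "\<dots> \<le> 2 * (b + 1)" using I(1) by simp
  also have "\<dots> \<le> 4 * b" using ab by simp
  finally show ?thesis by (simp add: b_def)
qed

lemma integral_inverse_quadratic_le:
  fixes b U :: real
  assumes "b > 0" "U \<ge> 0"
  shows "(\<lambda>t. 1 / (b\<^sup>2 + t\<^sup>2)) integrable_on {-U..U}" "integral {-U..U} (\<lambda>t. 1 / (b\<^sup>2 + t\<^sup>2)) \<le> 4 / b"
proof -
  have "((\<lambda>t. 1 / (b\<^sup>2 + t\<^sup>2)) has_integral (arctan (U / b) / b - arctan (- U / b) / b)) {-U..U}"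
  proof (rule fundamental_theorem_of_calculus)
    fix t assume "t \<in> {-U..U}"
    have "((\<lambda>t. arctan (t / b)) has_real_derivative inverse (1 + (t / b)\<^sup>2) * (1 / b)) (at t within {-U..U})"
      by (rule DERIV_chain2[OF DERIV_arctan]) (use assms in \<open>auto intro!: derivative_eq_intros\<close>)
    from DERIV_cdivide[OF this, of b]
    have "((\<lambda>t. arctan (t / b) / b) has_real_derivative inverse (1 + (t / b)\<^sup>2) * (1 / b) / b) (at t within {-U..U})" .
    moreover have "inverse (1 + (t / b)\<^sup>2) * (1 / b) / b = 1 / (b\<^sup>2 + t\<^sup>2)"
    proof -
      have "1 + (t / b)\<^sup>2 = (b\<^sup>2 + t\<^sup>2) / b\<^sup>2" using assms by (simp add: power_divide add_divide_distrib)
      then show ?thesis using assms by (simp add: power2_eq_square)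
    qed
    ultimately have "((\<lambda>t. arctan (t / b) / b) has_real_derivative 1 / (b\<^sup>2 + t\<^sup>2)) (at t within {-U..U})" by simp
    then show "((\<lambda>t. arctan (t / b) / b) has_vector_derivative 1 / (b\<^sup>2 + t\<^sup>2)) (at t within {-U..U})"
      by (simp add: has_real_derivative_iff_has_vector_derivative)
  qed (use assms in auto)
  then show "(\<lambda>t. 1 / (b\<^sup>2 + t\<^sup>2)) integrable_on {-U..U}" "integral {-U..U} (\<lambda>t. 1 / (b\<^sup>2 + t\<^sup>2)) \<le> 4 / b"
  proof -
    assume h: "((\<lambda>t. 1 / (b\<^sup>2 + t\<^sup>2)) has_integral (arctan (U / b) / b - arctan (- U / b) / b)) {-U..U}"
    then show "(\<lambda>t. 1 / (b\<^sup>2 + t\<^sup>2)) integrable_on {-U..U}" by blast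
    have "arctan (U / b) - arctan (- U / b) \<le> 4"
      using arctan_ubound[of "U / b"] arctan_lbound[of "- U / b"] pi_less_4 by linarith
    then have "arctan (U / b) / b - arctan (- U / b) / b \<le> 4 / b"
      using assms by (simp add: diff_divide_distrib[symmetric] divide_right_mono)
    with h show "integral {-U..U} (\<lambda>t. 1 / (b\<^sup>2 + t\<^sup>2)) \<le> 4 / b" by (simp add: integral_unique)
  qed
qed

lemma has_sum_norm_le:
  assumes "(f has_sum S) B" "\<And>H. finite H \<Longrightarrow> H \<subseteq> B \<Longrightarrow> norm (sum f H) \<le> e"
  shows "norm S \<le> e"
proof (rule Lim_norm_ubound)
  show "(sum f \<longlongrightarrow> S) (finite_subsets_at_top B)" using assms(1) by (simp add: has_sum_def)
  show "eventually (\<lambda>H. norm (sum f H) \<le> e) (finite_subsets_at_top B)"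
    using assms(2) by (auto simp: eventually_finite_subsets_at_top)
qed simp

lemma norm_add_sq_le: "(norm (a + b))\<^sup>2 \<le> 2 * (norm a)\<^sup>2 + 2 * (norm b)\<^sup>2"
proof -
  have "(norm (a + b))\<^sup>2 \<le> (norm a + norm b)\<^sup>2" by (intro power_mono norm_triangle_ineq) auto
  also have "\<dots> \<le> 2 * (norm a)\<^sup>2 + 2 * (norm b)\<^sup>2" using sum_squares_bound[of "norm a" "norm b"] by (simp add: power2_sum)
  finally show ?thesis .
qed

section \<open>Mollified zeta on the right line, Dirichlet polynomials on the left line\<close>

context beurling begin

lemma abs_nm [simp]: "\<bar>nm m\<bar> = nm m" by (simp add: abs_of_pos)

text \<open>The continued zeta function. At the pole the quotient is 0 by convention, and the
  estimates below stay away from s = 1.\<close>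

definition zeta :: "complex \<Rightarrow> complex" where "zeta s = Z s / (s - 1)"

definition f_moll :: "real \<Rightarrow> complex \<Rightarrow> complex" where
  "f_moll X s = mollifier X s * zeta s - 1"

lemma zeta_eq_zt: "Re s > 1 \<Longrightarrow> zeta s = zt s"
  by (cases "s = 1") (auto simp: zeta_def Z_eq_zt)

lemma holomorphic_zeta: "zeta holomorphic_on ({s. Re s > \<theta>} - {1})"
  unfolding zeta_def by (intro holomorphic_intros holomorphic_on_subset[OF holomorphic_Z]) auto

lemma holomorphic_mollifier: "mollifier X holomorphic_on S"
  unfolding mollifier_def by (intro holomorphic_intros)

lemma holomorphic_f_moll: "f_moll X holomorphic_on ({s. Re s > \<theta>} - {1})"
  unfolding f_moll_def by (intro holomorphic_intros holomorphic_mollifier holomorphic_zeta)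

lemma continuous_on_line:
  assumes "\<sigma> > \<theta>" "\<sigma> \<noteq> 1"
  shows "continuous_on S (\<lambda>t. zeta (Complex \<sigma> t))" "continuous_on S (\<lambda>t. f_moll X (Complex \<sigma> t))"
    "continuous_on S (\<lambda>t. mollifier X (Complex \<sigma> t))"
proof -
  note c = continuous_on_Complex[of S \<sigma>]
  have sub: "Complex \<sigma> ` S \<subseteq> {s. Re s > \<theta>} - {1}" using assms by (auto simp: complex_eq_iff)
  show "continuous_on S (\<lambda>t. zeta (Complex \<sigma> t))"
    by (rule continuous_on_compose2[OF holomorphic_on_imp_continuous_on[OF holomorphic_zeta] c sub])
  show "continuous_on S (\<lambda>t. f_moll X (Complex \<sigma> t))"
    by (rule continuous_on_compose2[OF holomorphic_on_imp_continuous_on[OF holomorphic_f_moll] c sub])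
  show "continuous_on S (\<lambda>t. mollifier X (Complex \<sigma> t))"
    by (rule continuous_on_compose2[OF holomorphic_on_imp_continuous_on[OF holomorphic_mollifier] c subset_UNIV])
qed

text \<open>All coefficients live beyond X, where the condition on U and X gives U n^\<theta> \<le>
  2 n, so the weight n + U n^\<theta> is O(n) as for ordinary integers. The diagonal then becomes
  the tau squared series at 1 + 2 \<delta>, of order \<delta>^(-4), and the squared l1 norm
  contributes \<delta>^(-8) / U.\<close>

lemma mean_square_right_line:
  obtains C where "C > 0" "\<And>X U \<delta>. X \<ge> 1 \<Longrightarrow> U \<ge> 1 \<Longrightarrow> 0 < \<delta> \<Longrightarrow> \<delta> \<le> 1 \<Longrightarrow> U * X powr (\<theta> - 1) \<le> 2 \<Longrightarrow>
    integral {-U..U} (\<lambda>t. (norm (f_moll X (Complex (1 + \<delta>) t)))\<^sup>2) \<le> C * (1 / \<delta> ^ 4 + 1 / (\<delta> ^ 8 * U))"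
proof -
  obtain C0 where C0: "C0 > 0" "\<And>J c U. finite J \<Longrightarrow> U \<ge> 1 \<Longrightarrow>
     integral {-U..U} (\<lambda>t. (norm (\<Sum>m\<in>J. c m * exp (\<i> * of_real (- ln (nm m) * t))))\<^sup>2)
      \<le> C0 * ((\<Sum>m\<in>J. (norm (c m))\<^sup>2 * (nm m + U * nm m powr \<theta>)) + (\<Sum>m\<in>J. norm (c m))\<^sup>2 / U)"
    using mean_square_dirichlet by blast
  obtain c where c: "c \<ge> 1" "\<And>\<sigma>. 1 < \<sigma> \<Longrightarrow> \<sigma> \<le> 3 \<Longrightarrow> Zr \<sigma> \<le> c / (\<sigma> - 1)" using Zr_bound by blast
  have Zr0: "Zr \<sigma> \<ge> 0" for \<sigma> unfolding Zr_def by (rule infsum_nonneg) auto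
  show thesis
  proof (rule that[of "2 * C0 * (3 * c ^ 4 + c ^ 8) + 4"])
    show "2 * C0 * (3 * c ^ 4 + c ^ 8) + 4 > 0" using C0 c by (auto intro!: add_pos_pos mult_pos_pos)
    fix X U \<delta> :: real
    assume X: "X \<ge> 1" and U: "U \<ge> 1" and d: "0 < \<delta>" "\<delta> \<le> 1" and UX: "U * X powr (\<theta> - 1) \<le> 2"
    define \<sigma> where "\<sigma> = 1 + \<delta>"
    have s1: "\<sigma> > 1" using d by (simp add: \<sigma>_def)
    let ?w = "\<lambda>k. (tau k)\<^sup>2 * nm k powr (- \<sigma>)"
    have "?w summable_on UNIV"
      by (rule nonneg_bdd_above_summable_on) (auto intro!: bdd_aboveI sum_tau_sq_le s1)
    \<comment> \<open>The mean value theorem is for finite sums. F leaves a tail of at most 1 / U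
      for every t, which adds only a constant to the integral; how large F is does not matter, since
      the bounds below do not involve its size.\<close>
    then obtain F where F: "finite F" "\<And>H. finite H \<Longrightarrow> H \<inter> F = {} \<Longrightarrow> sum ?w H \<le> 1 / U"
      using infsum_tail_small[of ?w "1 / U"] U by auto
    define S where "S = (\<lambda>t. \<Sum>k\<in>F. of_real (bcoeff X k) * cpow (nm k) (- Complex \<sigma> t))"
    have bw: "norm (of_real (bcoeff X k) * cpow (nm k) (- Complex \<sigma> t)) \<le> ?w k" for k t
      using norm_bcoeff_term_le[of X k "Complex \<sigma> t"] by simp
    have tail: "norm (f_moll X (Complex \<sigma> t) - S t) \<le> 1 / U" for t
    proof (rule has_sum_norm_le)
      have "((\<lambda>k. of_real (bcoeff X k) * cpow (nm k) (- Complex \<sigma> t)) has_sum f_moll X (Complex \<sigma> t)) UNIV"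
        using has_sum_mollified_minus_1[of "Complex \<sigma> t" X] s1 X by (simp add: f_moll_def zeta_eq_zt)
      then show "((\<lambda>k. of_real (bcoeff X k) * cpow (nm k) (- Complex \<sigma> t)) has_sum (f_moll X (Complex \<sigma> t) - S t)) (UNIV - F)"
        unfolding S_def by (rule has_sum_Diff) (auto intro: has_sum_finiteI F)
      fix H assume H: "finite H" "H \<subseteq> UNIV - F"
      have "norm (\<Sum>k\<in>H. of_real (bcoeff X k) * cpow (nm k) (- Complex \<sigma> t)) \<le> sum ?w H"
        by (intro sum_norm_le bw)
      also have "\<dots> \<le> 1 / U" using H by (intro F) auto
      finally show "norm (\<Sum>k\<in>H. of_real (bcoeff X k) * cpow (nm k) (- Complex \<sigma> t)) \<le> 1 / U" .
    qed
    let ?b = "\<lambda>k. complex_of_real (bcoeff X k * nm k powr (- \<sigma>))"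
    have S_eq: "S t = (\<Sum>k\<in>F. of_real (bcoeff X k * nm k powr (- \<sigma>)) * exp (\<i> * of_real (- ln (nm k) * t)))" for t
      unfolding S_def by (intro sum.cong refl) (simp add: cpow_complex)
    have S_cont: "continuous_on T S" for T unfolding S_eq[abs_def] by (intro continuous_intros)
    have f_cont: "continuous_on T (\<lambda>t. f_moll X (Complex \<sigma> t))" for T
      by (rule continuous_on_line) (use s1 th_less in auto)
    have "integral {-U..U} (\<lambda>t. (norm (f_moll X (Complex \<sigma> t)))\<^sup>2) \<le> integral {-U..U} (\<lambda>t. 2 * (norm (S t))\<^sup>2 + 2 / U)"
    proof (rule integral_le)
      fix t :: real
      have "(norm (f_moll X (Complex \<sigma> t)))\<^sup>2 = (norm (S t + (f_moll X (Complex \<sigma> t) - S t)))\<^sup>2" by simp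
      also have "\<dots> \<le> 2 * (norm (S t))\<^sup>2 + 2 * (norm (f_moll X (Complex \<sigma> t) - S t))\<^sup>2" by (rule norm_add_sq_le)
      also have "(norm (f_moll X (Complex \<sigma> t) - S t))\<^sup>2 \<le> (1 / U)\<^sup>2" by (intro power_mono tail) auto
      also have "(1 / U)\<^sup>2 \<le> 1 / U" using U by (simp add: power2_eq_square field_simps)
      finally show "(norm (f_moll X (Complex \<sigma> t)))\<^sup>2 \<le> 2 * (norm (S t))\<^sup>2 + 2 / U" by simp
    qed (intro integrable_continuous_real continuous_intros f_cont S_cont)+
    also have "\<dots> = 2 * integral {-U..U} (\<lambda>t. (norm (S t))\<^sup>2) + 4"
      using U by (subst integral_add) (auto intro!: integrable_continuous_real continuous_intros S_cont)
    also have "integral {-U..U} (\<lambda>t. (norm (S t))\<^sup>2) \<le> C0 * ((\<Sum>k\<in>F. (norm (?b k))\<^sup>2 * (nm k + U * nm k powr \<theta>))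
        + (\<Sum>k\<in>F. norm (?b k))\<^sup>2 / U)"
      unfolding S_eq by (rule C0(2)[OF F(1) U])
    also have "\<dots> \<le> C0 * (3 * c ^ 4 * (1 / \<delta> ^ 4) + c ^ 8 * (1 / (\<delta> ^ 8 * U)))"
    proof (intro mult_left_mono add_mono)
      have "(\<Sum>k\<in>F. (norm (?b k))\<^sup>2 * (nm k + U * nm k powr \<theta>))
         \<le> (\<Sum>k\<in>F. 3 * ((tau k)\<^sup>2 * nm k powr (- (1 + 2 * \<delta>))))"
      proof (rule sum_mono)
        fix k
        show "(norm (?b k))\<^sup>2 * (nm k + U * nm k powr \<theta>) \<le> 3 * ((tau k)\<^sup>2 * nm k powr (- (1 + 2 * \<delta>)))"
        proof (cases "nm k \<le> X")
          case True
          then show ?thesis by (simp add: bcoeff_def)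
        next
          case False
          have "U * nm k powr \<theta> = U * nm k powr (\<theta> - 1) * nm k" by (simp add: powr_diff abs_of_pos)
          also have "\<dots> \<le> U * X powr (\<theta> - 1) * nm k"
            using False X U th_less by (intro mult_right_mono mult_left_mono powr_mono2') (auto simp: less_imp_le)
          also have "\<dots> \<le> 2 * nm k" using UX by (intro mult_right_mono) (auto simp: less_imp_le)
          finally have n3: "nm k + U * nm k powr \<theta> \<le> 3 * nm k" by simp
          have "(norm (?b k))\<^sup>2 * (nm k + U * nm k powr \<theta>)
              \<le> (norm (?b k))\<^sup>2 * (3 * nm k)"
            by (intro mult_left_mono n3) auto
          also have "\<dots> = 3 * (\<bar>bcoeff X k\<bar>\<^sup>2 * (nm k powr (- \<sigma>) * nm k powr (- \<sigma>) * nm k powr 1))"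
            by (simp only: norm_of_real power2_abs power_mult_distrib) (simp add: power2_eq_square)
          also have "nm k powr (- \<sigma>) * nm k powr (- \<sigma>) * nm k powr 1 = nm k powr (- (1 + 2 * \<delta>))"
            unfolding powr_add[symmetric] by (simp add: \<sigma>_def)
          also have "3 * (\<bar>bcoeff X k\<bar>\<^sup>2 * nm k powr (- (1 + 2 * \<delta>))) \<le> 3 * ((tau k)\<^sup>2 * nm k powr (- (1 + 2 * \<delta>)))"
            by (intro mult_left_mono mult_right_mono power_mono abs_bcoeff_le) auto
          finally show ?thesis .
        qed
      qed
      also have "\<dots> \<le> 3 * Zr (1 + 2 * \<delta>) ^ 4"
        unfolding sum_distrib_left[symmetric] by (intro mult_left_mono sum_tau_sq_le F) (use d in auto)
      also have "\<dots> \<le> 3 * (c / (1 + 2 * \<delta> - 1)) ^ 4"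
        by (intro mult_left_mono power_mono c Zr0) (use d in auto)
      also have "\<dots> \<le> 3 * (c / \<delta>) ^ 4"
        by (intro mult_left_mono power_mono divide_left_mono) (use d c in auto)
      also have "\<dots> = 3 * c ^ 4 * (1 / \<delta> ^ 4)" by (simp add: power_divide)
      finally show "(\<Sum>k\<in>F. (norm (?b k))\<^sup>2 * (nm k + U * nm k powr \<theta>)) \<le> 3 * c ^ 4 * (1 / \<delta> ^ 4)" .
      have "(\<Sum>k\<in>F. norm (?b k)) \<le> (\<Sum>k\<in>F. ?w k)"
        by (intro sum_mono order.trans[OF _ bw[of _ 0]]) (simp add: norm_mult norm_cpow)
      also have "\<dots> \<le> Zr \<sigma> ^ 4" by (rule sum_tau_sq_le[OF s1 F(1)])
      also have "\<dots> \<le> (c / (\<sigma> - 1)) ^ 4" by (intro power_mono c Zr0) (use d in \<open>auto simp: \<sigma>_def\<close>)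
      finally have "(\<Sum>k\<in>F. norm (?b k)) \<le> (c / \<delta>) ^ 4" by (simp add: \<sigma>_def)
      then have "(\<Sum>k\<in>F. norm (?b k))\<^sup>2 / U \<le> ((c / \<delta>) ^ 4)\<^sup>2 / U"
        by (intro divide_right_mono power_mono sum_nonneg) (use U in auto)
      then show "(\<Sum>k\<in>F. norm (?b k))\<^sup>2 / U \<le> c ^ 8 * (1 / (\<delta> ^ 8 * U))"
        by (simp add: power_divide flip: power_mult)
    qed (use C0 in auto)
    finally have le: "integral {-U..U} (\<lambda>t. (norm (f_moll X (Complex \<sigma> t)))\<^sup>2)
        \<le> 2 * (C0 * (3 * c ^ 4 * (1 / \<delta> ^ 4) + c ^ 8 * (1 / (\<delta> ^ 8 * U)))) + 4" by simp
    have a1: "1 / \<delta> ^ 4 \<ge> 1" using d by (simp add: power_le_one)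
    have a2: "1 / (\<delta> ^ 8 * U) \<ge> 0" using d U by simp
    have "0 \<le> 2 * C0 * (3 * c ^ 4) * (1 / (\<delta> ^ 8 * U))" "0 \<le> 2 * C0 * c ^ 8 * (1 / \<delta> ^ 4)"
      using C0 c d U by auto
    then have "2 * (C0 * (3 * c ^ 4 * (1 / \<delta> ^ 4) + c ^ 8 * (1 / (\<delta> ^ 8 * U)))) + 4 \<le> (2 * C0 * (3 * c ^ 4 + c ^ 8) + 4) * (1 / \<delta> ^ 4 + 1 / (\<delta> ^ 8 * U))"
      using a1 a2 unfolding distrib_left distrib_right mult.assoc by linarith
    with le show "integral {-U..U} (\<lambda>t. (norm (f_moll X (Complex (1 + \<delta>) t)))\<^sup>2) \<le> (2 * C0 * (3 * c ^ 4 + c ^ 8) + 4) * (1 / \<delta> ^ 4 + 1 / (\<delta> ^ 8 * U))"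
      by (simp add: \<sigma>_def)
  qed
qed

text \<open>On the abscissa (1 + \<theta>) / 2 the weighted square of a coefficient is at most (n^(1
  - \<theta>) + U) / n, and X^(1 - \<theta>) \<le> U turns this into 2 U / n: here the two terms of
  the mean value theorem balance. \<kappa> is the price of moving the line by \<delta> to the left.
  General c serves both the mollifier and the partial sums of zeta.\<close>

lemma mean_square_left_poly:
  obtains C where "C > 0" "\<And>X U \<delta> \<kappa> c. X \<ge> 2 \<Longrightarrow> U \<ge> 1 \<Longrightarrow> 0 \<le> \<delta> \<Longrightarrow> X powr \<delta> \<le> \<kappa> \<Longrightarrow> X powr (1 - \<theta>) \<le> U \<Longrightarrow> (\<And>m. \<bar>c m\<bar> \<le> 1) \<Longrightarrow>
    integral {-U..U} (\<lambda>t. (norm (\<Sum>m | nm m \<le> X. of_real (c m) * cpow (nm m) (- Complex (crit - \<delta>) t)))\<^sup>2)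
      \<le> C * \<kappa>\<^sup>2 * (U * ln X + (ln X)\<^sup>2)"
proof -
  obtain C0 where C0: "C0 > 0" "\<And>J c U. finite J \<Longrightarrow> U \<ge> 1 \<Longrightarrow>
     integral {-U..U} (\<lambda>t. (norm (\<Sum>m\<in>J. c m * exp (\<i> * of_real (- ln (nm m) * t))))\<^sup>2)
      \<le> C0 * ((\<Sum>m\<in>J. (norm (c m))\<^sup>2 * (nm m + U * nm m powr \<theta>)) + (\<Sum>m\<in>J. norm (c m))\<^sup>2 / U)"
    using mean_square_dirichlet by blast
  obtain b where b: "b \<ge> 1" "\<And>x. x \<ge> 2 \<Longrightarrow> (\<Sum>m | nm m \<le> x. 1 / nm m) \<le> b * ln x" using sum_inverse_bound by blast
  show thesis
  proof (rule that[of "C0 * (2 * b + b\<^sup>2)"])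
    show "C0 * (2 * b + b\<^sup>2) > 0" using C0 b by (intro mult_pos_pos add_pos_pos) auto
    fix X U \<delta> \<kappa> :: real and c :: "nat multiset \<Rightarrow> real"
    assume X: "X \<ge> 2" and U: "U \<ge> 1" and d: "0 \<le> \<delta>" and k: "X powr \<delta> \<le> \<kappa>" and XU: "X powr (1 - \<theta>) \<le> U" and c: "\<And>m. \<bar>c m\<bar> \<le> 1"
    define \<sigma> where "\<sigma> = crit - \<delta>"
    let ?J = "{m. nm m \<le> X}"
    have k0: "\<kappa> \<ge> 0" using k powr_ge_zero[of X \<delta>] by linarith
    have lX: "ln X \<ge> 0" using X by simp
    let ?b = "\<lambda>m. complex_of_real (c m * nm m powr (- \<sigma>))"
    have coeff: "\<bar>c m * nm m powr (- \<sigma>)\<bar> \<le> \<kappa> * nm m powr (- crit)" if "nm m \<le> X" for m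
    proof -
      have "\<bar>c m * nm m powr (- \<sigma>)\<bar> \<le> 1 * nm m powr (- \<sigma>)" unfolding abs_mult by (intro mult_mono c) auto
      also have "\<dots> = nm m powr \<delta> * nm m powr (- crit)" by (simp add: powr_add[symmetric] \<sigma>_def)
      also have "\<dots> \<le> \<kappa> * nm m powr (- crit)"
        using that d by (intro mult_right_mono order.trans[OF powr_mono2 k]) (auto simp: less_imp_le)
      finally show ?thesis .
    qed
    have "integral {-U..U} (\<lambda>t. (norm (\<Sum>m\<in>?J. of_real (c m) * cpow (nm m) (- Complex \<sigma> t)))\<^sup>2)
      = integral {-U..U} (\<lambda>t. (norm (\<Sum>m\<in>?J. of_real (c m * nm m powr (- \<sigma>)) * exp (\<i> * of_real (- ln (nm m) * t))))\<^sup>2)"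
      by (simp add: cpow_complex mult.assoc)
    also have "\<dots> \<le> C0 * ((\<Sum>m\<in>?J. (norm (?b m))\<^sup>2 * (nm m + U * nm m powr \<theta>))
       + (\<Sum>m\<in>?J. norm (?b m))\<^sup>2 / U)"
      by (rule C0(2)) (use U in auto)
    also have "\<dots> \<le> C0 * (2 * b * \<kappa>\<^sup>2 * (U * ln X) + b\<^sup>2 * \<kappa>\<^sup>2 * (ln X)\<^sup>2)"
    proof (intro mult_left_mono add_mono)
      have "(\<Sum>m\<in>?J. (norm (?b m))\<^sup>2 * (nm m + U * nm m powr \<theta>)) \<le> (\<Sum>m\<in>?J. 2 * \<kappa>\<^sup>2 * U * (1 / nm m))"
      proof (rule sum_mono)
        fix m assume m: "m \<in> ?J"
        have "(norm (?b m))\<^sup>2 \<le> (\<kappa> * nm m powr (- crit))\<^sup>2"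
          unfolding norm_of_real by (intro power_mono coeff) (use m in auto)
        also have "\<dots> = \<kappa>\<^sup>2 * (nm m powr (- crit) * nm m powr (- crit))" by (simp add: power2_eq_square)
        also have "nm m powr (- crit) * nm m powr (- crit) = nm m powr (- 1 - \<theta>)"
        proof -
          have "- crit + - crit = - 1 - \<theta>" by (simp add: field_simps)
          then show ?thesis by (simp only: powr_add[symmetric])
        qed
        finally have "(norm (?b m))\<^sup>2 * (nm m + U * nm m powr \<theta>) \<le> \<kappa>\<^sup>2 * nm m powr (- 1 - \<theta>) * (nm m + U * nm m powr \<theta>)"
          by (intro mult_right_mono add_nonneg_nonneg mult_nonneg_nonneg) (use U in \<open>auto simp: less_imp_le\<close>)
        also have "\<dots> = \<kappa>\<^sup>2 * (nm m powr (1 - \<theta>) + U) * (1 / nm m)"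
        proof -
          have "nm m powr (- 1 - \<theta>) * nm m powr 1 = nm m powr (1 - \<theta>) * nm m powr (- 1)"
            unfolding powr_add[symmetric] by simp
          moreover have "nm m powr (- 1 - \<theta>) * nm m powr \<theta> = nm m powr (- 1)"
            unfolding powr_add[symmetric] by simp
          moreover have "nm m powr (- 1) = 1 / nm m" "nm m powr 1 = nm m" by (simp_all add: powr_minus_divide)
          ultimately have e: "nm m powr (- 1 - \<theta>) * nm m = nm m powr (1 - \<theta>) * (1 / nm m)"
            "nm m powr (- 1 - \<theta>) * nm m powr \<theta> = 1 / nm m" by simp_all
          have "\<kappa>\<^sup>2 * nm m powr (- 1 - \<theta>) * (nm m + U * nm m powr \<theta>)
            = \<kappa>\<^sup>2 * (nm m powr (- 1 - \<theta>) * nm m) + \<kappa>\<^sup>2 * U * (nm m powr (- 1 - \<theta>) * nm m powr \<theta>)"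
            by (simp only: distrib_left mult_ac)
          also have "\<dots> = \<kappa>\<^sup>2 * (nm m powr (1 - \<theta>) + U) * (1 / nm m)"
            unfolding e by (simp only: distrib_left distrib_right mult_ac)
          finally show ?thesis .
        qed
        also have "nm m powr (1 - \<theta>) \<le> U"
          using m th_less by (intro order.trans[OF powr_mono2 XU]) (auto simp: less_imp_le)
        then have "\<kappa>\<^sup>2 * (nm m powr (1 - \<theta>) + U) * (1 / nm m) \<le> \<kappa>\<^sup>2 * (U + U) * (1 / nm m)"
          by (intro mult_right_mono mult_left_mono) (auto simp: less_imp_le)
        finally show "(norm (?b m))\<^sup>2 * (nm m + U * nm m powr \<theta>) \<le> 2 * \<kappa>\<^sup>2 * U * (1 / nm m)" by (simp add: algebra_simps)
      qed
      also have "\<dots> \<le> 2 * \<kappa>\<^sup>2 * U * (b * ln X)"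
        unfolding sum_distrib_left[symmetric] by (intro mult_left_mono b) (use U X in auto)
      finally show "(\<Sum>m\<in>?J. (norm (?b m))\<^sup>2 * (nm m + U * nm m powr \<theta>)) \<le> 2 * b * \<kappa>\<^sup>2 * (U * ln X)"
        by (simp add: mult_ac)
      \<comment> \<open>For the l1 norm, n^(-(1 + \<theta>) / 2) is written as n^((1 - \<theta>) /
        2) / n and the numerator is taken at X; its square X^(1 - \<theta>) is then cancelled by
        U.\<close>
      have "(\<Sum>m\<in>?J. norm (?b m)) \<le> (\<Sum>m\<in>?J. \<kappa> * X powr ((1 - \<theta>) / 2) * (1 / nm m))"
      proof (rule sum_mono)
        fix m assume m: "m \<in> ?J"
        have "norm (?b m) \<le> \<kappa> * nm m powr (- crit)"
          unfolding norm_of_real by (intro coeff) (use m in auto)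
        also have "nm m powr (- crit) = nm m powr ((1 - \<theta>) / 2) * nm m powr (- 1)"
        proof -
          have "- crit = (1 - \<theta>) / 2 + - 1" by (simp add: field_simps)
          then show ?thesis by (simp only: powr_add[symmetric])
        qed
        also have "nm m powr (- 1) = 1 / nm m" using nm_pos[of m] by (simp add: powr_minus_divide abs_of_pos)
        also have "\<kappa> * (nm m powr ((1 - \<theta>) / 2) * (1 / nm m)) \<le> \<kappa> * (X powr ((1 - \<theta>) / 2) * (1 / nm m))"
          using m k0 th_less by (intro mult_left_mono mult_right_mono powr_mono2) (auto simp: less_imp_le)
        finally show "norm (?b m) \<le> \<kappa> * X powr ((1 - \<theta>) / 2) * (1 / nm m)" by (simp add: mult.assoc)
      qed
      also have "\<dots> \<le> \<kappa> * X powr ((1 - \<theta>) / 2) * (b * ln X)"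
        unfolding sum_distrib_left[symmetric] by (intro mult_left_mono b) (use k0 X in auto)
      finally have "(\<Sum>m\<in>?J. norm (?b m))\<^sup>2 / U \<le> (\<kappa> * X powr ((1 - \<theta>) / 2) * (b * ln X))\<^sup>2 / U"
        by (intro divide_right_mono power_mono sum_nonneg) (use U in auto)
      also have "(\<kappa> * X powr ((1 - \<theta>) / 2) * (b * ln X))\<^sup>2 = b\<^sup>2 * \<kappa>\<^sup>2 * (ln X)\<^sup>2 * (X powr ((1 - \<theta>) / 2) * X powr ((1 - \<theta>) / 2))"
        by (simp add: power2_eq_square)
      also have "X powr ((1 - \<theta>) / 2) * X powr ((1 - \<theta>) / 2) = X powr (1 - \<theta>)"
        unfolding powr_add[symmetric] by simp
      also have "b\<^sup>2 * \<kappa>\<^sup>2 * (ln X)\<^sup>2 * X powr (1 - \<theta>) / U \<le> b\<^sup>2 * \<kappa>\<^sup>2 * (ln X)\<^sup>2 * U / U"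
        using XU U by (intro divide_right_mono mult_left_mono) auto
      finally show "(\<Sum>m\<in>?J. norm (?b m))\<^sup>2 / U \<le> b\<^sup>2 * \<kappa>\<^sup>2 * (ln X)\<^sup>2" using U by simp
    qed (use C0 in auto)
    also have "\<dots> \<le> C0 * (2 * b + b\<^sup>2) * \<kappa>\<^sup>2 * (U * ln X + (ln X)\<^sup>2)"
    proof -
      have "0 \<le> 2 * b * \<kappa>\<^sup>2 * (ln X)\<^sup>2" "0 \<le> b\<^sup>2 * \<kappa>\<^sup>2 * (U * ln X)" using b U lX by auto
      then have "2 * b * \<kappa>\<^sup>2 * (U * ln X) + b\<^sup>2 * \<kappa>\<^sup>2 * (ln X)\<^sup>2 \<le> (2 * b + b\<^sup>2) * \<kappa>\<^sup>2 * (U * ln X + (ln X)\<^sup>2)"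
        unfolding distrib_left distrib_right by linarith
      then show ?thesis using C0(1) by (simp add: mult.assoc)
    qed
    finally show "integral {-U..U} (\<lambda>t. (norm (\<Sum>m | nm m \<le> X. of_real (c m) * cpow (nm m) (- Complex (crit - \<delta>) t)))\<^sup>2)
      \<le> C0 * (2 * b + b\<^sup>2) * \<kappa>\<^sup>2 * (U * ln X + (ln X)\<^sup>2)" by (simp add: \<sigma>_def)
  qed
qed

end

section \<open>Mean values on the left line\<close>

context beurling begin

text \<open>The coefficients decay geometrically at rate \<eta> (\<sigma> - \<theta>), which makes
  both parts of the mean value inequality of order \<eta>^(-2). This is later cancelled by |1 - exp
  (- s \<eta>)|^2 \<le> (|s| \<eta>)^2, so the grid may be as fine as desired.\<close>

lemma mean_square_grid_sum:
  fixes y \<eta> U \<sigma> d :: real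
  assumes y: "y \<ge> 1" and eta: "\<eta> > 0" "\<eta> \<le> 1" and U: "U \<ge> 1" "U * \<eta> \<le> 1"
    and d: "d > 0" "\<theta> + d \<le> \<sigma>" "\<sigma> \<le> 1"
  defines "Y \<equiv> \<lambda>m. y * exp (\<eta> * real m)"
  shows "integral {-U..U} (\<lambda>t. (norm (\<Sum>m<K. of_real (E (Y (Suc m))) * cpow (Y m) (- Complex \<sigma> t)))\<^sup>2)
    \<le> c0\<^sup>2 * exp 2 * (96 / d + 16 / d\<^sup>2) * (y powr (\<theta> - \<sigma>))\<^sup>2 / \<eta>\<^sup>2"
proof -
  define a where "a = \<sigma> - \<theta>"
  have a: "d \<le> a" "a \<le> 1" "a > 0" using d th_nonneg by (auto simp: a_def)
  have ea: "\<eta> * a > 0" "\<eta> * a \<le> 1" "\<eta> * d \<le> \<eta> * a" "\<eta> * d > 0"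
    using eta a d by (auto intro: mult_le_one)
  define q where "q = y powr (\<theta> - \<sigma>)"
  have q: "q > 0" using y by (simp add: q_def)
  have Ypos: "Y m > 0" for m using y by (simp add: Y_def)
  define c where "c = (\<lambda>m. E (Y (Suc m)) * Y m powr (- \<sigma>))"
  have c_bound: "\<bar>c m\<bar> \<le> c0 * exp 1 * q * exp (- (\<eta> * a) * real m)" for m
  proof -
    have "\<bar>c m\<bar> = \<bar>E (Y (Suc m))\<bar> * Y m powr (- \<sigma>)" by (simp add: c_def abs_mult)
    also have "\<dots> \<le> c0 * exp \<eta> * q * exp (- (\<eta> * a) * real m)"
      unfolding Y_def q_def a_def by (rule E_coeff_bound[OF y eta(1)])
    also have "\<dots> \<le> c0 * exp 1 * q * exp (- (\<eta> * a) * real m)"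
      using c0 eta q by (intro mult_right_mono mult_left_mono) auto
    finally show ?thesis .
  qed
  have s1: "(\<Sum>m<K. \<bar>c m\<bar>) \<le> c0 * exp 1 * q * (2 / (\<eta> * d))"
  proof -
    have "(\<Sum>m<K. \<bar>c m\<bar>) \<le> (\<Sum>m<K. c0 * exp 1 * q * exp (- (\<eta> * a) * real m))" by (intro sum_mono c_bound)
    also have "\<dots> = c0 * exp 1 * q * (\<Sum>m<K. exp (- (\<eta> * a) * real m))" by (simp add: sum_distrib_left)
    also have "\<dots> \<le> c0 * exp 1 * q * ((1 + \<eta> * a) / (\<eta> * a))"
      using c0 q ea by (intro mult_left_mono geometric_exp_bound) auto
    also have "(1 + \<eta> * a) / (\<eta> * a) \<le> 2 / (\<eta> * d)" using ea by (intro frac_le) auto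
    finally show ?thesis using c0 q by (simp add: mult_left_mono)
  qed
  have s2: "(\<Sum>m<K. \<bar>c m\<bar>\<^sup>2) \<le> c0\<^sup>2 * exp 2 * q\<^sup>2 * (3 / (2 * (\<eta> * d)))"
  proof -
    have "(\<Sum>m<K. \<bar>c m\<bar>\<^sup>2) \<le> (\<Sum>m<K. c0\<^sup>2 * exp 2 * q\<^sup>2 * exp (- (2 * (\<eta> * a)) * real m))"
    proof (rule sum_mono)
      fix m
      have "\<bar>c m\<bar>\<^sup>2 \<le> (c0 * exp 1 * q * exp (- (\<eta> * a) * real m))\<^sup>2" by (intro power_mono c_bound) auto
      also have "\<dots> = c0\<^sup>2 * exp 2 * q\<^sup>2 * exp (- (2 * (\<eta> * a)) * real m)"
        by (simp add: power_mult_distrib flip: exp_double)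
      finally show "\<bar>c m\<bar>\<^sup>2 \<le> c0\<^sup>2 * exp 2 * q\<^sup>2 * exp (- (2 * (\<eta> * a)) * real m)" .
    qed
    also have "\<dots> = c0\<^sup>2 * exp 2 * q\<^sup>2 * (\<Sum>m<K. exp (- (2 * (\<eta> * a)) * real m))" by (simp add: sum_distrib_left)
    also have "\<dots> \<le> c0\<^sup>2 * exp 2 * q\<^sup>2 * ((1 + 2 * (\<eta> * a)) / (2 * (\<eta> * a)))"
      using q ea by (intro mult_left_mono geometric_exp_bound) auto
    also have "(1 + 2 * (\<eta> * a)) / (2 * (\<eta> * a)) \<le> 3 / (2 * (\<eta> * d))" using ea by (intro frac_le) auto
    finally show ?thesis using q by (simp add: mult_left_mono)
  qed
  have "integral {-U..U} (\<lambda>t. (norm (\<Sum>m<K. of_real (E (Y (Suc m))) * cpow (Y m) (- Complex \<sigma> t)))\<^sup>2)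
     = integral {-U..U} (\<lambda>t. (norm (\<Sum>m\<in>{..<K}. of_real (c m) * exp (\<i> * of_real ((- ln (Y m)) * t))))\<^sup>2)"
    using Ypos by (simp add: cpow_complex c_def mult.assoc)
  also have "\<dots> \<le> 16 * U * (\<Sum>m\<in>{..<K}. (norm (complex_of_real (c m)))\<^sup>2 * (4 / (U * \<eta>))) + 4 / U * (\<Sum>m\<in>{..<K}. norm (complex_of_real (c m)))\<^sup>2"
  proof (rule mean_square_exponential_sum)
    fix j r
    have "\<bar>- ln (Y j) - - ln (Y k)\<bar> = \<eta> * \<bar>real j - real k\<bar>" for j k
    proof -
      have "- ln (Y j) - - ln (Y k) = \<eta> * (real k - real j)" using y by (simp add: Y_def ln_mult algebra_simps)
      then show ?thesis using eta by (simp add: abs_mult abs_minus_commute)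
    qed
    then show "real (card {k \<in> {..<K}. \<bar>- ln (Y j) - - ln (Y k)\<bar> \<le> 1 \<and> real r \<le> U * \<bar>- ln (Y j) - - ln (Y k)\<bar> \<and> U * \<bar>- ln (Y j) - - ln (Y k)\<bar> < real r + 1}) \<le> 4 / (U * \<eta>)"
      using U eta by (intro card_grid_shell_le) auto
  qed (use U in auto)
  also have "\<dots> = 64 / \<eta> * (\<Sum>m<K. \<bar>c m\<bar>\<^sup>2) + 4 / U * (\<Sum>m<K. \<bar>c m\<bar>)\<^sup>2"
    using U eta by (simp add: sum_distrib_right[symmetric] sum_divide_distrib[symmetric])
  also have "\<dots> \<le> 64 / \<eta> * (c0\<^sup>2 * exp 2 * q\<^sup>2 * (3 / (2 * (\<eta> * d)))) + 4 * (c0 * exp 1 * q * (2 / (\<eta> * d)))\<^sup>2"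
  proof (intro add_mono mult_left_mono mult_mono s2 power_mono s1)
    show "4 / U \<le> 4" using U by (simp add: field_simps)
  qed (use U eta in \<open>auto intro: sum_nonneg\<close>)
  also have "\<dots> = c0\<^sup>2 * exp 2 * (96 / d + 16 / d\<^sup>2) * q\<^sup>2 / \<eta>\<^sup>2"
  proof -
    have "exp 2 = (exp 1 :: real)\<^sup>2" by (simp flip: exp_double)
    then show ?thesis using eta d by (simp add: power_mult_distrib power_divide field_simps power2_eq_square)
  qed
  finally show ?thesis by (simp add: q_def)
qed

text \<open>Zeta is split into the polynomial S up to X, the pole term P1, the grid sum P2 beyond X
  and a bounded rest. P2 contributes U^2 X^(2 (\<theta> - \<sigma>)), which is O(\<kappa>^2 U)
  because U \<le> 2 X^(1 - \<theta>): this forces X to be long, whereas S and P1 use X^(1 -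
  \<theta>) \<le> U.\<close>

lemma mean_square_zeta_left:
  obtains C where "C > 0" "\<And>X U \<delta> \<kappa>. X \<ge> 2 \<Longrightarrow> U \<ge> 1 \<Longrightarrow> 0 \<le> \<delta> \<Longrightarrow> \<delta> \<le> (1 - \<theta>) / 4 \<Longrightarrow> X powr \<delta> \<le> \<kappa> \<Longrightarrow>
     X powr (1 - \<theta>) \<le> U \<Longrightarrow> U \<le> 2 * X powr (1 - \<theta>) \<Longrightarrow>
    integral {-U..U} (\<lambda>t. (norm (zeta (Complex (crit - \<delta>) t)))\<^sup>2) \<le> C * \<kappa>\<^sup>2 * (U * ln X + (ln X)\<^sup>2)"
proof -
  obtain C1 where C1: "C1 > 0" "\<And>X U \<delta> \<kappa> c. X \<ge> 2 \<Longrightarrow> U \<ge> 1 \<Longrightarrow> 0 \<le> \<delta> \<Longrightarrow> X powr \<delta> \<le> \<kappa> \<Longrightarrow> X powr (1 - \<theta>) \<le> U \<Longrightarrow> (\<And>m. \<bar>c m\<bar> \<le> 1) \<Longrightarrow>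
    integral {-U..U} (\<lambda>t. (norm (\<Sum>m | nm m \<le> X. of_real (c m) * cpow (nm m) (- Complex (crit - \<delta>) t)))\<^sup>2)
      \<le> C1 * \<kappa>\<^sup>2 * (U * ln X + (ln X)\<^sup>2)"
    using mean_square_left_poly by blast
  define d where "d = (1 - \<theta>) / 4"
  have d: "d > 0" using th_less by (simp add: d_def)
  define Q where "Q = c0\<^sup>2 * exp 2 * (96 / d + 16 / d\<^sup>2)"
  have Q: "Q \<ge> 0" using d by (simp add: Q_def)
  define B where "B = 8 * A\<^sup>2 / d + 64 * Q + 16 * (2 * c0 + 2)\<^sup>2"
  have B: "B \<ge> 0" using d Q by (simp add: B_def)
  show thesis
  proof (rule that[of "2 * C1 + 2 * B"])
    show "2 * C1 + 2 * B > 0" using C1 B by simp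
    fix X U \<delta> \<kappa> :: real
    assume X: "X \<ge> 2" and U: "U \<ge> 1" and del: "0 \<le> \<delta>" "\<delta> \<le> (1 - \<theta>) / 4" and k: "X powr \<delta> \<le> \<kappa>"
      and XU: "X powr (1 - \<theta>) \<le> U" "U \<le> 2 * X powr (1 - \<theta>)"
    define \<sigma> where "\<sigma> = crit - \<delta>"
    have \<sigma>: "\<theta> + d \<le> \<sigma>" "2 * d \<le> 1 - \<sigma>" "\<sigma> \<le> 1" "\<sigma> \<ge> 0"
      using del th_less th_nonneg by (auto simp: \<sigma>_def d_def field_simps)
    have k1: "\<kappa> \<ge> 1" using k X del ge_one_powr_ge_zero[of X \<delta>] by linarith
    have k2: "X powr (2 * \<delta>) \<le> \<kappa>\<^sup>2"
    proof -
      have "(X powr \<delta>)\<^sup>2 \<le> \<kappa>\<^sup>2" by (intro power_mono k) auto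
      then show ?thesis by (simp add: power2_eq_square flip: powr_add)
    qed
    have lX: "ln X \<ge> 1 / 2" using X by (rule ln_ge_half)
    have ns: "norm (Complex \<sigma> t) \<le> 1 + U" if "t \<in> {-U..U}" for t
      using cmod_le[of "Complex \<sigma> t"] \<sigma> that by auto
    have s1: "Complex \<sigma> t \<noteq> 1" for t using \<sigma> d by (auto simp: complex_eq_iff)
    define B1 where "B1 = c0 * (2 + (1 + U) / d)"
    have B1: "B1 > 0" using c0 d U by (auto simp: B1_def intro!: mult_pos_pos add_pos_nonneg)
    \<comment> \<open>So far out that what lies beyond z contributes at most 1 throughout |t| \<le>
      U. It may be huge, since it does not enter the final bound.\<close>
    define z where "z = max (X + 1) (B1 powr (1 / d))"
    have z: "z \<ge> X + 1" "z \<ge> 1" using X by (auto simp: z_def)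
    have zd: "B1 * z powr (- d) \<le> 1"
    proof -
      have "z powr (- d) \<le> (B1 powr (1 / d)) powr (- d)" using B1 d by (intro powr_mono2') (auto simp: z_def)
      also have "\<dots> = 1 / B1" using B1 d by (simp add: powr_powr powr_minus_divide)
      finally show ?thesis using B1 by (simp add: field_simps)
    qed
    define l where "l = ln z - ln X"
    have l: "l > 0" using z X by (simp add: l_def)
    \<comment> \<open>Collects the requirements \<eta> \<le> 1, U \<eta> \<le> 1 and discretization
      error at most 1 into the single condition \<eta> R \<le> 1. With K steps of logarithmic length
      l / K the grid from X ends exactly at z.\<close>
    define R where "R = 1 + U + (2 * A + c0) * (1 + U) * z"
    have R0: "(2 * A + c0) * (1 + U) * z \<ge> 0" using A_pos c0 U z by simp
    then have R: "R \<ge> 1 + U" by (simp add: R_def)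
    define K where "K = nat \<lceil>l * R\<rceil> + 1"
    define \<eta> where "\<eta> = l / real K"
    have K: "real K > 0" "l * R \<le> real K" unfolding K_def by linarith+
    have eR: "\<eta> * R \<le> 1" using K by (simp add: \<eta>_def field_simps)
    have eta0: "\<eta> > 0" using l K by (simp add: \<eta>_def)
    have eta: "\<eta> \<le> 1" "U * \<eta> \<le> 1" "(2 * A + c0) * (1 + U) * \<eta> * z \<le> 1"
    proof -
      have e: "\<eta> * 1 + \<eta> * U + \<eta> * ((2 * A + c0) * (1 + U) * z) \<le> 1" using eR unfolding R_def distrib_left .
      have "\<eta> * U \<ge> 0" "\<eta> * ((2 * A + c0) * (1 + U) * z) \<ge> 0" using eta0 U R0 by auto
      with e eta0 show "\<eta> \<le> 1" "U * \<eta> \<le> 1" "(2 * A + c0) * (1 + U) * \<eta> * z \<le> 1"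
        by (simp_all add: mult_ac)
    qed
    have zY: "z = X * exp (\<eta> * real K)" using K z X by (simp add: \<eta>_def l_def exp_diff)
    define P where "P = (\<lambda>t. \<Sum>m<K. of_real (E (X * exp (\<eta> * real (Suc m)))) * cpow (X * exp (\<eta> * real m)) (- Complex \<sigma> t))"
    define S where "S = (\<lambda>t. \<Sum>m | nm m \<le> X. cpow (nm m) (- Complex \<sigma> t))"
    define P1 where "P1 = (\<lambda>t. of_real A * cpow X (1 - Complex \<sigma> t) / (Complex \<sigma> t - 1))"
    define P2 where "P2 = (\<lambda>t. (1 - exp (- Complex \<sigma> t * of_real \<eta>)) * P t)"
    have rest: "norm (zeta (Complex \<sigma> t) - S t - P1 t - P2 t) \<le> 2 * c0 + 2" if t: "t \<in> {-U..U}" for t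
    proof -
      let ?s = "Complex \<sigma> t"
      have 1: "norm (zeta ?s - \<Phi> z ?s / (?s - 1)) \<le> 1"
      proof -
        have "norm (zeta ?s - \<Phi> z ?s / (?s - 1)) = norm (Z ?s - \<Phi> z ?s) / norm (?s - 1)"
          by (simp add: zeta_def norm_divide flip: diff_divide_distrib)
        also have "\<dots> \<le> G ?s * z powr (\<theta> - Re ?s) / norm (?s - 1)"
          by (intro divide_right_mono Z_approx) (use \<sigma> d z in auto)
        also have "\<dots> = c0 * (2 + norm ?s / (\<sigma> - \<theta>)) * z powr (\<theta> - \<sigma>)" using s1[of t] by (simp add: G_def)
        also have "\<dots> \<le> B1 * z powr (- d)" unfolding B1_def
          using c0 ns[OF t] \<sigma> d z U by (intro mult_mono mult_left_mono add_left_mono frac_le powr_mono) auto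
        finally show ?thesis using zd by linarith
      qed
      have "(?s - 1) * D X z ?s = \<Phi> z ?s - \<Phi> X ?s" using X z s1 by (simp add: \<Phi>_diff)
      then have 2: "\<Phi> z ?s / (?s - 1) = S t + P1 t + D X z ?s"
        using s1[of t] by (simp add: \<Phi>_def S_def P1_def field_simps)
      have 3: "norm (D X z ?s - P2 t) \<le> 2 * c0 + 1"
      proof -
        have "norm (D X z ?s - P2 t) \<le> 2 * c0 * X powr (\<theta> - Re ?s) + (2 * A + c0) * norm ?s * \<eta> * z"
          unfolding P2_def P_def zY by (rule D_main) (use X eta0 s1 \<sigma> d in auto)
        also have "X powr (\<theta> - Re ?s) \<le> X powr 0" using X \<sigma> d by (intro powr_mono) auto
        then have "2 * c0 * X powr (\<theta> - Re ?s) \<le> 2 * c0 * 1" using c0 X by (intro mult_left_mono) auto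
        moreover have "(2 * A + c0) * norm ?s * \<eta> * z \<le> (2 * A + c0) * (1 + U) * \<eta> * z"
          using A_pos c0 eta0 z ns[OF t] by (intro mult_right_mono mult_left_mono) auto
        ultimately show ?thesis using eta by linarith
      qed
      have "zeta ?s - S t - P1 t - P2 t = (zeta ?s - \<Phi> z ?s / (?s - 1)) + (D X z ?s - P2 t)" by (simp add: 2)
      also have "norm \<dots> \<le> 1 + (2 * c0 + 1)" by (intro order.trans[OF norm_triangle_ineq] add_mono 1 3)
      finally show ?thesis by simp
    qed
    note cC = continuous_on_Complex
    have S_cont: "continuous_on T S" and P_cont: "continuous_on T P" for T
      unfolding S_def P_def by (intro continuous_intros cC)+
    have P1_cont: "continuous_on T P1" for T
      unfolding P1_def by (intro continuous_intros cC) (use s1 in auto)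
    have P2_cont: "continuous_on T P2" for T
      unfolding P2_def by (intro continuous_intros cC P_cont)
    have z_cont: "continuous_on T (\<lambda>t. zeta (Complex \<sigma> t))" for T
      by (rule continuous_on_line) (use \<sigma> d in auto)
    have int: "integral {-U..U} (\<lambda>t. (norm (zeta (Complex \<sigma> t)))\<^sup>2)
      \<le> integral {-U..U} (\<lambda>t. 2 * (norm (S t))\<^sup>2 + (4 * (norm (P1 t))\<^sup>2 + (8 * (norm (P2 t))\<^sup>2 + 8 * (2 * c0 + 2)\<^sup>2)))"
    proof (rule integral_le)
      fix t assume t: "t \<in> {-U..U}"
      let ?r = "zeta (Complex \<sigma> t) - S t - P1 t - P2 t"
      have "zeta (Complex \<sigma> t) = S t + (P1 t + (P2 t + ?r))" by simp
      then have "(norm (zeta (Complex \<sigma> t)))\<^sup>2 \<le> 2 * (norm (S t))\<^sup>2 + 2 * (norm (P1 t + (P2 t + ?r)))\<^sup>2"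
        by (metis norm_add_sq_le)
      moreover have "(norm (P1 t + (P2 t + ?r)))\<^sup>2 \<le> 2 * (norm (P1 t))\<^sup>2 + 2 * (norm (P2 t + ?r))\<^sup>2" by (rule norm_add_sq_le)
      moreover have "(norm (P2 t + ?r))\<^sup>2 \<le> 2 * (norm (P2 t))\<^sup>2 + 2 * (norm ?r)\<^sup>2" by (rule norm_add_sq_le)
      moreover have "(norm ?r)\<^sup>2 \<le> (2 * c0 + 2)\<^sup>2" by (intro power_mono rest t) auto
      ultimately show "(norm (zeta (Complex \<sigma> t)))\<^sup>2 \<le> 2 * (norm (S t))\<^sup>2 + (4 * (norm (P1 t))\<^sup>2 + (8 * (norm (P2 t))\<^sup>2 + 8 * (2 * c0 + 2)\<^sup>2))"
        by linarith
    qed (intro integrable_continuous_real continuous_intros S_cont P1_cont P2_cont z_cont)+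
    have "integral {-U..U} (\<lambda>t. 2 * (norm (S t))\<^sup>2 + (4 * (norm (P1 t))\<^sup>2 + (8 * (norm (P2 t))\<^sup>2 + 8 * (2 * c0 + 2)\<^sup>2)))
      = 2 * integral {-U..U} (\<lambda>t. (norm (S t))\<^sup>2) + (4 * integral {-U..U} (\<lambda>t. (norm (P1 t))\<^sup>2) + (8 * integral {-U..U} (\<lambda>t. (norm (P2 t))\<^sup>2) + 8 * (2 * c0 + 2)\<^sup>2 * (2 * U)))"
      using U
      by (subst integral_add, (intro integrable_continuous_real continuous_intros S_cont P1_cont P2_cont)+)+ simp
    note int = int[unfolded this]
    have iS: "integral {-U..U} (\<lambda>t. (norm (S t))\<^sup>2) \<le> C1 * \<kappa>\<^sup>2 * (U * ln X + (ln X)\<^sup>2)"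
      using C1(2)[OF X U del(1) k XU(1), of "\<lambda>_. 1"] by (simp add: S_def \<sigma>_def)
    have iP1: "integral {-U..U} (\<lambda>t. (norm (P1 t))\<^sup>2) \<le> A\<^sup>2 * \<kappa>\<^sup>2 * U * (2 / d)"
    proof -
      have X2: "X powr (2 * (1 - \<sigma>)) \<le> \<kappa>\<^sup>2 * U"
      proof -
        have "X powr (2 * (1 - \<sigma>)) = X powr (2 * \<delta>) * X powr (1 - \<theta>)" 
        proof -
          have "2 * (1 - \<sigma>) = 2 * \<delta> + (1 - \<theta>)" by (simp add: \<sigma>_def field_simps)
          then show ?thesis by (simp only: powr_add)
        qed
        also have "\<dots> \<le> \<kappa>\<^sup>2 * U" by (intro mult_mono k2 XU) auto
        finally show ?thesis .
      qed
      have b: "1 - \<sigma> > 0" using \<sigma> d by linarith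
      have "integral {-U..U} (\<lambda>t. (norm (P1 t))\<^sup>2) \<le> integral {-U..U} (\<lambda>t. A\<^sup>2 * (\<kappa>\<^sup>2 * U) * (1 / ((1 - \<sigma>)\<^sup>2 + t\<^sup>2)))"
      proof (rule integral_le)
        show "(\<lambda>t. A\<^sup>2 * (\<kappa>\<^sup>2 * U) * (1 / ((1 - \<sigma>)\<^sup>2 + t\<^sup>2))) integrable_on {-U..U}"
          by (intro integrable_continuous_real continuous_intros) (use b in \<open>auto simp: sum_power2_eq_zero_iff\<close>)
        fix t
        have "(norm (P1 t))\<^sup>2 = A\<^sup>2 * (X powr (1 - \<sigma>))\<^sup>2 / (norm (Complex \<sigma> t - 1))\<^sup>2"
          using X by (simp add: P1_def norm_mult norm_divide norm_cpow power_mult_distrib power_divide)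
        also have "(norm (Complex \<sigma> t - 1))\<^sup>2 = (1 - \<sigma>)\<^sup>2 + t\<^sup>2" by (simp add: cmod_power2 power2_commute)
        also have "(X powr (1 - \<sigma>))\<^sup>2 = X powr (2 * (1 - \<sigma>))" by (simp add: power2_eq_square flip: powr_add)
        also have "A\<^sup>2 * X powr (2 * (1 - \<sigma>)) / ((1 - \<sigma>)\<^sup>2 + t\<^sup>2) \<le> A\<^sup>2 * (\<kappa>\<^sup>2 * U) / ((1 - \<sigma>)\<^sup>2 + t\<^sup>2)"
          by (intro divide_right_mono mult_left_mono X2) auto
        finally show "(norm (P1 t))\<^sup>2 \<le> A\<^sup>2 * (\<kappa>\<^sup>2 * U) * (1 / ((1 - \<sigma>)\<^sup>2 + t\<^sup>2))" by simp
      qed (intro integrable_continuous_real continuous_intros P1_cont)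
      also have "\<dots> = A\<^sup>2 * (\<kappa>\<^sup>2 * U) * integral {-U..U} (\<lambda>t. 1 / ((1 - \<sigma>)\<^sup>2 + t\<^sup>2))"
        by (rule Henstock_Kurzweil_Integration.integral_mult_right)
      also have "\<dots> \<le> A\<^sup>2 * (\<kappa>\<^sup>2 * U) * (4 / (1 - \<sigma>))"
        using integral_inverse_quadratic_le(2)[OF b, of U] U by (intro mult_left_mono) auto
      also have "4 / (1 - \<sigma>) \<le> 4 / (2 * d)" using \<sigma> d by (intro divide_left_mono) auto
      then have "A\<^sup>2 * (\<kappa>\<^sup>2 * U) * (4 / (1 - \<sigma>)) \<le> A\<^sup>2 * (\<kappa>\<^sup>2 * U) * (4 / (2 * d))" using U by (intro mult_left_mono) auto
      finally show ?thesis by (simp add: mult.assoc)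
    qed
    have iP2: "integral {-U..U} (\<lambda>t. (norm (P2 t))\<^sup>2) \<le> 8 * \<kappa>\<^sup>2 * U * Q"
    proof -
      have "integral {-U..U} (\<lambda>t. (norm (P2 t))\<^sup>2) \<le> integral {-U..U} (\<lambda>t. (2 * U * \<eta>)\<^sup>2 * (norm (P t))\<^sup>2)"
      proof (rule integral_le)
        fix t assume t: "t \<in> {-U..U}"
        have "norm (1 - exp (- Complex \<sigma> t * of_real \<eta>)) \<le> norm (Complex \<sigma> t) * \<eta>"
          using norm_one_minus_exp[of X \<eta> "Complex \<sigma> t"] X eta0 \<sigma> by simp
        also have "\<dots> \<le> 2 * U * \<eta>" using ns[OF t] U eta0 by (intro mult_right_mono) auto
        finally have "(norm (1 - exp (- Complex \<sigma> t * of_real \<eta>)))\<^sup>2 \<le> (2 * U * \<eta>)\<^sup>2" by (intro power_mono) auto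
        then show "(norm (P2 t))\<^sup>2 \<le> (2 * U * \<eta>)\<^sup>2 * (norm (P t))\<^sup>2"
          unfolding P2_def norm_mult power_mult_distrib[of "norm (1 - _)"] by (intro mult_right_mono) auto
      qed (intro integrable_continuous_real continuous_intros P2_cont P_cont)+
      also have "\<dots> = (2 * U * \<eta>)\<^sup>2 * integral {-U..U} (\<lambda>t. (norm (P t))\<^sup>2)" by simp
      also have "\<dots> \<le> (2 * U * \<eta>)\<^sup>2 * (Q * (X powr (\<theta> - \<sigma>))\<^sup>2 / \<eta>\<^sup>2)"
        unfolding P_def Q_def by (intro mult_left_mono mean_square_grid_sum) (use X eta0 eta U d \<sigma> in auto)
      also have "\<dots> = 4 * U * Q * (U * (X powr (\<theta> - \<sigma>))\<^sup>2)" using eta0 by (simp add: power2_eq_square)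
      also have "U * (X powr (\<theta> - \<sigma>))\<^sup>2 \<le> 2 * \<kappa>\<^sup>2"
      proof -
        have e: "(X powr (\<theta> - \<sigma>))\<^sup>2 = X powr (2 * \<delta>) * X powr (\<theta> - 1)"
          by (simp add: power2_eq_square \<sigma>_def algebra_simps flip: powr_add)
        have "U * X powr (\<theta> - 1) \<le> 2 * X powr (1 - \<theta>) * X powr (\<theta> - 1)" using XU by (intro mult_right_mono) auto
        also have "\<dots> = 2" using X by (simp add: mult.assoc flip: powr_add)
        finally have "X powr (2 * \<delta>) * (U * X powr (\<theta> - 1)) \<le> \<kappa>\<^sup>2 * 2" using k2 U by (intro mult_mono) auto
        then show ?thesis by (simp add: e mult_ac)
      qed
      then have "4 * U * Q * (U * (X powr (\<theta> - \<sigma>))\<^sup>2) \<le> 4 * U * Q * (2 * \<kappa>\<^sup>2)" using U Q by (intro mult_left_mono) auto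
      finally show ?thesis by (simp add: mult_ac)
    qed
    have "integral {-U..U} (\<lambda>t. (norm (zeta (Complex \<sigma> t)))\<^sup>2)
      \<le> 2 * (C1 * \<kappa>\<^sup>2 * (U * ln X + (ln X)\<^sup>2)) + (4 * (A\<^sup>2 * \<kappa>\<^sup>2 * U * (2 / d)) + (8 * (8 * \<kappa>\<^sup>2 * U * Q) + 8 * (2 * c0 + 2)\<^sup>2 * (2 * U)))"
      using int iS iP1 iP2 by linarith
    also have "8 * (2 * c0 + 2)\<^sup>2 * (2 * U) \<le> \<kappa>\<^sup>2 * (16 * (2 * c0 + 2)\<^sup>2 * U)"
      using k1 U mult_right_mono[of 1 "\<kappa>\<^sup>2" "16 * (2 * c0 + 2)\<^sup>2 * U"] by (simp add: one_le_power mult_ac)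
    finally have fin: "integral {-U..U} (\<lambda>t. (norm (zeta (Complex \<sigma> t)))\<^sup>2) \<le> 2 * C1 * \<kappa>\<^sup>2 * (U * ln X + (ln X)\<^sup>2) + \<kappa>\<^sup>2 * B * U"
      by (simp add: B_def algebra_simps)
    have "U * 1 \<le> U * (2 * ln X)" using lX U by (intro mult_left_mono) auto
    then have "U \<le> 2 * (U * ln X)" by simp
    then have "U \<le> 2 * (U * ln X + (ln X)\<^sup>2)" by (simp add: add_increasing2)
    then have "\<kappa>\<^sup>2 * B * U \<le> \<kappa>\<^sup>2 * B * (2 * (U * ln X + (ln X)\<^sup>2))" using B by (intro mult_left_mono) auto
    with fin show "integral {-U..U} (\<lambda>t. (norm (zeta (Complex (crit - \<delta>) t)))\<^sup>2) \<le> (2 * C1 + 2 * B) * \<kappa>\<^sup>2 * (U * ln X + (ln X)\<^sup>2)"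
      by (simp add: \<sigma>_def algebra_simps)
  qed
qed

text \<open>Both factors of the product have mean squares of the same order, so the inequality 2 a b
  \<le> a^2 + b^2 under the integral does the work of Cauchy-Schwarz.\<close>

lemma mean_left_line:
  obtains C where "C > 0" "\<And>X U \<delta> \<kappa>. X \<ge> 2 \<Longrightarrow> U \<ge> 1 \<Longrightarrow> 0 \<le> \<delta> \<Longrightarrow> \<delta> \<le> (1 - \<theta>) / 4 \<Longrightarrow> X powr \<delta> \<le> \<kappa> \<Longrightarrow>
     X powr (1 - \<theta>) \<le> U \<Longrightarrow> U \<le> 2 * X powr (1 - \<theta>) \<Longrightarrow>
    integral {-U..U} (\<lambda>t. norm (f_moll X (Complex (crit - \<delta>) t))) \<le> C * \<kappa>\<^sup>2 * (U * ln X + (ln X)\<^sup>2)"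
proof -
  obtain C1 where C1: "C1 > 0" "\<And>X U \<delta> \<kappa> c. X \<ge> 2 \<Longrightarrow> U \<ge> 1 \<Longrightarrow> 0 \<le> \<delta> \<Longrightarrow> X powr \<delta> \<le> \<kappa> \<Longrightarrow> X powr (1 - \<theta>) \<le> U \<Longrightarrow> (\<And>m. \<bar>c m\<bar> \<le> 1) \<Longrightarrow>
    integral {-U..U} (\<lambda>t. (norm (\<Sum>m | nm m \<le> X. of_real (c m) * cpow (nm m) (- Complex (crit - \<delta>) t)))\<^sup>2)
      \<le> C1 * \<kappa>\<^sup>2 * (U * ln X + (ln X)\<^sup>2)"
    using mean_square_left_poly by blast
  obtain C2 where C2: "C2 > 0" "\<And>X U \<delta> \<kappa>. X \<ge> 2 \<Longrightarrow> U \<ge> 1 \<Longrightarrow> 0 \<le> \<delta> \<Longrightarrow> \<delta> \<le> (1 - \<theta>) / 4 \<Longrightarrow> X powr \<delta> \<le> \<kappa> \<Longrightarrow>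
     X powr (1 - \<theta>) \<le> U \<Longrightarrow> U \<le> 2 * X powr (1 - \<theta>) \<Longrightarrow>
    integral {-U..U} (\<lambda>t. (norm (zeta (Complex (crit - \<delta>) t)))\<^sup>2) \<le> C2 * \<kappa>\<^sup>2 * (U * ln X + (ln X)\<^sup>2)"
    using mean_square_zeta_left by blast
  show thesis
  proof (rule that[of "C1 + C2 + 4"])
    show "C1 + C2 + 4 > 0" using C1 C2 by simp
    fix X U \<delta> \<kappa> :: real
    assume X: "X \<ge> 2" and U: "U \<ge> 1" and del: "0 \<le> \<delta>" "\<delta> \<le> (1 - \<theta>) / 4" and k: "X powr \<delta> \<le> \<kappa>"
      and XU: "X powr (1 - \<theta>) \<le> U" "U \<le> 2 * X powr (1 - \<theta>)"
    define \<sigma> where "\<sigma> = crit - \<delta>"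
    have \<sigma>: "\<sigma> > \<theta>" "\<sigma> \<noteq> 1" using del th_less by (auto simp: \<sigma>_def field_simps)
    have k1: "\<kappa> \<ge> 1" using k X del ge_one_powr_ge_zero[of X \<delta>] by linarith
    have lX: "ln X \<ge> 1 / 2" using X by (rule ln_ge_half)
    let ?W = "U * ln X + (ln X)\<^sup>2"
    let ?M = "\<lambda>t. mollifier X (Complex \<sigma> t)" and ?Z = "\<lambda>t. zeta (Complex \<sigma> t)"
    have "integral {-U..U} (\<lambda>t. norm (f_moll X (Complex \<sigma> t))) \<le> integral {-U..U} (\<lambda>t. (norm (?M t))\<^sup>2 + ((norm (?Z t))\<^sup>2 + 1))"
    proof (rule integral_le)
      fix t
      have "norm (f_moll X (Complex \<sigma> t)) \<le> norm (?M t) * norm (?Z t) + 1"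
        unfolding f_moll_def by (rule order.trans[OF norm_triangle_ineq4]) (simp add: norm_mult)
      moreover have "2 * norm (?M t) * norm (?Z t) \<le> (norm (?M t))\<^sup>2 + (norm (?Z t))\<^sup>2" by (rule sum_squares_bound)
      moreover have "norm (?M t) * norm (?Z t) \<ge> 0" by simp
      ultimately show "norm (f_moll X (Complex \<sigma> t)) \<le> (norm (?M t))\<^sup>2 + ((norm (?Z t))\<^sup>2 + 1)" by linarith
    qed (intro integrable_continuous_real continuous_intros continuous_on_line \<sigma>)+
    also have "\<dots> = integral {-U..U} (\<lambda>t. (norm (?M t))\<^sup>2) + (integral {-U..U} (\<lambda>t. (norm (?Z t))\<^sup>2) + 2 * U)"
      using U by (subst integral_add, (intro integrable_continuous_real continuous_intros continuous_on_line \<sigma>)+)+ simp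
    also have "integral {-U..U} (\<lambda>t. (norm (?M t))\<^sup>2) \<le> C1 * \<kappa>\<^sup>2 * ?W"
      unfolding mollifier_def \<sigma>_def by (rule C1(2)[OF X U del(1) k XU(1) abs_moeb_le])
    also have "integral {-U..U} (\<lambda>t. (norm (?Z t))\<^sup>2) \<le> C2 * \<kappa>\<^sup>2 * ?W"
      unfolding \<sigma>_def by (rule C2(2)[OF X U del k XU])
    also have "2 * U \<le> 4 * \<kappa>\<^sup>2 * ?W"
    proof -
      have lin: "u \<le> 2 * a \<Longrightarrow> 0 \<le> b \<Longrightarrow> 2 * u \<le> 4 * (a + b)" for u a b :: real by simp
      have "U * 1 \<le> U * (2 * ln X)" using lX U by (intro mult_left_mono) auto
      then have "U \<le> 2 * (U * ln X)" by simp
      then have "2 * U \<le> 4 * ?W" by (rule lin) simp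
      also have "\<dots> \<le> \<kappa>\<^sup>2 * (4 * ?W)" using k1 U lX mult_right_mono[of 1 "\<kappa>\<^sup>2" "4 * ?W"] by (simp add: one_le_power)
      finally show ?thesis by (simp only: mult_ac)
    qed
    finally show "integral {-U..U} (\<lambda>t. norm (f_moll X (Complex (crit - \<delta>) t))) \<le> (C1 + C2 + 4) * \<kappa>\<^sup>2 * ?W"
      by (simp add: \<sigma>_def algebra_simps)
  qed
qed

end

subsection \<open>Counting zeros in windows\<close>

text \<open>Jensen's bound, by moving every zero out of the disc with a Blaschke factor.\<close>
lemma zero_count_disc:
  fixes f :: "complex \<Rightarrow> complex"
  assumes holf: "f holomorphic_on ball c R'" and r: "0 < r" "r < R" "R < R'"
    and B: "\<And>z. z \<in> cball c R \<Longrightarrow> norm (f z) \<le> B" and fc: "f c \<noteq> 0"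
  defines "S \<equiv> {z \<in> cball c r. f z = 0}"
  shows "finite S" "norm (f c) * (R / r) ^ (\<Sum>z\<in>S. nat (zorder f z)) \<le> B"
proof -
  \<comment> \<open>An intermediate radius: its closed disc is compact inside the domain, hence
    contains finitely many zeros, and its open disc is a neighbourhood of
    \<open>cball c R\<close>.\<close>
  define R1 where "R1 = (R + R') / 2"
  have R1: "R < R1" "R1 < R'" using r by (auto simp: R1_def)
  have cR: "c \<in> ball c R'" using r by simp
  define W0 where "W0 = {z \<in> cball c R1. f z = 0}"
  have "finite W0" unfolding W0_def
  proof (cases "f constant_on ball c R'")
    case True
    then have "f z \<noteq> 0" if "z \<in> cball c R1" for z
    proof -
      have "z \<in> ball c R'" using that R1 by auto
      then have "f z = f c" using True cR by (auto simp: constant_on_def)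
      then show ?thesis using fc by simp
    qed
    then have e: "{z \<in> cball c R1. f z = 0} = {}" by blast
    show "finite {z \<in> cball c R1. f z = 0}" unfolding e by simp
  next
    case False
    show "finite {z \<in> cball c R1. f z = 0}"
      by (rule holomorphic_compact_finite_zeros[OF holf _ _ _ _ False]) (use R1 in auto)
  qed
  then show finS: "finite S" by (rule finite_subset[rotated]) (use r R1 in \<open>auto simp: S_def W0_def\<close>)
  let ?A = "ball c R1"
  define W where "W = {z \<in> ?A. f z = 0}"
  have W: "finite W" by (rule finite_subset[OF _ \<open>finite W0\<close>]) (auto simp: W_def W0_def)
  define k where "k = (\<lambda>z. nat (zorder f z))"
  have holA: "f holomorphic_on ?A" using holf by (rule holomorphic_on_subset) (use R1 in auto)
  have cA: "c \<in> ?A" using r R1 by simp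
  have zo: "(if f z = 0 then zorder f z > 0 else zorder f z = 0)" if "z \<in> ?A" for z
  proof -
    have "\<exists>w\<in>?A. f w \<noteq> 0" using fc cA by blast
    from zorder_exist_zero[OF holA open_ball connected_ball that this] show ?thesis by auto
  qed
  \<comment> \<open>Q carries all zeros of f in the larger disc with their orders, so the quotient h
    is holomorphic; G below restores the factors of the zeros outside S.\<close>
  define Q where "Q = (\<lambda>z. \<Prod>w\<in>W. (z - w) ^ k w)"
  have holQ: "Q holomorphic_on T" for T unfolding Q_def by (intro holomorphic_intros)
  have Q0: "Q z = 0 \<longleftrightarrow> z \<in> W" if "z \<in> ?A" for z
  proof
    assume "Q z = 0"
    then show "z \<in> W" using W by (auto simp: Q_def)
  next
    assume z: "z \<in> W"
    then have "k z > 0" using zo[OF that] by (simp add: W_def k_def)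
    then show "Q z = 0" using z W by (auto simp: Q_def)
  qed
  have zoQ: "zorder Q z = zorder f z" if z: "z \<in> ?A" for z
  proof (cases "z \<in> W")
    case True
    define g where "g = (\<lambda>x. \<Prod>w\<in>W - {z}. (x - w) ^ k w)"
    have "zorder Q z = int (k z)"
    proof (rule zorder_eqI[of UNIV])
      show "g holomorphic_on UNIV" unfolding g_def by (intro holomorphic_intros)
      show "g z \<noteq> 0" using W by (auto simp: g_def)
      show "Q w = g w * (w - z) powi int (k z)" for w
        using W True by (simp add: Q_def g_def prod.remove[of W z] mult.commute)
    qed auto
    then show ?thesis using zo[OF z] True by (simp add: k_def W_def)
  next
    case False
    then have "f z \<noteq> 0" "Q z \<noteq> 0" using z Q0 by (auto simp: W_def)
    moreover have "Q analytic_on UNIV" using holQ by (simp add: analytic_on_open)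
    then have "Q analytic_on {z}" by (rule analytic_on_subset) auto
    ultimately show ?thesis using zo[OF z] zorder_eq_0I[of Q z] by simp
  qed
  obtain h where h: "h holomorphic_on ?A" "\<And>z. z \<in> ?A \<Longrightarrow> f z = h z * Q z"
  proof -
    have eq: "Q z = 0 \<longleftrightarrow> f z = 0" if "z \<in> ?A" for z using Q0[OF that] that by (simp add: W_def)
    show thesis
    proof (rule holomorphic_zorder_factorization[OF holA open_ball connected_ball holQ eq zoQ])
      fix h assume "h holomorphic_on ?A" "\<And>z. z \<in> ?A \<Longrightarrow> f z = h z * Q z"
      then show thesis by (rule that)
    qed
  qed
  have SW: "S \<subseteq> W" using r R1 by (auto simp: S_def W_def)
  define G where "G = (\<lambda>z. h z * (\<Prod>w\<in>W - S. (z - w) ^ k w))"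
  have fG: "f z = G z * (\<Prod>w\<in>S. (z - w) ^ k w)" if "z \<in> ?A" for z
    using h(2)[OF that] prod.subset_diff[OF SW W, of "\<lambda>w. (z - w) ^ k w"] by (simp add: G_def Q_def mult.assoc)
  have holG: "G holomorphic_on ?A" unfolding G_def by (intro holomorphic_intros h)
  \<comment> \<open>The denominator of the Blaschke factor for the circle of radius R. On that
    circle |b w z| = |z - w|, because R^2 = u cnj u for u = z - c; thus H has the modulus of f
    there, while at the centre b w c = R stands in place of |c - w| \<le> r.\<close>
  define b where "b = (\<lambda>w z. (of_real (R\<^sup>2) - cnj (w - c) * (z - c)) / of_real R)"
  define H where "H = (\<lambda>z. G z * (\<Prod>w\<in>S. b w z ^ k w))"
  have holH: "H holomorphic_on ?A" unfolding H_def b_def using r by (intro holomorphic_intros holG) auto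
  define K where "K = (\<Sum>w\<in>S. k w)"
  have "norm (H c) \<le> B"
  proof (rule maximum_modulus_frontier[where S = "cball c R" and f = H and \<xi> = c])
    show "H holomorphic_on interior (cball c R)"
      using holH by (rule holomorphic_on_subset) (use R1 in auto)
    show "continuous_on (closure (cball c R)) H"
      by (rule continuous_on_subset[OF holomorphic_on_imp_continuous_on[OF holH]]) (use R1 in auto)
    fix z assume "z \<in> frontier (cball c R)"
    then have z: "dist c z = R" using r by simp
    then have zA: "z \<in> ?A" "z \<in> cball c R" using R1 by auto
    have "norm (b w z) = norm (z - w)" for w
    proof -
      define u v where "u = z - c" and "v = w - c"
      have nu: "norm u = R" using z by (simp add: u_def dist_norm norm_minus_commute)
      then have "of_real (R\<^sup>2) = u * cnj u" using complex_norm_square[of u] by simp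
      then have "of_real (R\<^sup>2) - cnj v * u = u * cnj (u - v)" by (simp add: algebra_simps)
      then have "norm (b w z) = norm u * norm (u - v) / R"
        using r by (simp add: b_def u_def[symmetric] v_def[symmetric] norm_divide norm_mult del: complex_cnj_diff)
      also have "\<dots> = norm (u - v)" using nu r by simp
      finally show ?thesis by (simp add: u_def v_def)
    qed
    then have "norm (H z) = norm (f z)"
      unfolding fG[OF zA(1)] H_def norm_mult by (simp add: norm_power flip: prod_norm)
    then show "norm (H z) \<le> B" using B[OF zA(2)] by simp
  qed (use r in auto)
  moreover have "norm (H c) = norm (G c) * R ^ K"
    unfolding H_def norm_mult K_def using r
    by (simp add: b_def norm_power norm_divide power2_eq_square power_sum flip: prod_norm)
  moreover have "norm (f c) \<le> norm (G c) * r ^ K"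
  proof -
    have "(\<Prod>w\<in>S. norm (c - w) ^ k w) \<le> (\<Prod>w\<in>S. r ^ k w)"
      by (intro prod_mono conjI power_mono) (auto simp: S_def dist_norm)
    then have "norm (G c) * (\<Prod>w\<in>S. norm (c - w) ^ k w) \<le> norm (G c) * (\<Prod>w\<in>S. r ^ k w)"
      by (intro mult_left_mono) auto
    then show ?thesis unfolding fG[OF cA] norm_mult K_def by (simp add: norm_power power_sum flip: prod_norm)
  qed
  then have "norm (f c) * (R / r) ^ K \<le> norm (G c) * r ^ K * (R / r) ^ K" using r by (intro mult_right_mono) auto
  moreover have "norm (G c) * r ^ K * (R / r) ^ K = norm (G c) * R ^ K" using r by (simp add: power_divide)
  ultimately have "norm (f c) * (R / r) ^ K \<le> B" by linarith
  then show "norm (f c) * (R / r) ^ (\<Sum>z\<in>S. nat (zorder f z)) \<le> B" by (simp only: K_def k_def)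
qed

section \<open>Nonvanishing beyond 1 and zeros in windows of bounded height\<close>

context beurling begin

text \<open>The mollified zeta function tends to 1 as X grows, because the terms of the difference
  live beyond X and the tau squared series has small tails; at a zero the difference would be -1.
  The mollifier thus stands in for the Euler product.\<close>

lemma zt_nonzero:
  assumes "Re s > 1"
  shows "zt s \<noteq> 0"
proof
  assume z: "zt s = 0"
  let ?w = "\<lambda>k. (tau k)\<^sup>2 * nm k powr (- Re s)"
  have "?w summable_on UNIV"
    by (rule nonneg_bdd_above_summable_on) (auto intro!: bdd_aboveI sum_tau_sq_le assms)
  then obtain F where F: "finite F" "\<And>H. finite H \<Longrightarrow> H \<inter> F = {} \<Longrightarrow> sum ?w H \<le> 1 / 2"
    using infsum_tail_small[of ?w "1 / 2"] by auto
  obtain X where X: "X \<ge> 1" "F \<subseteq> {m. nm m \<le> X}" using finite_subset_nm[OF F(1)] by blast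
  have "norm (mollifier X s * zt s - 1) \<le> 1 / 2"
  proof (rule has_sum_norm_le[OF has_sum_mollified_minus_1[OF assms X(1)]])
    fix H :: "nat multiset set" assume H: "finite H"
    have "(\<Sum>k\<in>H. of_real (bcoeff X k) * cpow (nm k) (-s)) = (\<Sum>k\<in>H - F. of_real (bcoeff X k) * cpow (nm k) (-s))"
      using X(2) H by (intro sum.mono_neutral_right) (auto simp: bcoeff_def)
    also have "norm \<dots> \<le> sum ?w (H - F)"
      by (intro sum_norm_le norm_bcoeff_term_le)
    also have "\<dots> \<le> 1 / 2" using H by (intro F) auto
    finally show "norm (\<Sum>k\<in>H. of_real (bcoeff X k) * cpow (nm k) (-s)) \<le> 1 / 2" .
  qed
  then show False using z by simp
qed

lemma Z_zero_Re_le_1: "Z s = 0 \<Longrightarrow> Re s > \<theta> \<Longrightarrow> Re s \<le> 1"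
  using zt_nonzero[of s] Z_eq_zt[of s] by (cases "Re s > 1") auto

definition Zzeros :: "real \<Rightarrow> complex set" where
  "Zzeros \<alpha> = {s. Z s = 0 \<and> Re s \<ge> \<alpha>}"

abbreviation mult_sum :: "complex set \<Rightarrow> real" where
  "mult_sum S \<equiv> (\<Sum>s\<in>S. real (nat (zorder Z s)))"

text \<open>Jensen's bound on discs centred on Re s = c, where zeta is bounded below. They reach
  past the abscissa (1 + \<theta>) / 2 but not to \<theta>, so Z is of at most quadratic growth on
  them and the count is logarithmic.\<close>

lemma zeros_window:
  obtains h C where "h > 0" "C > 0" "\<And>\<gamma>. finite {s \<in> Zzeros crit. \<bar>Im s - \<gamma>\<bar> \<le> h}"
    "\<And>\<gamma>. mult_sum {s \<in> Zzeros crit. \<bar>Im s - \<gamma>\<bar> \<le> h} \<le> C * ln (\<bar>\<gamma>\<bar> + 3)"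
proof -
  obtain c where c: "c \<ge> 3" "\<And>s. Re s = c \<Longrightarrow> norm (zt s) \<ge> 1 / 2" using zt_lower_bound by blast
  define s0 where "s0 = crit"
  \<comment> \<open>The distances from c to (1 + \<theta>) / 2, to \<theta> + (1 - \<theta>) / 4 and
    to \<theta> + (1 - \<theta>) / 8, with r halfway between the first two.\<close>
  define r0 R R' r where "r0 = c - s0" and "R = c - (3 * \<theta> + 1) / 4" and "R' = c - (7 * \<theta> + 1) / 8" and "r = (r0 + R) / 2"
  have r: "0 < r0" "r0 < r" "0 < r" "r < R" "R < R'"
    using c th_less th_nonneg by (auto simp: r0_def R_def R'_def r_def s0_def field_simps)
  \<comment> \<open>By Pythagoras a zero at horizontal distance at most r0 and vertical distance at
    most h from the centre lies in the disc of radius r.\<close>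
  define h where "h = sqrt (r\<^sup>2 - r0\<^sup>2)"
  have rr: "r\<^sup>2 - r0\<^sup>2 > 0" using r by (simp add: power_strict_mono)
  have h: "h > 0" "h\<^sup>2 = r\<^sup>2 - r0\<^sup>2" using rr by (auto simp: h_def)
  define d where "d = (1 - \<theta>) / 4"
  have d: "d > 0" using th_less by (simp add: d_def)
  define C1 where "C1 = (1 + c0 * (2 + 1 / d)) + A"
  have C1: "C1 \<ge> 1" using c0 d A_pos by (auto simp: C1_def intro!: add_nonneg_nonneg mult_nonneg_nonneg)
  define q where "q = ln (R / r)"
  have q: "q > 0" using r by (simp add: q_def)
  \<comment> \<open>Makes ln C1 + 2 ln (2 c + 1) + 2 lg \<le> C q lg for lg =
    \<open>ln (\<bar>\<gamma>\<bar> + 3)\<close>; the shift by 3, larger than e, ensures lg \<ge>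
    1.\<close>
  define C where "C = (2 + (ln C1 + 2 * ln (2 * c + 1))) / q"
  have lc: "ln C1 + 2 * ln (2 * c + 1) \<ge> 0" using C1 c by simp
  have C: "C > 0" using lc q by (simp add: C_def)
  have main: "finite {s \<in> Zzeros s0. \<bar>Im s - \<gamma>\<bar> \<le> h} \<and>
     mult_sum {s \<in> Zzeros s0. \<bar>Im s - \<gamma>\<bar> \<le> h} \<le> C * ln (\<bar>\<gamma>\<bar> + 3)" for \<gamma>
  proof -
    define cc where "cc = Complex c \<gamma>"
    define V where "V = 2 * c + 1 + \<bar>\<gamma>\<bar>"
    have V: "V \<ge> 1" using c by (simp add: V_def)
    have re: "Re s > \<theta>" if "s \<in> ball cc R'" for s
    proof -
      have "\<bar>Re (cc - s)\<bar> < R'" using that abs_Re_le_cmod[of "cc - s"] by (simp add: dist_norm)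
      then have "c - Re s < R'" by (simp add: cc_def)
      then show ?thesis using th_less by (simp add: R'_def field_simps)
    qed
    let ?S = "{z \<in> cball cc r. Z z = 0}"
    have hol: "Z holomorphic_on ball cc R'" by (rule holomorphic_on_subset[OF holomorphic_Z]) (use re in auto)
    have Zc: "norm (Z cc) \<ge> 1"
    proof -
      have e: "Z cc = (cc - 1) * zt cc" using c by (intro Z_eq_zt) (auto simp: cc_def)
      have "c - 1 \<le> norm (cc - 1)" using complex_Re_le_cmod[of "cc - 1"] by (simp add: cc_def)
      then have "2 * (1 / 2) \<le> norm (cc - 1) * norm (zt cc)" using c by (intro mult_mono c(2)) (auto simp: cc_def)
      then show ?thesis by (simp add: e norm_mult)
    qed
    have B: "norm (Z s) \<le> C1 * V\<^sup>2" if s: "s \<in> cball cc R" for s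
    proof -
      have "\<bar>Re (cc - s)\<bar> \<le> R" using s abs_Re_le_cmod[of "cc - s"] by (simp add: dist_norm)
      then have "c - Re s \<le> R" by (simp add: cc_def)
      then have rd: "Re s - \<theta> \<ge> d" by (simp add: R_def d_def field_simps)
      have "norm s \<le> norm cc + norm (s - cc)" by (rule norm_triangle_sub)
      moreover have "norm cc \<le> c + \<bar>\<gamma>\<bar>" using cmod_le[of cc] c by (simp add: cc_def)
      moreover have "R \<le> c" using th_nonneg by (simp add: R_def)
      then have "norm (s - cc) \<le> c" using s by (simp add: dist_norm norm_minus_commute)
      ultimately have n: "norm s \<le> V - 1" by (simp add: V_def)
      then have n1: "norm (s - 1) \<le> V" using norm_triangle_ineq4[of s 1] by simp
      have "norm (Z s) \<le> norm (s - 1) * (1 + c0 * (2 + norm s / (Re s - \<theta>))) + A" by (rule Z_bound) (use rd d in auto)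
      also have "\<dots> \<le> V * (V * (1 + c0 * (2 + 1 / d))) + V * V * A"
      proof (intro add_mono mult_mono)
        have "norm s / (Re s - \<theta>) \<le> V / d" using n rd d V by (intro frac_le) auto
        then have "1 + c0 * (2 + norm s / (Re s - \<theta>)) \<le> V * 1 + c0 * (V * 2 + V / d)"
          using V c0 by (intro add_mono mult_left_mono) auto
        also have "\<dots> = V * (1 + c0 * (2 + 1 / d))" by (simp add: algebra_simps)
        finally show "1 + c0 * (2 + norm s / (Re s - \<theta>)) \<le> V * (1 + c0 * (2 + 1 / d))" .
        have "1 * 1 * A \<le> V * V * A" using V A_pos by (intro mult_mono) auto
        then show "A \<le> V * V * A" by simp
      qed (use n1 V c0 rd d in \<open>auto intro!: add_nonneg_nonneg mult_nonneg_nonneg divide_nonneg_nonneg\<close>)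
      also have "\<dots> = C1 * V\<^sup>2" by (simp add: C1_def power2_eq_square algebra_simps)
      finally show ?thesis .
    qed
    have fin: "finite ?S" and cnt: "norm (Z cc) * (R / r) ^ (\<Sum>z\<in>?S. nat (zorder Z z)) \<le> C1 * V\<^sup>2"
    proof -
      have "Z cc \<noteq> 0" using Zc by auto
      from zero_count_disc[OF hol r(3-5) B this]
      show "finite ?S" "norm (Z cc) * (R / r) ^ (\<Sum>z\<in>?S. nat (zorder Z z)) \<le> C1 * V\<^sup>2" by auto
    qed
    have sub: "{s \<in> Zzeros s0. \<bar>Im s - \<gamma>\<bar> \<le> h} \<subseteq> ?S"
    proof
      fix s assume s: "s \<in> {s \<in> Zzeros s0. \<bar>Im s - \<gamma>\<bar> \<le> h}"
      then have z: "Z s = 0" "Re s \<ge> s0" "\<bar>Im s - \<gamma>\<bar> \<le> h" by (auto simp: Zzeros_def)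
      then have "Re s \<le> 1" using th_less by (intro Z_zero_Re_le_1) (auto simp: s0_def field_simps)
      then have "(c - Re s)\<^sup>2 \<le> r0\<^sup>2" using z c by (intro power_mono) (auto simp: r0_def)
      moreover have "(\<gamma> - Im s)\<^sup>2 \<le> h\<^sup>2"
        using z(3) h(1) by (metis abs_le_square_iff abs_minus_commute abs_of_pos)
      moreover have "(norm (cc - s))\<^sup>2 = (c - Re s)\<^sup>2 + (\<gamma> - Im s)\<^sup>2" by (simp add: cmod_power2 cc_def)
      ultimately have "(norm (cc - s))\<^sup>2 \<le> r\<^sup>2" using h(2) by linarith
      then have "norm (cc - s) \<le> r" by (rule power2_le_imp_le) (use r in linarith)
      then show "s \<in> ?S" using z by (simp add: dist_norm)
    qed
    have "(R / r) ^ (\<Sum>z\<in>?S. nat (zorder Z z)) \<le> norm (Z cc) * (R / r) ^ (\<Sum>z\<in>?S. nat (zorder Z z))"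
    proof -
      have pos: "0 \<le> (R / r) ^ (\<Sum>z\<in>?S. nat (zorder Z z))" using r by (intro zero_le_power) simp
      from mult_right_mono[OF Zc pos] show ?thesis by (simp only: mult_1_left)
    qed
    with cnt have le: "(R / r) ^ (\<Sum>z\<in>?S. nat (zorder Z z)) \<le> C1 * V\<^sup>2" by linarith
    define nz where "nz = (\<Sum>z\<in>?S. nat (zorder Z z))"
    define rz where "rz = real nz"
    note le = le[folded nz_def]
    have "ln ((R / r) ^ nz) \<le> ln (C1 * V\<^sup>2)"
      using le r by (intro ln_mono) auto
    then have l1: "rz * q \<le> ln C1 + 2 * ln V"
      using r C1 V by (simp add: ln_realpow ln_mult q_def rz_def)
    have l3: "ln (\<bar>\<gamma>\<bar> + 3) \<ge> 1"
    proof -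
      have "exp 1 \<le> \<bar>\<gamma>\<bar> + 3" using exp_le by linarith
      then have "ln (exp 1) \<le> ln (\<bar>\<gamma>\<bar> + 3)" by (intro ln_mono) auto
      then show ?thesis by simp
    qed
    define lg where "lg = ln (\<bar>\<gamma>\<bar> + 3)"
    note l3 = l3[folded lg_def]
    have "V \<le> (2 * c + 1) * (\<bar>\<gamma>\<bar> + 3)"
    proof -
      have "1 * \<bar>\<gamma>\<bar> \<le> (2 * c + 1) * \<bar>\<gamma>\<bar>" using c by (intro mult_right_mono) auto
      then show ?thesis using c by (simp add: V_def algebra_simps)
    qed
    then have "ln V \<le> ln ((2 * c + 1) * (\<bar>\<gamma>\<bar> + 3))" using V by (intro ln_mono) auto
    also have "\<dots> = ln (2 * c + 1) + ln (\<bar>\<gamma>\<bar> + 3)" by (rule ln_mult_pos) (use c in auto)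
    finally have lV: "ln V \<le> ln (2 * c + 1) + lg" by (simp only: lg_def)
    have "rz * q \<le> ln C1 + 2 * ln (2 * c + 1) + 2 * lg" using l1 lV by linarith
    also have "\<dots> \<le> (ln C1 + 2 * ln (2 * c + 1)) * lg + 2 * lg"
      using mult_left_mono[OF l3 lc] by simp
    also have "\<dots> = C * lg * q" using q by (simp add: C_def field_simps)
    finally have fin2: "rz \<le> C * lg"
      using q mult_le_cancel_right_pos by blast
    have "mult_sum {s \<in> Zzeros s0. \<bar>Im s - \<gamma>\<bar> \<le> h} \<le> mult_sum ?S"
      by (intro sum_mono2 fin sub) auto
    also have "\<dots> = rz" by (simp add: rz_def nz_def)
    finally show ?thesis using fin2 finite_subset[OF sub fin] unfolding lg_def by (meson order.trans)
  qed
  show thesis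
    by (rule that[OF h(1) C]) (use main in \<open>auto simp: s0_def\<close>)
qed

end

subsection \<open>Zero detection\<close>

text \<open>The horizontal sides, where the integrand will be tiny, are estimated by a supremum; on
  the vertical sides only mean values are available, so the integral of the modulus is kept.\<close>

lemma norm_contour_integral_rectpath_le:
  assumes ab: "a < b" and cd: "c < d"
    and cont: "continuous_on (path_image (rectpath (Complex a c) (Complex b d))) F"
    and B: "B \<ge> 0" "\<And>x y. a \<le> x \<Longrightarrow> x \<le> b \<Longrightarrow> y \<in> {c, d} \<Longrightarrow> norm (F (Complex x y)) \<le> B"
  shows "norm (contour_integral (rectpath (Complex a c) (Complex b d)) F)
    \<le> 2 * B * (b - a) + integral {c..d} (\<lambda>y. norm (F (Complex b y))) + integral {c..d} (\<lambda>y. norm (F (Complex a y)))"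
proof -
  define a1 a2 a3 a4 where "a1 = Complex a c" and "a2 = Complex b c" and "a3 = Complex b d" and "a4 = Complex a d"
  note defs = this
  have rp: "rectpath a1 a3 = linepath a1 a2 +++ linepath a2 a3 +++ linepath a3 a4 +++ linepath a4 a1"
    by (simp add: rectpath_def Let_def defs)
  have P: "path_image (rectpath a1 a3) = {z. Re z \<in> {a, b} \<and> Im z \<in> {c..d}} \<union> {z. Im z \<in> {c, d} \<and> Re z \<in> {a..b}}"
    using ab cd by (subst path_image_rectpath) (auto simp: defs)
  have seg: "closed_segment a1 a2 \<subseteq> path_image (rectpath a1 a3)" "closed_segment a2 a3 \<subseteq> path_image (rectpath a1 a3)"
    "closed_segment a3 a4 \<subseteq> path_image (rectpath a1 a3)" "closed_segment a4 a1 \<subseteq> path_image (rectpath a1 a3)"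
    "closed_segment a1 a4 \<subseteq> path_image (rectpath a1 a3)"
    unfolding P using ab cd
    by (auto simp: closed_segment_same_Re closed_segment_same_Im closed_segment_eq_real_ivl defs)
  have cs: "continuous_on (closed_segment a1 a2) F" "continuous_on (closed_segment a2 a3) F"
    "continuous_on (closed_segment a3 a4) F" "continuous_on (closed_segment a4 a1) F" "continuous_on (closed_segment a1 a4) F"
    using cont seg unfolding defs[symmetric] by (blast intro: continuous_on_subset)+
  have B': "norm (F z) \<le> B" if "a \<le> Re z" "Re z \<le> b" "Im z = c \<or> Im z = d" for z
    using B(2)[of "Re z" "Im z"] that by simp
  note ci = cs(1-4)[THEN contour_integrable_continuous_linepath]
  have "contour_integral (rectpath a1 a3) F = contour_integral (linepath a1 a2) F + (contour_integral (linepath a2 a3) F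
      + (contour_integral (linepath a3 a4) F + contour_integral (linepath a4 a1) F))"
    unfolding rp using ci by (simp add: contour_integrable_joinI)
  moreover have "norm (contour_integral (linepath a1 a2) F) \<le> B * norm (a2 - a1)"
    by (rule contour_integral_bound_linepath[OF ci(1) B(1)])
       (use ab in \<open>auto simp: closed_segment_same_Im closed_segment_eq_real_ivl defs intro!: B'\<close>)
  moreover have "norm (a2 - a1) = b - a" using ab by (simp add: defs cmod_def)
  moreover have "norm (contour_integral (linepath a3 a4) F) \<le> B * norm (a4 - a3)"
    by (rule contour_integral_bound_linepath[OF ci(3) B(1)])
       (use ab in \<open>auto simp: closed_segment_same_Im closed_segment_eq_real_ivl defs intro!: B'\<close>)
  moreover have "norm (a4 - a3) = b - a" using ab by (simp add: defs cmod_def)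
  moreover have vert: "norm (integral {c..d} (\<lambda>y. F (Complex x y))) \<le> integral {c..d} (\<lambda>y. norm (F (Complex x y)))"
    if x: "x \<in> {a, b}" for x
  proof (rule integral_norm_bound_integral)
    have cF: "continuous_on {c..d} (\<lambda>y. F (Complex x y))"
      by (rule continuous_on_compose2[OF cont[folded a1_def a3_def, unfolded P] continuous_on_Complex]) (use x in auto)
    then show "(\<lambda>y. F (Complex x y)) integrable_on {c..d}" by (rule integrable_continuous_real)
    from cF show "(\<lambda>y. norm (F (Complex x y))) integrable_on {c..d}"
      by (intro integrable_continuous_real continuous_intros)
  qed auto
  have "norm (contour_integral (linepath a2 a3) F) \<le> integral {c..d} (\<lambda>y. norm (F (Complex b y)))"
    using vert[of b] cd by (subst contour_integral_linepath_same_Re[where c = b and a = c and b = d]) (auto simp: defs norm_mult)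
  moreover have "norm (contour_integral (linepath a4 a1) F) \<le> integral {c..d} (\<lambda>y. norm (F (Complex a y)))"
    using vert[of a] cd
    by (subst contour_integral_reverse_linepath[OF cs(4)], subst contour_integral_linepath_same_Re[where c = a and a = c and b = d])
       (auto simp: defs norm_mult)
  ultimately show ?thesis
    unfolding defs[symmetric]
    using norm_triangle_ineq[of "contour_integral (linepath a1 a2) F" "contour_integral (linepath a2 a3) F
      + (contour_integral (linepath a3 a4) F + contour_integral (linepath a4 a1) F)"]
      norm_triangle_ineq[of "contour_integral (linepath a2 a3) F" "contour_integral (linepath a3 a4) F + contour_integral (linepath a4 a1) F"]
      norm_triangle_ineq[of "contour_integral (linepath a3 a4) F" "contour_integral (linepath a4 a1) F"]
    by simp
qed

context beurling begin

text \<open>A power of T suffices: the bound is applied only on the horizontal sides, where the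
  kernel decays like exp (- (log T)^2). The condition on |Im s| keeps s away from the pole.\<close>

lemma norm_f_moll_le:
  assumes s: "\<theta> + d \<le> Re s" "Re s \<le> 2" "1 \<le> \<bar>Im s\<bar>" "\<bar>Im s\<bar> \<le> 2 * T" and d: "d > 0" and X: "X \<ge> 1" and T: "T \<ge> 1"
  shows "norm (f_moll X s) \<le> ((A + c0) * (1 + 2 * c0 + A + 4 * c0 / d) + 1) * (T * X)"
proof -
  have n1: "norm (s - 1) \<ge> 1" using abs_Im_le_cmod[of "s - 1"] s by simp
  have ns: "norm s \<le> 4 * T" using cmod_le[of s] s T d th_nonneg by auto
  have z: "norm (zeta s) \<le> (1 + 2 * c0 + A + 4 * c0 / d) * T"
  proof -
    have "norm (zeta s) = norm (Z s) / norm (s - 1)" by (simp add: zeta_def norm_divide)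
    also have "\<dots> \<le> (norm (s - 1) * (1 + c0 * (2 + norm s / (Re s - \<theta>))) + A) / norm (s - 1)"
      by (intro divide_right_mono Z_bound) (use s d in auto)
    also have "\<dots> = 1 + c0 * (2 + norm s / (Re s - \<theta>)) + A / norm (s - 1)" 
    proof -
      have "s \<noteq> 1" using n1 by auto
      then show ?thesis by (simp add: add_divide_distrib)
    qed
    also have "A / norm (s - 1) \<le> A * T"
    proof -
      have "A / norm (s - 1) \<le> A / 1" using n1 A_pos by (intro divide_left_mono) auto
      also have "\<dots> \<le> A * T" using T A_pos by simp
      finally show ?thesis .
    qed
    also have "1 + c0 * (2 + norm s / (Re s - \<theta>)) \<le> T + c0 * (2 * T + 4 * T / d)"
    proof -
      have "norm s / (Re s - \<theta>) \<le> 4 * T / d" using ns s d T by (intro frac_le) auto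
      then have "c0 * (2 + norm s / (Re s - \<theta>)) \<le> c0 * (2 * T + 4 * T / d)" using c0 T by (intro mult_left_mono) auto
      then show ?thesis using T by linarith
    qed
    finally show ?thesis by (simp add: algebra_simps)
  qed
  have m: "norm (mollifier X s) \<le> (A + c0) * X"
  proof -
    have "norm (mollifier X s) \<le> (\<Sum>d | nm d \<le> X. 1)" unfolding mollifier_def
    proof (rule sum_norm_le)
      fix m
      have "nm m powr (- Re s) \<le> nm m powr 0" using nm_ge_1[of m] s d th_nonneg by (intro powr_mono) auto
      then have "nm m powr (- Re s) \<le> 1" using nm_pos[of m] by simp
      then show "norm (of_real (moeb m) * cpow (nm m) (-s)) \<le> 1"
        using abs_moeb_le[of m] by (simp add: norm_mult norm_cpow mult_le_one)
    qed
    also have "\<dots> = N X" by (simp add: N_def)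
    finally show ?thesis using N_le[OF X] by linarith
  qed
  have "norm (f_moll X s) \<le> norm (mollifier X s) * norm (zeta s) + 1"
    unfolding f_moll_def by (rule order.trans[OF norm_triangle_ineq4]) (simp add: norm_mult)
  also have "\<dots> \<le> ((A + c0) * X) * ((1 + 2 * c0 + A + 4 * c0 / d) * T) + T * X"
    by (intro add_mono mult_mono m z) (use A_pos c0 X T mult_mono[of 1 T 1 X] in auto)
  finally show ?thesis by (simp add: algebra_simps)
qed

abbreviation line_mean :: "real \<Rightarrow> real \<Rightarrow> real \<Rightarrow> real" where
  "line_mean T \<sigma> \<gamma> \<equiv> integral {\<gamma> - ln T..\<gamma> + ln T} (\<lambda>u. norm (f_moll (T powr (1 / (1 - \<theta>))) (Complex \<sigma> u)))"

text \<open>The lower bound 2 log T on |Im \<rho>| keeps the rectangle of half-height log T off the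
  real axis, hence off the pole. With 4 on the left, one of the two lines always contributes at
  least 2.\<close>

lemma zero_detection:
  obtains T0 where "T0 \<ge> exp (4 / (1 - \<theta>))" "\<And>T Y \<rho>. T \<ge> T0 \<Longrightarrow> 1 \<le> Y \<Longrightarrow> Y \<le> T powr (2 / (1 - \<theta>)) \<Longrightarrow> Z \<rho> = 0 \<Longrightarrow>
     crit \<le> Re \<rho> \<Longrightarrow> 2 * ln T \<le> \<bar>Im \<rho>\<bar> \<Longrightarrow> \<bar>Im \<rho>\<bar> \<le> T \<Longrightarrow>
     4 \<le> exp 1 * ln T * Y powr (1 + 1 / ln T - Re \<rho>) * line_mean T (1 + 1 / ln T) (Im \<rho>)
       + exp 1 * ln T * Y powr (crit - Re \<rho>) * line_mean T (crit - 1 / ln T) (Im \<rho>)"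
proof -
  define d where "d = (1 - \<theta>) / 4"
  have d: "d > 0" using th_less by (simp add: d_def)
  define C2 where "C2 = (A + c0) * (1 + 2 * c0 + A + 4 * c0 / d) + 1"
  have C2: "C2 \<ge> 1" using A_pos c0 d by (auto simp: C2_def intro!: mult_nonneg_nonneg add_nonneg_nonneg)
  \<comment> \<open>The exponent in T X Y \<le> T^q: 1 from T, 1 / (1 - \<theta>) from X and 2 / (1
    - \<theta>) from Y.\<close>
  define q where "q = 1 + 3 / (1 - \<theta>)"
  have q: "q \<ge> 1" using th_less by (simp add: q_def)
  have lC: "ln (4 * C2 * exp 1) \<ge> 0"
  proof -
    have "1 * 1 \<le> (4 * C2) * exp 1" using C2 by (intro mult_mono) auto
    then show ?thesis by simp
  qed
  \<comment> \<open>For ln T \<ge> L0 the first summand gives 1 / ln T \<le> (1 - \<theta>) / 4, so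
    the left line stays to the right of \<theta>; the other two make the horizontal sides
    negligible.\<close>
  define L0 where "L0 = 4 / (1 - \<theta>) + q + ln (4 * C2 * exp 1)"
  show thesis
  proof (rule that[of "exp L0"])
    show "exp L0 \<ge> exp (4 / (1 - \<theta>))" using q lC by (simp add: L0_def)
    fix T Y :: real and \<rho> :: complex
    assume T: "T \<ge> exp L0" and Y: "1 \<le> Y" "Y \<le> T powr (2 / (1 - \<theta>))" and rho: "Z \<rho> = 0" "crit \<le> Re \<rho>"
      and im: "2 * ln T \<le> \<bar>Im \<rho>\<bar>" "\<bar>Im \<rho>\<bar> \<le> T"
    define L where "L = ln T"
    define \<beta> \<gamma> where "\<beta> = Re \<rho>" and "\<gamma> = Im \<rho>"
    have Tpos: "T > 0" using T exp_gt_zero[of L0] by linarith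
    have L: "L \<ge> L0"
      using T Tpos by (simp add: L_def ln_ge_iff)
    have "4 / (1 - \<theta>) \<ge> 4" using th_less th_nonneg by (simp add: field_simps)
    then have L4: "L \<ge> 4" "L \<ge> 4 / (1 - \<theta>)" using L q lC by (auto simp: L0_def)
    have LT: "L \<le> T" using ln_bound[of T] Tpos by (simp add: L_def)
    have T1: "T \<ge> 1" using LT L4 by linarith
    define X where "X = T powr (1 / (1 - \<theta>))"
    have X: "X \<ge> 1" using T1 th_less by (simp add: X_def ge_one_powr_ge_zero)
    define dl where "dl = 1 / L"
    have dl: "0 < dl" "dl \<le> d" "dl \<le> 1 / 4"
      using L4 th_less by (auto simp: dl_def d_def field_simps)
    define sl sr where "sl = crit - dl" and "sr = 1 + dl"
    have beta: "sl + dl \<le> \<beta>" "\<beta> \<le> 1" "\<beta> > \<theta>"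
      using rho Z_zero_Re_le_1[of \<rho>] th_less by (auto simp: \<beta>_def sl_def field_simps)
    have sl: "\<theta> + d \<le> sl" using dl th_less by (auto simp: sl_def d_def field_simps)
    have slr: "sl < sr" "sr - sl \<le> 2" "\<beta> - sl \<le> 1" "sr - \<beta> \<le> 1" "sr \<le> 2"
      using dl beta th_less th_nonneg by (auto simp: sl_def sr_def field_simps)
    have im2: "2 * L \<le> \<bar>\<gamma>\<bar>" "\<bar>\<gamma>\<bar> \<le> T" using im by (auto simp: L_def \<gamma>_def)
    \<comment> \<open>The open half-plane on the side of \<rho> excludes the pole and keeps the
      domain convex, as required by this form of Cauchy's formula.\<close>
    define H where "H = (if \<gamma> > 0 then {s. Im s > 0} else {s. Im s < 0})"
    define S where "S = {s. Re s > \<theta>} \<inter> H"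
    have S: "convex S" "open S"
      by (auto simp: S_def H_def convex_halfspace_Re_gt convex_halfspace_Im_gt convex_halfspace_Im_lt
          open_halfspace_Re_gt open_halfspace_Im_gt open_halfspace_Im_lt intro!: convex_Int open_Int)
    define K where "K = (\<lambda>w. exp ((w - \<rho>) * of_real (ln Y)) * exp ((w - \<rho>)\<^sup>2))"
    define g where "g = (\<lambda>w. f_moll X w * K w)"
    define F where "F = (\<lambda>w. g w / (w - \<rho>))"
    have holg: "g holomorphic_on S"
      unfolding g_def K_def
      by (intro holomorphic_intros holomorphic_on_subset[OF holomorphic_f_moll]) (auto simp: S_def H_def split: if_splits)
    have rhoS: "\<rho> \<in> S" using beta im2 L4 by (auto simp: S_def H_def \<beta>_def \<gamma>_def)
    define a1 a3 where "a1 = Complex sl (\<gamma> - L)" and "a3 = Complex sr (\<gamma> + L)"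
    have box: "\<rho> \<in> box a1 a3" using beta dl L4 by (auto simp: in_box_complex_iff a1_def a3_def \<beta>_def \<gamma>_def sr_def)
    have cb: "cbox a1 a3 \<subseteq> S"
      using sl d im2 L4 by (auto simp: in_cbox_complex_iff a1_def a3_def S_def H_def)
    have ims: "1 \<le> \<bar>y\<bar> \<and> \<bar>y\<bar> \<le> 2 * T" if "y \<in> {\<gamma> - L..\<gamma> + L}" for y
      using that im2 L4 LT by auto
    have pi: "path_image (rectpath a1 a3) \<subseteq> S - {\<rho>}"
    proof -
      have "path_image (rectpath a1 a3) = cbox a1 a3 - box a1 a3"
        using slr L4 by (intro path_image_rectpath_cbox_minus_box) (auto simp: a1_def a3_def)
      then show ?thesis using cb box by auto
    qed
    have "((\<lambda>w. g w / (w - \<rho>)) has_contour_integral (2 * pi * \<i> * winding_number (rectpath a1 a3) \<rho> * g \<rho>)) (rectpath a1 a3)"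
      by (rule Cauchy_integral_formula_convex_simple[OF S(1) holg]) (use rhoS S(2) pi in \<open>auto simp: interior_open\<close>)
    moreover have "g \<rho> = - 1" using rho by (simp add: g_def K_def f_moll_def zeta_def)
    ultimately have "contour_integral (rectpath a1 a3) F = - (2 * pi * \<i>)"
      using winding_number_rectpath[OF box] by (simp add: F_def contour_integral_unique)
    then have two_pi: "2 * pi = norm (contour_integral (rectpath a1 a3) F)" by (simp add: norm_mult)
    have holF: "F holomorphic_on (S - {\<rho>})"
      unfolding F_def by (intro holomorphic_intros holomorphic_on_subset[OF holg]) auto
    have F_norm: "norm (F w) = norm (f_moll X w) * (Y powr (Re w - \<beta>) * exp ((Re w - \<beta>)\<^sup>2 - (Im w - \<gamma>)\<^sup>2)) / norm (w - \<rho>)" for w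
      using Y by (simp add: F_def g_def K_def norm_divide norm_mult powr_def \<beta>_def \<gamma>_def power2_eq_square)
    have ex: "exp ((x - \<beta>)\<^sup>2 - y\<^sup>2) \<le> exp (1 - y\<^sup>2)" if "sl \<le> x" "x \<le> sr" for x y
    proof -
      have "\<bar>x - \<beta>\<bar> \<le> 1" using that slr by auto
      then have "(x - \<beta>)\<^sup>2 \<le> 1" by (simp add: abs_square_le_1)
      then show ?thesis by simp
    qed
    define B where "B = C2 * (T * X) * (Y * exp (1 - L\<^sup>2))"
    have B0: "B \<ge> 0" using C2 T1 X Y by (simp add: B_def)
    have horiz: "norm (F (Complex x y)) \<le> B" if x: "sl \<le> x" "x \<le> sr" and y: "y \<in> {\<gamma> - L, \<gamma> + L}" for x y
    proof -
      have y2: "y \<in> {\<gamma> - L..\<gamma> + L}" using y L4 by auto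
      have 1: "norm (f_moll X (Complex x y)) \<le> C2 * (T * X)"
        unfolding C2_def by (rule norm_f_moll_le) (use x sl slr ims[OF y2] d X T1 in auto)
      have 2: "Y powr (x - \<beta>) \<le> Y"
      proof -
        have "Y powr (x - \<beta>) \<le> Y powr 1" using Y x slr by (intro powr_mono) auto
        then show ?thesis using Y by simp
      qed
      have "(y - \<gamma>)\<^sup>2 = L\<^sup>2" using y by auto
      then have 3: "exp ((x - \<beta>)\<^sup>2 - (y - \<gamma>)\<^sup>2) \<le> exp (1 - L\<^sup>2)" using ex[OF x, of "y - \<gamma>"] by simp
      have 4: "norm (Complex x y - \<rho>) \<ge> 1"
        using abs_Im_le_cmod[of "Complex x y - \<rho>"] y L4 by (auto simp: \<gamma>_def)
      have "norm (F (Complex x y)) = norm (f_moll X (Complex x y)) * (Y powr (x - \<beta>) * exp ((x - \<beta>)\<^sup>2 - (y - \<gamma>)\<^sup>2)) / norm (Complex x y - \<rho>)"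
        by (simp add: F_norm)
      also have "\<dots> \<le> C2 * (T * X) * (Y * exp (1 - L\<^sup>2)) / 1"
        using 1 2 3 4 C2 T1 X Y by (intro frac_le mult_mono) auto
      finally show ?thesis by (simp add: B_def)
    qed
    have vert: "integral {\<gamma> - L..\<gamma> + L} (\<lambda>y. norm (F (Complex x y))) \<le> exp 1 * L * Y powr (x - \<beta>) * integral {\<gamma> - L..\<gamma> + L} (\<lambda>y. norm (f_moll X (Complex x y)))"
      if x: "x \<in> {sl, sr}" for x
    proof -
      \<comment> \<open>Both lines are at distance at least 1 / L from \<beta>, which bounds the
        denominator of the kernel and is the source of the factor L.\<close>
      have xd: "\<bar>x - \<beta>\<bar> \<ge> dl" using x beta dl by (auto simp: sr_def)
      have xs: "sl \<le> x" "x \<le> sr" using x slr by auto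
      have "integral {\<gamma> - L..\<gamma> + L} (\<lambda>y. norm (F (Complex x y))) \<le> integral {\<gamma> - L..\<gamma> + L} (\<lambda>y. exp 1 * L * Y powr (x - \<beta>) * norm (f_moll X (Complex x y)))"
      proof (rule integral_le)
        have "continuous_on {\<gamma> - L..\<gamma> + L} (\<lambda>y. F (Complex x y))"
        proof (rule continuous_on_compose2[OF holomorphic_on_imp_continuous_on[OF holF] continuous_on_Complex])
          have "Complex x y \<in> path_image (rectpath a1 a3)" if "y \<in> {\<gamma> - L..\<gamma> + L}" for y
            using that x slr L4 by (subst path_image_rectpath) (auto simp: a1_def a3_def)
          then show "Complex x ` {\<gamma> - L..\<gamma> + L} \<subseteq> S - {\<rho>}" using pi by blast
        qed
        then show "(\<lambda>y. norm (F (Complex x y))) integrable_on {\<gamma> - L..\<gamma> + L}"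
          by (intro integrable_continuous_real continuous_intros)
        show "(\<lambda>y. exp 1 * L * Y powr (x - \<beta>) * norm (f_moll X (Complex x y))) integrable_on {\<gamma> - L..\<gamma> + L}"
        proof -
          have "x > \<theta>" "x \<noteq> 1" using x sl d dl beta th_less by (auto simp: sr_def)
          then show ?thesis by (intro integrable_continuous_real continuous_intros continuous_on_line(2))
        qed
        fix y
        have "norm (F (Complex x y)) = norm (f_moll X (Complex x y)) * (Y powr (x - \<beta>) * exp ((x - \<beta>)\<^sup>2 - (y - \<gamma>)\<^sup>2)) / norm (Complex x y - \<rho>)"
          by (simp add: F_norm)
        also have "\<dots> \<le> norm (f_moll X (Complex x y)) * (Y powr (x - \<beta>) * exp 1) / dl"
        proof (intro frac_le mult_left_mono)
          have "exp ((x - \<beta>)\<^sup>2 - (y - \<gamma>)\<^sup>2) \<le> exp (1 - (y - \<gamma>)\<^sup>2)" by (rule ex[OF xs])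
          also have "\<dots> \<le> exp 1" by simp
          finally show "exp ((x - \<beta>)\<^sup>2 - (y - \<gamma>)\<^sup>2) \<le> exp 1" .
          show "dl \<le> norm (Complex x y - \<rho>)"
            using abs_Re_le_cmod[of "Complex x y - \<rho>"] xd by (simp add: \<beta>_def)
        qed (use dl in auto)
        finally show "norm (F (Complex x y)) \<le> exp 1 * L * Y powr (x - \<beta>) * norm (f_moll X (Complex x y))"
          by (simp add: dl_def mult_ac)
      qed
      also have "\<dots> = exp 1 * L * Y powr (x - \<beta>) * integral {\<gamma> - L..\<gamma> + L} (\<lambda>y. norm (f_moll X (Complex x y)))"
        by (rule Henstock_Kurzweil_Integration.integral_mult_right)
      finally show ?thesis .
    qed
    have Bsmall: "4 * B \<le> 1"
    proof -
      have Te: "T = exp L" using Tpos by (simp add: L_def)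
      have "T * X * Y \<le> exp L * exp (L * (1 / (1 - \<theta>))) * exp (L * (2 / (1 - \<theta>)))"
      proof (intro mult_mono)
        show "X \<le> exp (L * (1 / (1 - \<theta>)))" unfolding X_def using Tpos by (simp add: powr_def L_def)
        show "Y \<le> exp (L * (2 / (1 - \<theta>)))" using Y Tpos by (simp add: powr_def L_def mult.commute)
      qed (use Te X Y in auto)
      also have "\<dots> = exp (L * q)" by (simp add: q_def distrib_left flip: exp_add)
      finally have "4 * B \<le> 4 * C2 * (exp (L * q) * exp (1 - L\<^sup>2))"
        using C2 by (simp add: B_def mult_left_mono mult_ac)
      also have "\<dots> = 4 * C2 * exp 1 * exp (- (L * (L - q)))" by (simp add: power2_eq_square algebra_simps flip: exp_add)
      also have "exp (- (L * (L - q))) \<le> exp (- ln (4 * C2 * exp 1))"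
      proof -
        have "ln (4 * C2 * exp 1) \<le> 1 * (L - q)" 
        proof -
          have "4 / (1 - \<theta>) \<ge> 0" using th_less by simp
          then show ?thesis using L unfolding L0_def mult_1_left by linarith
        qed
        also have "\<dots> \<le> L * (L - q)"
        proof -
          have "4 / (1 - \<theta>) \<ge> 0" using th_less by simp
          then have "L - q \<ge> 0" using L lC unfolding L0_def by linarith
          then show ?thesis using L4 by (intro mult_right_mono) auto
        qed
        finally show ?thesis by simp
      qed
      then have "4 * C2 * exp 1 * exp (- (L * (L - q))) \<le> 4 * C2 * exp 1 * exp (- ln (4 * C2 * exp 1))"
        using C2 by (intro mult_left_mono) auto
      also have "\<dots> = 1"
      proof -
        have "x * exp (- ln x) = 1" if "x > 0" for x :: real using that by (simp add: exp_minus)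
        then show ?thesis using C2 by simp
      qed
      finally show ?thesis .
    qed
    \<comment> \<open>The left side exceeds 6 and the horizontal sides account for at most 4 B \<le>
      1, so the vertical sides must supply more than 4.\<close>
    have "2 * pi \<le> 2 * B * (sr - sl) + integral {\<gamma> - L..\<gamma> + L} (\<lambda>y. norm (F (Complex sr y))) + integral {\<gamma> - L..\<gamma> + L} (\<lambda>y. norm (F (Complex sl y)))"
      unfolding two_pi a1_def a3_def
      by (rule norm_contour_integral_rectpath_le)
         (use slr L4 B0 horiz continuous_on_subset[OF holomorphic_on_imp_continuous_on[OF holF] pi] in \<open>auto simp: a1_def a3_def\<close>)
    moreover have "2 * B * (sr - sl) \<le> 2 * B * 2" using slr B0 by (intro mult_left_mono) auto
    moreover have "2 * pi > 6" using pi_gt3 by simp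
    ultimately have "4 \<le> exp 1 * L * Y powr (sr - \<beta>) * integral {\<gamma> - L..\<gamma> + L} (\<lambda>y. norm (f_moll X (Complex sr y)))
        + exp 1 * L * Y powr (sl - \<beta>) * integral {\<gamma> - L..\<gamma> + L} (\<lambda>y. norm (f_moll X (Complex sl y)))"
      using Bsmall vert[of sr] vert[of sl] by simp
    \<comment> \<open>As Y \<ge> 1, dropping the shift 1 / L from the exponent only increases the
      power of Y.\<close>
    moreover have "exp 1 * L * Y powr (sl - \<beta>) * integral {\<gamma> - L..\<gamma> + L} (\<lambda>y. norm (f_moll X (Complex sl y)))
       \<le> exp 1 * L * Y powr (crit - \<beta>) * integral {\<gamma> - L..\<gamma> + L} (\<lambda>y. norm (f_moll X (Complex sl y)))"
    proof (intro mult_right_mono mult_left_mono powr_mono)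
      show "integral {\<gamma> - L..\<gamma> + L} (\<lambda>y. norm (f_moll X (Complex sl y))) \<ge> 0"
        by (rule Henstock_Kurzweil_Integration.integral_nonneg)
           (use sl d dl beta in \<open>auto intro!: integrable_continuous_real continuous_intros continuous_on_line(2)\<close>)
    qed (use dl Y L4 in \<open>auto simp: sl_def\<close>)
    ultimately have "4 \<le> exp 1 * L * Y powr (sr - \<beta>) * integral {\<gamma> - L..\<gamma> + L} (\<lambda>y. norm (f_moll X (Complex sr y)))
        + exp 1 * L * Y powr (crit - \<beta>) * integral {\<gamma> - L..\<gamma> + L} (\<lambda>y. norm (f_moll X (Complex sl y)))"
      by linarith
    then show "4 \<le> exp 1 * ln T * Y powr (1 + 1 / ln T - Re \<rho>) * line_mean T (1 + 1 / ln T) (Im \<rho>)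
       + exp 1 * ln T * Y powr (crit - Re \<rho>) * line_mean T (crit - 1 / ln T) (Im \<rho>)"
      by (simp only: sl_def sr_def dl_def L_def X_def \<beta>_def \<gamma>_def)
  qed
qed

end

subsection \<open>The zero-density estimate\<close>

lemma card_int_interval_le:
  assumes "a \<le> b"
  shows "finite {k::int. a \<le> of_int k \<and> of_int k \<le> b}" "real (card {k::int. a \<le> of_int k \<and> of_int k \<le> b}) \<le> b - a + 1"
proof -
  have e: "{k::int. a \<le> of_int k \<and> of_int k \<le> b} = {ceiling a..floor b}" by (auto simp: ceiling_le_iff le_floor_iff)
  show "finite {k::int. a \<le> of_int k \<and> of_int k \<le> b}" unfolding e by simp
  show "real (card {k::int. a \<le> of_int k \<and> of_int k \<le> b}) \<le> b - a + 1" unfolding e using assms by (simp, linarith)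
qed

text \<open>The points \<gamma> k lie in different cells of length h, so a given u is within L of at
  most 2 L / h + 2 of them. L \<le> T keeps all segments inside [-2 T, 2 T].\<close>

lemma sum_integral_overlap_le:
  fixes g :: "real \<Rightarrow> real" and \<gamma> :: "int \<Rightarrow> real"
  assumes K: "finite K" and h: "h > 0" and L: "0 \<le> L" "L \<le> T"
    and \<gamma>: "\<And>k. k \<in> K \<Longrightarrow> \<lfloor>\<gamma> k / h\<rfloor> = k" "\<And>k. k \<in> K \<Longrightarrow> \<bar>\<gamma> k\<bar> \<le> T"
    and g: "continuous_on {-(2*T)..2*T} g" "\<And>u. g u \<ge> 0"
  shows "(\<Sum>k\<in>K. integral {\<gamma> k - L..\<gamma> k + L} g) \<le> (2 * L / h + 2) * integral {-(2*T)..2*T} g"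
proof -
  have sub: "{-(2*T)..2*T} \<inter> {\<gamma> k - L..\<gamma> k + L} = {\<gamma> k - L..\<gamma> k + L}" if "k \<in> K" for k
    using \<gamma>(2)[OF that] L by auto
  have int: "(\<lambda>u. if u \<in> {\<gamma> k - L..\<gamma> k + L} then g u else 0) integrable_on {-(2*T)..2*T}" if "k \<in> K" for k
    unfolding integrable_restrict_Int Int_commute[of "{\<gamma> k - L..\<gamma> k + L}"] sub[OF that]
    by (intro integrable_continuous_real continuous_on_subset[OF g(1)]) (use \<gamma>(2)[OF that] L in auto)
  have "(\<Sum>k\<in>K. integral {\<gamma> k - L..\<gamma> k + L} g) = (\<Sum>k\<in>K. integral {-(2*T)..2*T} (\<lambda>u. if u \<in> {\<gamma> k - L..\<gamma> k + L} then g u else 0))"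
    by (intro sum.cong refl) (simp only: integral_restrict_Int sub sub[unfolded Int_commute[of "{-(2*T)..2*T}"]])
  also have "\<dots> = integral {-(2*T)..2*T} (\<lambda>u. \<Sum>k\<in>K. if u \<in> {\<gamma> k - L..\<gamma> k + L} then g u else 0)"
    by (rule integral_sum[symmetric]) (use K int in auto)
  also have "\<dots> \<le> integral {-(2*T)..2*T} (\<lambda>u. (2 * L / h + 2) * g u)"
  proof (rule integral_le)
    show "(\<lambda>u. \<Sum>k\<in>K. if u \<in> {\<gamma> k - L..\<gamma> k + L} then g u else 0) integrable_on {-(2*T)..2*T}"
      by (rule integrable_sum) (use K int in auto)
    show "(\<lambda>u. (2 * L / h + 2) * g u) integrable_on {-(2*T)..2*T}"
      by (intro integrable_continuous_real continuous_intros g)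
    fix u
    let ?K = "{k \<in> K. u \<in> {\<gamma> k - L..\<gamma> k + L}}"
    have "?K \<subseteq> {k. (u - L) / h - 1 \<le> of_int k \<and> of_int k \<le> (u + L) / h}"
    proof
      fix k assume k: "k \<in> ?K"
      then have f: "of_int k \<le> \<gamma> k / h" "\<gamma> k / h < of_int k + 1" using \<gamma>(1)[of k] by (auto simp: floor_eq_iff)
      have "\<gamma> k / h \<le> (u + L) / h" "(u - L) / h \<le> \<gamma> k / h" using k h by (auto intro!: divide_right_mono)
      with f show "k \<in> {k. (u - L) / h - 1 \<le> of_int k \<and> of_int k \<le> (u + L) / h}" by auto
    qed
    moreover have le: "(u - L) / h - 1 \<le> (u + L) / h" using h L divide_right_mono[of "u - L" "u + L" h] by linarith
    ultimately have "real (card ?K) \<le> (u + L) / h - ((u - L) / h - 1) + 1"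
      using card_int_interval_le[OF le] card_mono[of "{k. (u - L) / h - 1 \<le> of_int k \<and> of_int k \<le> (u + L) / h}" ?K]
      by (meson of_nat_mono order.trans)
    also have "\<dots> = 2 * L / h + 2" using h by (simp add: field_simps)
    finally have c: "real (card ?K) \<le> 2 * L / h + 2" .
    have "(\<Sum>k\<in>K. if u \<in> {\<gamma> k - L..\<gamma> k + L} then g u else 0) = (\<Sum>k\<in>?K. g u)" using K by (subst sum.inter_filter) auto
    also have "\<dots> = real (card ?K) * g u" by simp
    also have "\<dots> \<le> (2 * L / h + 2) * g u" by (intro mult_right_mono c g)
    finally show "(\<Sum>k\<in>K. if u \<in> {\<gamma> k - L..\<gamma> k + L} then g u else 0) \<le> (2 * L / h + 2) * g u" .
  qed
  also have "\<dots> = (2 * L / h + 2) * integral {-(2*T)..2*T} g" by (rule Henstock_Kurzweil_Integration.integral_mult_right)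
  finally show ?thesis .
qed

text \<open>Cauchy-Schwarz through f \<le> e + f^2 / (4 e). With e = 1 / (c (b - a)) the constant
  part accounts for exactly 1 of the assumed 2.\<close>

lemma cauchy_schwarz_detection:
  fixes f :: "real \<Rightarrow> real"
  assumes f: "continuous_on {a..b} f" and c: "c > 0" "a < b" and big: "2 \<le> c * integral {a..b} f"
  shows "1 \<le> c\<^sup>2 * (b - a) / 4 * integral {a..b} (\<lambda>u. (f u)\<^sup>2)"
proof -
  define e where "e = 1 / (c * (b - a))"
  have e: "e > 0" using c by (simp add: e_def)
  have "integral {a..b} f \<le> integral {a..b} (\<lambda>u. e + (f u)\<^sup>2 / (4 * e))"
  proof (rule integral_le)
    fix u
    have "0 \<le> (f u - 2 * e)\<^sup>2" by simp
    then have "4 * e * f u \<le> 4 * e\<^sup>2 + (f u)\<^sup>2" by (simp add: power2_eq_square algebra_simps)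
    then show "f u \<le> e + (f u)\<^sup>2 / (4 * e)" using e by (simp add: field_simps power2_eq_square)
  qed (intro integrable_continuous_real continuous_intros f; use e in simp)+
  also have "\<dots> = e * (b - a) + integral {a..b} (\<lambda>u. (f u)\<^sup>2) / (4 * e)"
    using c e by (subst integral_add) (auto intro!: integrable_continuous_real continuous_intros f)
  finally have "c * integral {a..b} f \<le> c * (e * (b - a) + integral {a..b} (\<lambda>u. (f u)\<^sup>2) / (4 * e))"
    using c by (intro mult_left_mono) auto
  also have "\<dots> = 1 + c\<^sup>2 * (b - a) / 4 * integral {a..b} (\<lambda>u. (f u)\<^sup>2)"
    using c by (simp add: e_def field_simps power2_eq_square)
  finally show ?thesis using big by linarith
qed

section \<open>Counting the cells that contain zeros\<close>

context beurling begin

definition zeros_upto :: "real \<Rightarrow> real \<Rightarrow> complex set" where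
  "zeros_upto \<alpha> T = {s \<in> Zzeros \<alpha>. \<bar>Im s\<bar> \<le> T}"

text \<open>Cell k of length h lies in the window of half-height h around k h, which holds O(log T)
  zeros. Multiplicities thus cost one logarithm, and from here on only occupied cells are
  counted.\<close>

lemma zeros_by_windows:
  obtains h C where "h > 0" "C > 0"
    "\<And>T. T \<ge> 2 \<Longrightarrow> finite (zeros_upto crit T)"
    "\<And>T S. T \<ge> 2 \<Longrightarrow> S \<subseteq> zeros_upto crit T \<Longrightarrow>
       mult_sum S \<le> C * ln T * real (card ((\<lambda>s. \<lfloor>Im s / h\<rfloor>) ` S))"
proof -
  obtain h C where h: "h > 0" "C > 0" "\<And>\<gamma>. finite {s \<in> Zzeros crit. \<bar>Im s - \<gamma>\<bar> \<le> h}"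
    "\<And>\<gamma>. mult_sum {s \<in> Zzeros crit. \<bar>Im s - \<gamma>\<bar> \<le> h} \<le> C * ln (\<bar>\<gamma>\<bar> + 3)"
    using zeros_window by blast
  \<comment> \<open>The factor comes from ln (T + h + 3) \<le> ln T + ln (h + 3), the last term
    being absorbed by 2 ln T \<ge> 1.\<close>
  define C' where "C' = C * (1 + 2 * ln (h + 3))"
  have C': "C' > 0" using h by (auto simp: C'_def intro!: mult_pos_pos add_pos_nonneg)
  let ?fl = "\<lambda>s. \<lfloor>Im s / h\<rfloor>"
  let ?W = "\<lambda>k. {s \<in> Zzeros crit. \<bar>Im s - of_int k * h\<bar> \<le> h}"
  have inW: "s \<in> ?W (?fl s)" if "s \<in> Zzeros crit" for s
  proof -
    have "of_int (?fl s) * h \<le> Im s" "Im s < (of_int (?fl s) + 1) * h"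
      using floor_divide_lower[OF h(1)] floor_divide_upper[OF h(1)] by auto
    then show ?thesis using that h(1) by (auto simp: algebra_simps)
  qed
  have fin: "finite (zeros_upto crit T)" if T: "T \<ge> 2" for T
  proof -
    let ?I = "{k::int. -T / h - 1 \<le> of_int k \<and> of_int k \<le> T / h}"
    have "- T / h - 1 \<le> T / h" using T h by (simp add: field_simps)
    then have "finite ?I" by (rule card_int_interval_le)
    moreover have "zeros_upto crit T \<subseteq> (\<Union>k\<in>?I. ?W k)"
    proof
      fix s assume s: "s \<in> zeros_upto crit T"
      have "Im s \<le> T" "- T \<le> Im s" using s by (auto simp: zeros_upto_def)
      then have "Im s / h \<le> T / h" "- T / h \<le> Im s / h" using h(1) by (simp_all only: divide_right_mono less_imp_le)
      moreover have "of_int (?fl s) \<le> Im s / h" "Im s / h < of_int (?fl s) + 1" by linarith+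
      ultimately have "?fl s \<in> ?I" unfolding mem_Collect_eq by linarith
      then show "s \<in> (\<Union>k\<in>?I. ?W k)" using inW[of s] s unfolding zeros_upto_def by blast
    qed
    ultimately show ?thesis using h(3) by (auto intro: finite_subset)
  qed
  show thesis
  proof (rule that[OF h(1) C' fin])
    fix T S assume T: "T \<ge> 2" and S: "S \<subseteq> zeros_upto crit T"
    have finS: "finite S" using fin[OF T] S finite_subset by blast
    have lT: "ln T \<ge> 1 / 2" using T by (rule ln_ge_half)
    have "mult_sum S = (\<Sum>k\<in>?fl ` S. \<Sum>s\<in>{s \<in> S. ?fl s = k}. real (nat (zorder Z s)))"
      by (rule sum.image_gen[OF finS])
    also have "\<dots> \<le> (\<Sum>k\<in>?fl ` S. C' * ln T)"
    proof (rule sum_mono)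
      fix k assume k: "k \<in> ?fl ` S"
      then obtain s where s: "s \<in> S" "k = ?fl s" by auto
      have sz: "s \<in> Zzeros crit" "\<bar>Im s\<bar> \<le> T" using s S by (auto simp: zeros_upto_def)
      have "\<bar>of_int k * h\<bar> \<le> T + h" using inW[OF sz(1)] sz(2) s by auto
      then have "ln (\<bar>of_int k * h\<bar> + 3) \<le> ln (T + h + 3)" by (intro ln_mono) auto
      also have "\<dots> \<le> ln (T * (h + 3))"
      proof (intro ln_mono)
        have "2 * (h + 2) \<le> T * (h + 2)" using T h by (intro mult_right_mono) auto
        then show "T + h + 3 \<le> T * (h + 3)" using h by (simp add: algebra_simps)
      qed (use T h in auto)
      also have "\<dots> = ln T + ln (h + 3)" by (rule ln_mult_pos) (use T h in auto)
      also have "\<dots> \<le> ln T + 2 * ln T * ln (h + 3)"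
      proof -
        have "1 * ln (h + 3) \<le> (2 * ln T) * ln (h + 3)" using lT h by (intro mult_right_mono) auto
        then show ?thesis by simp
      qed
      finally have l: "ln (\<bar>of_int k * h\<bar> + 3) \<le> (1 + 2 * ln (h + 3)) * ln T" by (simp add: algebra_simps)
      have "mult_sum {s \<in> S. ?fl s = k} \<le> mult_sum (?W k)"
        using inW S by (intro sum_mono2 h(3)) (auto simp: zeros_upto_def)
      also have "\<dots> \<le> C * ln (\<bar>of_int k * h\<bar> + 3)" by (rule h(4))
      also have "\<dots> \<le> C * ((1 + 2 * ln (h + 3)) * ln T)" using h(2) l by (intro mult_left_mono) auto
      finally show "mult_sum {s \<in> S. ?fl s = k} \<le> C' * ln T" by (simp add: C'_def mult.assoc)
    qed
    finally show "mult_sum S \<le> C' * ln T * real (card (?fl ` S))" by (simp add: mult_ac)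
  qed
qed

text \<open>The eight logarithms: two from c^2, one from the length of the segments, one from their
  overlap and four from the mean square. The restriction on Y keeps Y^(2 / log T) bounded, so the
  shift of the line costs a constant.\<close>

lemma card_detected_right:
  assumes h: "h > 0"
  obtains C where "C > 0" "\<And>T Y \<alpha> K \<rho>. T \<ge> exp (4 / (1 - \<theta>)) \<Longrightarrow> Y \<ge> 1 \<Longrightarrow> Y \<le> T powr (2 / (1 - \<theta>)) \<Longrightarrow> finite K \<Longrightarrow>
     (\<And>k. k \<in> K \<Longrightarrow> \<lfloor>Im (\<rho> k) / h\<rfloor> = k) \<Longrightarrow> (\<And>k. k \<in> K \<Longrightarrow> \<bar>Im (\<rho> k)\<bar> \<le> T) \<Longrightarrow> (\<And>k. k \<in> K \<Longrightarrow> Re (\<rho> k) \<ge> \<alpha>) \<Longrightarrow>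
     (\<And>k. k \<in> K \<Longrightarrow> 2 \<le> exp 1 * ln T * Y powr (1 + 1 / ln T - Re (\<rho> k)) * line_mean T (1 + 1 / ln T) (Im (\<rho> k))) \<Longrightarrow>
     real (card K) \<le> C * Y powr (2 * (1 - \<alpha>)) * ln T ^ 8"
proof -
  obtain Cr where Cr: "Cr > 0" "\<And>X U \<delta>. X \<ge> 1 \<Longrightarrow> U \<ge> 1 \<Longrightarrow> 0 < \<delta> \<Longrightarrow> \<delta> \<le> 1 \<Longrightarrow> U * X powr (\<theta> - 1) \<le> 2 \<Longrightarrow>
    integral {-U..U} (\<lambda>t. (norm (f_moll X (Complex (1 + \<delta>) t)))\<^sup>2) \<le> Cr * (1 / \<delta> ^ 4 + 1 / (\<delta> ^ 8 * U))"
    using mean_square_right_line by blast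
  define C where "C = (exp 1)\<^sup>2 * exp (4 / (1 - \<theta>)) / 2 * (2 / h + 2) * (Cr * 13)"
  show thesis
  proof (rule that[of C])
    show "C > 0" using Cr h by (auto simp: C_def intro!: mult_pos_pos add_pos_pos)
    fix T Y \<alpha> :: real and K and \<rho> :: "int \<Rightarrow> complex"
    assume T: "T \<ge> exp (4 / (1 - \<theta>))" and Y: "Y \<ge> 1" "Y \<le> T powr (2 / (1 - \<theta>))" and K: "finite K"
      and r1: "\<And>k. k \<in> K \<Longrightarrow> \<lfloor>Im (\<rho> k) / h\<rfloor> = k" and r2: "\<And>k. k \<in> K \<Longrightarrow> \<bar>Im (\<rho> k)\<bar> \<le> T" and r3: "\<And>k. k \<in> K \<Longrightarrow> Re (\<rho> k) \<ge> \<alpha>"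
      and big: "\<And>k. k \<in> K \<Longrightarrow> 2 \<le> exp 1 * ln T * Y powr (1 + 1 / ln T - Re (\<rho> k)) * line_mean T (1 + 1 / ln T) (Im (\<rho> k))"
    define L where "L = ln T"
    have Tpos: "T > 0" using T exp_gt_zero[of "4 / (1 - \<theta>)"] by linarith
    have "4 / (1 - \<theta>) \<ge> 4" using th_less th_nonneg by (simp add: field_simps)
    moreover have "L \<ge> 4 / (1 - \<theta>)" using T Tpos by (simp add: L_def ln_ge_iff)
    ultimately have L4: "L \<ge> 4" by linarith
    have Te: "T = exp L" using Tpos by (simp add: L_def)
    have LT: "L \<le> T" using ln_bound[of T] Tpos by (simp add: L_def)
    define X where "X = T powr (1 / (1 - \<theta>))"
    have T1: "T \<ge> 1" using LT L4 by linarith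
    have X1: "X \<ge> 1" using T1 th_less by (simp add: X_def ge_one_powr_ge_zero)
    let ?f = "\<lambda>u. norm (f_moll X (Complex (1 + 1 / L) u))"
    have fc: "continuous_on S ?f" for S
      by (intro continuous_intros continuous_on_line(2)) (use L4 th_less in \<open>auto intro: less_trans[of _ 1]\<close>)
    define c where "c = exp 1 * L * Y powr (1 + 1 / L - \<alpha>)"
    have c: "c > 0" using L4 Y by (simp add: c_def)
    have one: "1 \<le> c\<^sup>2 * (2 * L) / 4 * integral {Im (\<rho> k) - L..Im (\<rho> k) + L} (\<lambda>u. (?f u)\<^sup>2)" if k: "k \<in> K" for k
    proof -
      have i0: "integral {Im (\<rho> k) - L..Im (\<rho> k) + L} ?f \<ge> 0"
        by (rule Henstock_Kurzweil_Integration.integral_nonneg) (auto intro!: integrable_continuous_real fc)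
      have "2 \<le> exp 1 * L * Y powr (1 + 1 / L - Re (\<rho> k)) * integral {Im (\<rho> k) - L..Im (\<rho> k) + L} ?f"
        using big[OF k] by (simp add: L_def X_def)
      also have "\<dots> \<le> c * integral {Im (\<rho> k) - L..Im (\<rho> k) + L} ?f"
        unfolding c_def using r3[OF k] Y L4 i0 by (intro mult_right_mono mult_left_mono powr_mono) auto
      finally show ?thesis
        using cauchy_schwarz_detection[OF fc[of "{Im (\<rho> k) - L..Im (\<rho> k) + L}"] c] L4 by simp
    qed
    have "real (card K) = (\<Sum>k\<in>K. 1)" by simp
    also have "\<dots> \<le> (\<Sum>k\<in>K. c\<^sup>2 * (2 * L) / 4 * integral {Im (\<rho> k) - L..Im (\<rho> k) + L} (\<lambda>u. (?f u)\<^sup>2))"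
      by (intro sum_mono one)
    also have "\<dots> = c\<^sup>2 * (2 * L) / 4 * (\<Sum>k\<in>K. integral {Im (\<rho> k) - L..Im (\<rho> k) + L} (\<lambda>u. (?f u)\<^sup>2))"
      by (simp add: sum_distrib_left)
    also have "\<dots> \<le> c\<^sup>2 * (2 * L) / 4 * ((2 / h + 2) * L * (Cr * 13 * L ^ 4))"
    proof (intro mult_left_mono)
      have "(\<Sum>k\<in>K. integral {Im (\<rho> k) - L..Im (\<rho> k) + L} (\<lambda>u. (?f u)\<^sup>2)) \<le> (2 * L / h + 2) * integral {-(2*T)..2*T} (\<lambda>u. (?f u)\<^sup>2)"
        by (rule sum_integral_overlap_le[OF K h]) (use r1 r2 L4 LT in \<open>auto intro!: continuous_intros fc\<close>)
      also have "\<dots> \<le> (2 / h + 2) * L * (Cr * 13 * L ^ 4)"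
      proof (intro mult_mono)
        have "2 * 1 \<le> 2 * L" using L4 by simp
        then show "2 * L / h + 2 \<le> (2 / h + 2) * L" by (simp add: algebra_simps)
        \<comment> \<open>For U = 2 T and this X the condition U X^(\<theta> - 1) \<le> 2 of the
          mean square holds with equality.\<close>
        have "2 * T * X powr (\<theta> - 1) = 2 * T * T powr (- 1)"
        proof -
          have "1 / (1 - \<theta>) * (\<theta> - 1) = - 1" using th_less by (simp add: field_simps)
          then show ?thesis by (simp only: X_def powr_powr)
        qed
        also have "\<dots> = 2" using Tpos by (simp add: powr_minus_divide)
        finally have "integral {-(2*T)..2*T} (\<lambda>u. (?f u)\<^sup>2) \<le> Cr * (1 / (1 / L) ^ 4 + 1 / ((1 / L) ^ 8 * (2 * T)))"
          using X1 T1 L4 by (intro Cr) auto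
        also have "1 / (1 / L) ^ 4 + 1 / ((1 / L) ^ 8 * (2 * T)) = L ^ 4 + L ^ 4 * (L ^ 4 / (2 * T))"
          using L4 by (simp add: power_divide flip: power_add)
        also have "L ^ 4 / (2 * T) \<le> 12"
        proof -
          \<comment> \<open>One term of the exponential series; it bounds L^8 / (2 T) by 12 L^4,
            whence the 13 in C.\<close>
          have "L ^ 4 /\<^sub>R fact 4 \<le> exp L"
            unfolding exp_def using L4 sum_le_suminf[OF summable_exp_generic[of L], of "{4}"] by simp
          then have "L ^ 4 \<le> 24 * T" by (simp add: Te fact_numeral field_simps)
          then show ?thesis using Tpos by (simp add: field_simps)
        qed
        then have "L ^ 4 + L ^ 4 * (L ^ 4 / (2 * T)) \<le> L ^ 4 + L ^ 4 * 12" using L4 by (intro add_left_mono mult_left_mono) auto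
        then have "Cr * (L ^ 4 + L ^ 4 * (L ^ 4 / (2 * T))) \<le> Cr * (13 * L ^ 4)" using Cr(1) by (intro mult_left_mono) auto
        finally show "integral {-(2*T)..2*T} (\<lambda>u. (?f u)\<^sup>2) \<le> Cr * 13 * L ^ 4" by simp
        show "integral {-(2*T)..2*T} (\<lambda>u. (?f u)\<^sup>2) \<ge> 0"
          by (rule Henstock_Kurzweil_Integration.integral_nonneg) (auto intro!: integrable_continuous_real continuous_intros fc)
      qed (use h L4 in auto)
      finally show "(\<Sum>k\<in>K. integral {Im (\<rho> k) - L..Im (\<rho> k) + L} (\<lambda>u. (?f u)\<^sup>2)) \<le> (2 / h + 2) * L * (Cr * 13 * L ^ 4)" .
    qed (use L4 in auto)
    also have "c\<^sup>2 \<le> (exp 1)\<^sup>2 * L\<^sup>2 * (exp (4 / (1 - \<theta>)) * Y powr (2 * (1 - \<alpha>)))"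
    proof -
      have "Y powr (2 / L) \<le> (T powr (2 / (1 - \<theta>))) powr (2 / L)" using Y L4 by (intro powr_mono2) auto
      also have "\<dots> = exp (4 / (1 - \<theta>))" using Tpos L4 by (simp add: powr_powr powr_def flip: L_def)
      finally have 1: "Y powr (2 / L) \<le> exp (4 / (1 - \<theta>))" .
      have "c\<^sup>2 = (exp 1)\<^sup>2 * L\<^sup>2 * (Y powr (1 + 1 / L - \<alpha>) * Y powr (1 + 1 / L - \<alpha>))"
        by (simp add: c_def power_mult_distrib power2_eq_square)
      also have "Y powr (1 + 1 / L - \<alpha>) * Y powr (1 + 1 / L - \<alpha>) = Y powr (2 / L) * Y powr (2 * (1 - \<alpha>))"
        unfolding powr_add[symmetric] by (simp add: algebra_simps)
      also have "(exp 1)\<^sup>2 * L\<^sup>2 * (Y powr (2 / L) * Y powr (2 * (1 - \<alpha>))) \<le> (exp 1)\<^sup>2 * L\<^sup>2 * (exp (4 / (1 - \<theta>)) * Y powr (2 * (1 - \<alpha>)))"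
        by (intro mult_left_mono mult_right_mono 1) auto
      finally show ?thesis .
    qed
    then have "c\<^sup>2 * (2 * L) / 4 * ((2 / h + 2) * L * (Cr * 13 * L ^ 4))
      \<le> ((exp 1)\<^sup>2 * L\<^sup>2 * (exp (4 / (1 - \<theta>)) * Y powr (2 * (1 - \<alpha>)))) * (2 * L) / 4 * ((2 / h + 2) * L * (Cr * 13 * L ^ 4))"
      using L4 h Cr(1) by (intro mult_right_mono divide_right_mono) auto
    also have "\<dots> = C * Y powr (2 * (1 - \<alpha>)) * (L * L * L\<^sup>2 * L ^ 4)" unfolding C_def by simp
    also have "L * L * L\<^sup>2 * L ^ 4 = L ^ 8" by (simp flip: power2_eq_square power_add)
    finally show "real (card K) \<le> C * Y powr (2 * (1 - \<alpha>)) * ln T ^ 8" by (simp add: L_def)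
  qed
qed

text \<open>Here the first moment of |f| is available, so there is one logarithm each from the
  kernel, the overlap and the mean value. The exponent is raised to 8 to match the right
  line.\<close>

lemma card_detected_left:
  assumes h: "h > 0"
  obtains C where "C > 0" "\<And>T Y \<alpha> K \<rho>. T \<ge> exp (4 / (1 - \<theta>)) \<Longrightarrow> Y \<ge> 1 \<Longrightarrow> finite K \<Longrightarrow>
     (\<And>k. k \<in> K \<Longrightarrow> \<lfloor>Im (\<rho> k) / h\<rfloor> = k) \<Longrightarrow> (\<And>k. k \<in> K \<Longrightarrow> \<bar>Im (\<rho> k)\<bar> \<le> T) \<Longrightarrow> (\<And>k. k \<in> K \<Longrightarrow> Re (\<rho> k) \<ge> \<alpha>) \<Longrightarrow>
     (\<And>k. k \<in> K \<Longrightarrow> 2 \<le> exp 1 * ln T * Y powr (crit - Re (\<rho> k)) * line_mean T (crit - 1 / ln T) (Im (\<rho> k))) \<Longrightarrow>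
     real (card K) \<le> C * (T * Y powr (crit - \<alpha>)) * ln T ^ 8"
proof -
  obtain Cl where Cl: "Cl > 0" "\<And>X U \<delta> \<kappa>. X \<ge> 2 \<Longrightarrow> U \<ge> 1 \<Longrightarrow> 0 \<le> \<delta> \<Longrightarrow> \<delta> \<le> (1 - \<theta>) / 4 \<Longrightarrow> X powr \<delta> \<le> \<kappa> \<Longrightarrow>
     X powr (1 - \<theta>) \<le> U \<Longrightarrow> U \<le> 2 * X powr (1 - \<theta>) \<Longrightarrow>
    integral {-U..U} (\<lambda>t. norm (f_moll X (Complex (crit - \<delta>) t))) \<le> Cl * \<kappa>\<^sup>2 * (U * ln X + (ln X)\<^sup>2)"
    using mean_left_line by blast
  define \<kappa> where "\<kappa> = exp (1 / (1 - \<theta>))"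
  define w where "w = 1 / (1 - \<theta>)"
  have w: "w > 0" using th_less by (simp add: w_def)
  define C where "C = exp 1 * (2 / h + 2) * (Cl * \<kappa>\<^sup>2 * (2 * w + w\<^sup>2))"
  show thesis
  proof (rule that[of C])
    show C0: "C > 0" using Cl h w by (auto simp: C_def \<kappa>_def intro!: mult_pos_pos add_pos_pos)
    fix T Y \<alpha> :: real and K and \<rho> :: "int \<Rightarrow> complex"
    assume T: "T \<ge> exp (4 / (1 - \<theta>))" and Y: "Y \<ge> 1" and K: "finite K"
      and r1: "\<And>k. k \<in> K \<Longrightarrow> \<lfloor>Im (\<rho> k) / h\<rfloor> = k" and r2: "\<And>k. k \<in> K \<Longrightarrow> \<bar>Im (\<rho> k)\<bar> \<le> T" and r3: "\<And>k. k \<in> K \<Longrightarrow> Re (\<rho> k) \<ge> \<alpha>"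
      and big: "\<And>k. k \<in> K \<Longrightarrow> 2 \<le> exp 1 * ln T * Y powr (crit - Re (\<rho> k)) * line_mean T (crit - 1 / ln T) (Im (\<rho> k))"
    define L where "L = ln T"
    have Tpos: "T > 0" using T exp_gt_zero[of "4 / (1 - \<theta>)"] by linarith
    have "4 / (1 - \<theta>) \<ge> 4" using th_less th_nonneg by (simp add: field_simps)
    moreover have L5: "L \<ge> 4 / (1 - \<theta>)" using T Tpos by (simp add: L_def ln_ge_iff)
    ultimately have L4: "L \<ge> 4" by linarith
    have LT: "L \<le> T" using ln_bound[of T] Tpos by (simp add: L_def)
    define X where "X = T powr (1 / (1 - \<theta>))"
    have T1: "T \<ge> 4" using LT L4 by linarith
    have X1: "X \<ge> 2"
    proof -
      have "T powr 1 \<le> X" unfolding X_def using T1 th_less th_nonneg by (intro powr_mono) (auto simp: field_simps)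
      then show ?thesis using T1 by simp
    qed
    have dl: "0 \<le> 1 / L" "1 / L \<le> (1 - \<theta>) / 4" using L4 L5 th_less by (auto simp: field_simps)
    let ?f = "\<lambda>u. norm (f_moll X (Complex (crit - 1 / L) u))"
    have fc: "continuous_on S ?f" for S
    proof (intro continuous_intros continuous_on_line(2))
      show "crit - 1 / L > \<theta>" "crit - 1 / L \<noteq> 1" using dl th_less by (auto simp: field_simps)
    qed
    have lX: "ln X = w * L" using Tpos by (simp add: X_def L_def w_def ln_powr)
    define c where "c = exp 1 * L * Y powr (crit - \<alpha>)"
    have c: "c > 0" using L4 Y by (simp add: c_def)
    have one: "1 \<le> c * integral {Im (\<rho> k) - L..Im (\<rho> k) + L} ?f" if k: "k \<in> K" for k
    proof -
      have i0: "integral {Im (\<rho> k) - L..Im (\<rho> k) + L} ?f \<ge> 0"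
        by (rule Henstock_Kurzweil_Integration.integral_nonneg) (auto intro!: integrable_continuous_real fc)
      have "2 \<le> exp 1 * L * Y powr (crit - Re (\<rho> k)) * integral {Im (\<rho> k) - L..Im (\<rho> k) + L} ?f"
        using big[OF k] by (simp add: L_def X_def)
      also have "\<dots> \<le> c * integral {Im (\<rho> k) - L..Im (\<rho> k) + L} ?f"
        unfolding c_def using r3[OF k] Y L4 i0 by (intro mult_right_mono mult_left_mono powr_mono) auto
      finally show ?thesis by simp
    qed
    have "real (card K) = (\<Sum>k\<in>K. 1)" by simp
    also have "\<dots> \<le> (\<Sum>k\<in>K. c * integral {Im (\<rho> k) - L..Im (\<rho> k) + L} ?f)" by (intro sum_mono one)
    also have "\<dots> = c * (\<Sum>k\<in>K. integral {Im (\<rho> k) - L..Im (\<rho> k) + L} ?f)" by (simp add: sum_distrib_left)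
    also have "\<dots> \<le> c * ((2 / h + 2) * L * (Cl * \<kappa>\<^sup>2 * ((2 * w + w\<^sup>2) * (T * L))))"
    proof (intro mult_left_mono)
      have "(\<Sum>k\<in>K. integral {Im (\<rho> k) - L..Im (\<rho> k) + L} ?f) \<le> (2 * L / h + 2) * integral {-(2*T)..2*T} ?f"
        by (rule sum_integral_overlap_le[OF K h]) (use r1 r2 L4 LT in \<open>auto intro!: fc\<close>)
      also have "\<dots> \<le> (2 / h + 2) * L * (Cl * \<kappa>\<^sup>2 * ((2 * w + w\<^sup>2) * (T * L)))"
      proof (intro mult_mono)
        have "2 * 1 \<le> 2 * L" using L4 by simp
        then show "2 * L / h + 2 \<le> (2 / h + 2) * L" by (simp add: algebra_simps)
        have XT: "X powr (1 - \<theta>) = T" using th_less Tpos by (simp add: X_def powr_powr)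
        have Xk: "X powr (1 / L) \<le> \<kappa>" using Tpos L4 by (simp add: X_def \<kappa>_def powr_powr powr_def flip: L_def)
        have "integral {-(2*T)..2*T} ?f \<le> Cl * \<kappa>\<^sup>2 * (2 * T * ln X + (ln X)\<^sup>2)"
          by (rule Cl(2)[OF X1 _ dl Xk]) (use XT T1 in auto)
        also have "\<dots> \<le> Cl * \<kappa>\<^sup>2 * ((2 * w + w\<^sup>2) * (T * L))"
        proof (intro mult_left_mono)
          have "w\<^sup>2 * (L * L) \<le> w\<^sup>2 * (T * L)" using LT L4 by (intro mult_left_mono mult_right_mono) auto
          then show "2 * T * ln X + (ln X)\<^sup>2 \<le> (2 * w + w\<^sup>2) * (T * L)" by (simp add: lX power2_eq_square algebra_simps)
        qed (use Cl in auto)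
        finally show "integral {-(2*T)..2*T} ?f \<le> Cl * \<kappa>\<^sup>2 * ((2 * w + w\<^sup>2) * (T * L))" by simp
        show "integral {-(2*T)..2*T} ?f \<ge> 0"
          by (rule Henstock_Kurzweil_Integration.integral_nonneg) (auto intro!: integrable_continuous_real fc)
      qed (use h L4 in auto)
      finally show "(\<Sum>k\<in>K. integral {Im (\<rho> k) - L..Im (\<rho> k) + L} ?f) \<le> (2 / h + 2) * L * (Cl * \<kappa>\<^sup>2 * ((2 * w + w\<^sup>2) * (T * L)))" .
    qed (use c in auto)
    also have "\<dots> = C * (T * Y powr (crit - \<alpha>)) * (L * L * L)" unfolding C_def c_def by simp
    also have "L * L * L = L ^ 3" by (simp add: power3_eq_cube)
    also have "C * (T * Y powr (crit - \<alpha>)) * L ^ 3 \<le> C * (T * Y powr (crit - \<alpha>)) * L ^ 8"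
      using C0 Tpos L4 by (intro mult_left_mono power_increasing) auto
    finally show "real (card K) \<le> C * (T * Y powr (crit - \<alpha>)) * ln T ^ 8" by (simp add: L_def)
  qed
qed

end

section \<open>Choice of Y and uniformity in the parameters\<close>

context beurling begin

lemma zero_density_large_T:
  obtains T0 C where "T0 \<ge> 2" "C > 0" "\<And>\<alpha> T. crit \<le> \<alpha> \<Longrightarrow> \<alpha> \<le> 1 \<Longrightarrow> T \<ge> T0 \<Longrightarrow>
     mult_sum (zeros_upto \<alpha> T) \<le> C * T powr (4 * (1 - \<alpha>) / (3 - 2 * \<alpha> - \<theta>)) * ln T ^ 9"
proof -
  obtain h C1 where h: "h > 0" "C1 > 0" "\<And>T. T \<ge> 2 \<Longrightarrow> finite (zeros_upto crit T)"
    "\<And>T S. T \<ge> 2 \<Longrightarrow> S \<subseteq> zeros_upto crit T \<Longrightarrow>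
       mult_sum S \<le> C1 * ln T * real (card ((\<lambda>s. \<lfloor>Im s / h\<rfloor>) ` S))"
    using zeros_by_windows by blast
  obtain Cr where Cr: "Cr > 0" "\<And>T Y \<alpha> K \<rho>. T \<ge> exp (4 / (1 - \<theta>)) \<Longrightarrow> Y \<ge> 1 \<Longrightarrow> Y \<le> T powr (2 / (1 - \<theta>)) \<Longrightarrow> finite K \<Longrightarrow>
     (\<And>k. k \<in> K \<Longrightarrow> \<lfloor>Im (\<rho> k) / h\<rfloor> = k) \<Longrightarrow> (\<And>k. k \<in> K \<Longrightarrow> \<bar>Im (\<rho> k)\<bar> \<le> T) \<Longrightarrow> (\<And>k. k \<in> K \<Longrightarrow> Re (\<rho> k) \<ge> \<alpha>) \<Longrightarrow>
     (\<And>k. k \<in> K \<Longrightarrow> 2 \<le> exp 1 * ln T * Y powr (1 + 1 / ln T - Re (\<rho> k)) * line_mean T (1 + 1 / ln T) (Im (\<rho> k))) \<Longrightarrow>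
     real (card K) \<le> Cr * Y powr (2 * (1 - \<alpha>)) * ln T ^ 8"
    using card_detected_right[OF h(1)] by blast
  obtain Cl where Cl: "Cl > 0" "\<And>T Y \<alpha> K \<rho>. T \<ge> exp (4 / (1 - \<theta>)) \<Longrightarrow> Y \<ge> 1 \<Longrightarrow> finite K \<Longrightarrow>
     (\<And>k. k \<in> K \<Longrightarrow> \<lfloor>Im (\<rho> k) / h\<rfloor> = k) \<Longrightarrow> (\<And>k. k \<in> K \<Longrightarrow> \<bar>Im (\<rho> k)\<bar> \<le> T) \<Longrightarrow> (\<And>k. k \<in> K \<Longrightarrow> Re (\<rho> k) \<ge> \<alpha>) \<Longrightarrow>
     (\<And>k. k \<in> K \<Longrightarrow> 2 \<le> exp 1 * ln T * Y powr (crit - Re (\<rho> k)) * line_mean T (crit - 1 / ln T) (Im (\<rho> k))) \<Longrightarrow>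
     real (card K) \<le> Cl * (T * Y powr (crit - \<alpha>)) * ln T ^ 8"
    using card_detected_left[OF h(1)] by blast
  obtain T0 where T0: "T0 \<ge> exp (4 / (1 - \<theta>))" "\<And>T Y \<rho>. T \<ge> T0 \<Longrightarrow> 1 \<le> Y \<Longrightarrow> Y \<le> T powr (2 / (1 - \<theta>)) \<Longrightarrow> Z \<rho> = 0 \<Longrightarrow>
     crit \<le> Re \<rho> \<Longrightarrow> 2 * ln T \<le> \<bar>Im \<rho>\<bar> \<Longrightarrow> \<bar>Im \<rho>\<bar> \<le> T \<Longrightarrow>
     4 \<le> exp 1 * ln T * Y powr (1 + 1 / ln T - Re \<rho>) * line_mean T (1 + 1 / ln T) (Im \<rho>)
       + exp 1 * ln T * Y powr (crit - Re \<rho>) * line_mean T (crit - 1 / ln T) (Im \<rho>)"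
    using zero_detection by blast
  define C where "C = C1 * (4 / h + 2 + Cr + Cl)"
  show thesis
  proof (rule that[of T0 C])
    have "4 / (1 - \<theta>) \<ge> 4" using th_less th_nonneg by (simp add: field_simps)
    then have "exp 4 \<le> exp (4 / (1 - \<theta>))" by simp
    moreover have "1 + 4 \<le> exp (4::real)" by (rule exp_ge_add_one_self)
    ultimately show T02: "T0 \<ge> 2" using T0(1) by linarith
    show "C > 0" using h Cr Cl by (auto simp: C_def intro!: mult_pos_pos add_pos_pos)
    fix \<alpha> T :: real
    assume \<alpha>: "crit \<le> \<alpha>" "\<alpha> \<le> 1" and T: "T \<ge> T0"
    have T2: "T \<ge> 2" using T T02 by linarith
    have Te: "T \<ge> exp (4 / (1 - \<theta>))" using T T0(1) by linarith
    define L where "L = ln T"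
    have "L \<ge> 4 / (1 - \<theta>)" using Te T2 by (simp add: L_def ln_ge_iff)
    with \<open>4 / (1 - \<theta>) \<ge> 4\<close> have L4: "L \<ge> 4" by linarith
    define Dn where "Dn = 3 - 2 * \<alpha> - \<theta>"
    have Dn: "Dn \<ge> 1 - \<theta>" "Dn > 0" using \<alpha> th_less by (auto simp: Dn_def)
    \<comment> \<open>The solution of Y^(2 (1 - \<alpha>)) = T Y^((1 + \<theta>) / 2 - \<alpha>),
      which equalizes the bounds for the two kinds of detected cells. As \<alpha> \<le> 1 gives Dn
      \<ge> 1 - \<theta>, it respects the upper bound on Y.\<close>
    define Y where "Y = T powr (2 / Dn)"
    have Y: "Y \<ge> 1" "Y \<le> T powr (2 / (1 - \<theta>))"
    proof -
      show "Y \<ge> 1" using T2 Dn by (simp add: Y_def ge_one_powr_ge_zero)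
      have "2 / Dn \<le> 2 / (1 - \<theta>)" using Dn th_less by (intro divide_left_mono) auto
      then show "Y \<le> T powr (2 / (1 - \<theta>))" unfolding Y_def using T2 by (intro powr_mono) auto
    qed
    define Ex where "Ex = 4 * (1 - \<alpha>) / Dn"
    have Ex0: "Ex \<ge> 0" using \<alpha> Dn by (simp add: Ex_def)
    have TE: "T powr Ex \<ge> 1" using T2 Ex0 by (simp add: ge_one_powr_ge_zero)
    have YE: "Y powr (2 * (1 - \<alpha>)) = T powr Ex"
      by (simp add: Y_def powr_powr Ex_def)
    have YE2: "T * Y powr (crit - \<alpha>) = T powr Ex"
    proof -
      have "T * Y powr (crit - \<alpha>) = T powr 1 * T powr (2 / Dn * (crit - \<alpha>))"
        using T2 by (simp add: Y_def powr_powr)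
      also have "\<dots> = T powr (1 + 2 / Dn * (crit - \<alpha>))" by (simp only: powr_add)
      also have "1 + 2 / Dn * (crit - \<alpha>) = Ex"
      proof -
        have "1 + 2 / Dn * (crit - \<alpha>) = (Dn + (1 + \<theta> - 2 * \<alpha>)) / Dn" using Dn by (simp add: field_simps)
        also have "Dn + (1 + \<theta> - 2 * \<alpha>) = 4 * (1 - \<alpha>)" by (simp add: Dn_def)
        finally show ?thesis by (simp add: Ex_def)
      qed
      finally show ?thesis .
    qed
    let ?fl = "\<lambda>s. \<lfloor>Im s / h\<rfloor>"
    have sub: "zeros_upto \<alpha> T \<subseteq> zeros_upto crit T" using \<alpha> by (auto simp: zeros_upto_def Zzeros_def)
    have fin: "finite (zeros_upto \<alpha> T)" using sub h(3)[OF T2] finite_subset by blast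
    define S2 where "S2 = {s \<in> zeros_upto \<alpha> T. 2 * L \<le> \<bar>Im s\<bar>}"
    define S1 where "S1 = zeros_upto \<alpha> T - S2"
    define K where "K = ?fl ` S2"
    have finS2: "finite S2" using fin by (auto simp: S2_def)
    have K: "finite K" unfolding K_def using finS2 by simp
    \<comment> \<open>One zero represents each occupied cell, since multiplicities have already been
      paid for by the window bound.\<close>
    have "\<exists>\<rho>. \<forall>k\<in>K. \<rho> k \<in> S2 \<and> ?fl (\<rho> k) = k" unfolding K_def by (intro bchoice) auto
    then obtain \<rho> where \<rho>: "\<And>k. k \<in> K \<Longrightarrow> \<rho> k \<in> S2" "\<And>k. k \<in> K \<Longrightarrow> ?fl (\<rho> k) = k" by blast
    have \<rho>2: "\<bar>Im (\<rho> k)\<bar> \<le> T" "Re (\<rho> k) \<ge> \<alpha>" "Z (\<rho> k) = 0" "2 * L \<le> \<bar>Im (\<rho> k)\<bar>" if "k \<in> K" for k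
      using \<rho>(1)[OF that] by (auto simp: S2_def zeros_upto_def Zzeros_def)
    let ?r = "\<lambda>k. exp 1 * ln T * Y powr (1 + 1 / ln T - Re (\<rho> k)) * line_mean T (1 + 1 / ln T) (Im (\<rho> k))"
    let ?l = "\<lambda>k. exp 1 * ln T * Y powr (crit - Re (\<rho> k)) * line_mean T (crit - 1 / ln T) (Im (\<rho> k))"
    have det: "4 \<le> ?r k + ?l k" if "k \<in> K" for k
      by (rule T0(2)[OF T Y \<rho>2(3)]) (use that \<rho>2[OF that] \<alpha> in \<open>auto simp: L_def\<close>)
    define Kr Kl where "Kr = {k \<in> K. 2 \<le> ?r k}" and "Kl = {k \<in> K. 2 \<le> ?l k}"
    have "K \<subseteq> Kr \<union> Kl"
    proof
      fix k assume k: "k \<in> K"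
      have "2 \<le> a \<or> 2 \<le> b" if "4 \<le> a + b" for a b :: real using that by linarith
      from this[OF det[OF k]] k show "k \<in> Kr \<union> Kl" unfolding Kr_def Kl_def by blast
    qed
    then have "card K \<le> card Kr + card Kl"
      using K by (intro order.trans[OF card_mono card_Un_le]) (auto simp: Kr_def Kl_def)
    then have "real (card K) \<le> real (card Kr) + real (card Kl)" by (metis of_nat_add of_nat_mono)
    moreover have "real (card Kr) \<le> Cr * Y powr (2 * (1 - \<alpha>)) * ln T ^ 8"
      by (rule Cr(2)[OF Te Y, of Kr \<rho>]) (use K \<rho> \<rho>2 in \<open>auto simp: Kr_def\<close>)
    moreover have "real (card Kl) \<le> Cl * (T * Y powr (crit - \<alpha>)) * ln T ^ 8"
      by (rule Cl(2)[OF Te Y(1), of Kl \<rho>]) (use K \<rho> \<rho>2 in \<open>auto simp: Kl_def\<close>)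
    ultimately have cK: "real (card K) \<le> (Cr + Cl) * T powr Ex * L ^ 8"
      unfolding YE YE2 L_def[symmetric] by (simp add: algebra_simps)
    \<comment> \<open>Zeros below height 2 log T are not detected, but they fill only O(log T)
      cells, and T^Ex \<ge> 1 absorbs these.\<close>
    have cS1: "real (card (?fl ` S1)) \<le> (4 / h + 2) * T powr Ex * L ^ 8"
    proof -
      let ?I = "{k::int. - (2 * L) / h - 1 \<le> of_int k \<and> of_int k \<le> 2 * L / h}"
      have I: "- (2 * L) / h - 1 \<le> 2 * L / h" using L4 h by (simp add: field_simps)
      have "?fl ` S1 \<subseteq> ?I"
      proof
        fix k assume "k \<in> ?fl ` S1"
        then obtain s where s: "s \<in> S1" "k = ?fl s" by auto
        then have "\<bar>Im s\<bar> \<le> 2 * L" by (auto simp: S1_def S2_def)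
        then have "Im s \<le> 2 * L" "- (2 * L) \<le> Im s" by auto
        then have "Im s / h \<le> 2 * L / h" "- (2 * L) / h \<le> Im s / h" using h(1) by (simp_all only: divide_right_mono less_imp_le)
        moreover have "of_int (?fl s) \<le> Im s / h" "Im s / h < of_int (?fl s) + 1" by linarith+
        ultimately show "k \<in> ?I" unfolding mem_Collect_eq s(2) by linarith
      qed
      then have "real (card (?fl ` S1)) \<le> 2 * L / h - (- (2 * L) / h - 1) + 1"
        using card_int_interval_le[OF I] card_mono by (meson of_nat_mono order.trans)
      also have "\<dots> = 4 / h * L + 2" by simp
      also have "\<dots> \<le> (4 / h + 2) * L" using L4 by (simp add: algebra_simps)
      also have "\<dots> \<le> (4 / h + 2) * (T powr Ex * L ^ 8)"
      proof (intro mult_left_mono)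
        have "L ^ 1 \<le> L ^ 8" using L4 by (intro power_increasing) auto
        then have "1 * L \<le> T powr Ex * L ^ 8" using TE L4 by (intro mult_mono) auto
        then show "L \<le> T powr Ex * L ^ 8" by simp
      qed (use h in auto)
      finally show ?thesis by (simp add: mult.assoc)
    qed
    have "mult_sum (zeros_upto \<alpha> T) = mult_sum S1 + mult_sum S2"
      unfolding S1_def by (rule sum.subset_diff) (use fin in \<open>auto simp: S2_def\<close>)
    also have "\<dots> \<le> C1 * ln T * real (card (?fl ` S1)) + C1 * ln T * real (card (?fl ` S2))"
      by (intro add_mono h(4) T2) (use sub in \<open>auto simp: S1_def S2_def\<close>)
    also have "\<dots> \<le> C1 * L * ((4 / h + 2) * T powr Ex * L ^ 8) + C1 * L * ((Cr + Cl) * T powr Ex * L ^ 8)"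
      unfolding L_def[symmetric] K_def[symmetric] using h L4 by (intro add_mono mult_left_mono cS1 cK) auto
    also have "\<dots> = C * T powr Ex * (L * L ^ 8)" by (simp add: C_def algebra_simps)
    also have "L * L ^ 8 = L ^ 9" by (simp flip: power_Suc)
    finally show "mult_sum (zeros_upto \<alpha> T) \<le> C * T powr (4 * (1 - \<alpha>) / (3 - 2 * \<alpha> - \<theta>)) * ln T ^ 9"
      by (simp add: Ex_def Dn_def L_def)
  qed
qed

text \<open>Completes the range of parameters. For \<alpha> > 1 there are no zeros, whatever the
  exponent becomes; for T < T0 the count is at most the constant M, and 2 ln T \<ge> 1 turns M into
  a multiple of (ln T)^9.\<close>

lemma zero_density:
  obtains C where "\<And>\<alpha> T. crit \<le> \<alpha> \<Longrightarrow> T \<ge> 2 \<Longrightarrow> finite (zeros_upto \<alpha> T) \<and>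
     mult_sum (zeros_upto \<alpha> T) \<le> C * T powr (4 * (1 - \<alpha>) / (3 - 2 * \<alpha> - \<theta>)) * ln T ^ 9"
proof -
  obtain T0 C where C: "T0 \<ge> 2" "C > 0" "\<And>\<alpha> T. crit \<le> \<alpha> \<Longrightarrow> \<alpha> \<le> 1 \<Longrightarrow> T \<ge> T0 \<Longrightarrow>
     mult_sum (zeros_upto \<alpha> T) \<le> C * T powr (4 * (1 - \<alpha>) / (3 - 2 * \<alpha> - \<theta>)) * ln T ^ 9"
    using zero_density_large_T by blast
  obtain h C1 where h: "h > 0" "C1 > 0" "\<And>T. T \<ge> 2 \<Longrightarrow> finite (zeros_upto crit T)"
    "\<And>T S. T \<ge> 2 \<Longrightarrow> S \<subseteq> zeros_upto crit T \<Longrightarrow>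
       mult_sum S \<le> C1 * ln T * real (card ((\<lambda>s. \<lfloor>Im s / h\<rfloor>) ` S))"
    using zeros_by_windows by blast
  define M where "M = mult_sum (zeros_upto crit T0)"
  have M: "M \<ge> 0" unfolding M_def by (intro sum_nonneg) auto
  show thesis
  proof (rule that[of "C + M * 2 ^ 9"])
    fix \<alpha> T :: real
    assume \<alpha>: "crit \<le> \<alpha>" and T: "T \<ge> 2"
    let ?E = "T powr (4 * (1 - \<alpha>) / (3 - 2 * \<alpha> - \<theta>))"
    have lT: "ln T \<ge> 1 / 2" using T by (rule ln_ge_half)
    have sub: "zeros_upto \<alpha> T \<subseteq> zeros_upto crit T" using \<alpha> by (auto simp: zeros_upto_def Zzeros_def)
    then have fin: "finite (zeros_upto \<alpha> T)" using h(3)[OF T] finite_subset by blast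
    have "mult_sum (zeros_upto \<alpha> T) \<le> (C + M * 2 ^ 9) * ?E * ln T ^ 9"
    proof (cases "\<alpha> \<le> 1")
      case False
      have "zeros_upto \<alpha> T = {}"
      proof -
        have "Re s \<le> 1" if "s \<in> zeros_upto \<alpha> T" for s
          using that False th_less by (intro Z_zero_Re_le_1) (auto simp: zeros_upto_def Zzeros_def)
        then show ?thesis using False by (force simp: zeros_upto_def Zzeros_def)
      qed
      then show ?thesis using C M lT by simp
    next
      case True
      have E1: "?E \<ge> 1"
        using T True th_less by (intro ge_one_powr_ge_zero divide_nonneg_nonneg) auto
      have pos: "C * ?E * ln T ^ 9 \<ge> 0" "M * 2 ^ 9 * ?E * ln T ^ 9 \<ge> 0" using C M lT by auto
      show ?thesis
      proof (cases "T \<ge> T0")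
        case T: True
        show ?thesis using C(3)[OF \<alpha> \<open>\<alpha> \<le> 1\<close> T] pos unfolding distrib_right by linarith
      next
        case False
        have "mult_sum (zeros_upto \<alpha> T) \<le> M"
          unfolding M_def
          by (intro sum_mono2 h(3) C(1)) (use False \<alpha> in \<open>auto simp: zeros_upto_def Zzeros_def\<close>)
        also have "M * (1 * 1) \<le> M * (?E * (2 * ln T) ^ 9)"
        proof (intro mult_left_mono mult_mono M E1)
          show "1 \<le> (2 * ln T) ^ 9" using lT by (intro one_le_power) auto
        qed (use lT in auto)
        then have "M \<le> M * 2 ^ 9 * ?E * ln T ^ 9" by (simp add: power_mult_distrib mult_ac)
        finally show ?thesis using pos by (simp add: distrib_right)
      qed
    qed
    with fin show "finite (zeros_upto \<alpha> T) \<and>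
     mult_sum (zeros_upto \<alpha> T) \<le> (C + M * 2 ^ 9) * ?E * ln T ^ 9" by blast
  qed
qed

section \<open>Transfer to the given sequences and to the chosen continuation\<close>

lemma beurling_zeta_eq_zt:
  assumes e: "bij (e :: nat \<Rightarrow> nat multiset)" "\<And>j. n j = nm (e j)" and s: "Re s > 1"
  shows "beurling_zeta n s = zt s"
proof -
  \<comment> \<open>Unconditional convergence permits reindexing along e and then summation in the
    order of the sequence n.\<close>
  have "((\<lambda>j. cpow (nm (e j)) (-s)) has_sum zt s) UNIV"
    using has_sum_zt[OF s] has_sum_reindex_bij_betw[of e UNIV UNIV "\<lambda>m. cpow (nm m) (-s)" "zt s"] e(1) by simp
  then have "(\<lambda>j. complex_of_real (n j) powr (- s)) sums zt s"
    using has_sum_imp_sums by (simp add: e(2) powr_complex_eq_cpow)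
  then show ?thesis unfolding beurling_zeta_def by (simp add: sums_iff)
qed

text \<open>The difference quotient of Z at 1, completed by the derivative, shows that an extension
  exists, the constant being right because Z 1 = A. The identity theorem then forces the chosen
  regular part to agree with it.\<close>

lemma beurling_zeta_cont_eq:
  assumes e: "bij (e :: nat \<Rightarrow> nat multiset)" "\<And>j. n j = nm (e j)" and s: "Re s > \<theta>" "s \<noteq> 1"
  shows "beurling_zeta_cont n A \<theta> s = Z s / (s - 1)"
proof -
  let ?H = "{s. Re s > \<theta>}"
  let ?P = "\<lambda>F. F holomorphic_on ?H \<and> (\<forall>s. Re s > 1 \<longrightarrow> F s = beurling_zeta n s - complex_of_real A / (s - 1))"
  define F0 where "F0 = (\<lambda>z. if z = 1 then deriv Z 1 else (Z z - Z 1) / (z - 1))"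
  have hol: "F0 holomorphic_on ?H"
    unfolding F0_def by (rule pole_lemma_open[OF holomorphic_Z open_halfplane])
  have F0: "?P F0"
  proof (intro conjI hol allI impI)
    fix s assume s: "Re s > 1"
    then have "s \<noteq> 1" by auto
    then show "F0 s = beurling_zeta n s - complex_of_real A / (s - 1)"
      by (simp add: F0_def Z_1 Z_eq_zt[OF s] beurling_zeta_eq_zt[OF e s] diff_divide_distrib)
  qed
  define F where "F = beurling_zeta_regular_part n A \<theta>"
  have F: "?P F" unfolding F_def beurling_zeta_regular_part_def using F0 by (rule someI[where P = ?P])
  have "F s = F0 s"
  proof (rule analytic_continuation_open[where s = "{s. Re s > 1}" and s' = ?H and f = F and g = F0 and z = s])
    show "connected ?H" by (intro convex_connected convex_halfspace_Re_gt)
    have "2 \<in> {s. Re s > 1}" by simp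
    then show "{s. Re s > 1} \<noteq> {}" by blast
  qed (use F F0 s th_less open_halfplane in auto)
  then show ?thesis using s by (simp add: beurling_zeta_cont_def F_def[symmetric] F0_def Z_1 diff_divide_distrib)
qed

text \<open>Division by s - 1 does not change the order at a point other than 1: the local
  factorization of Z is divided by w - 1 on a ball from which 1 is removed.\<close>

lemma zorder_cont_eq:
  assumes e: "bij (e :: nat \<Rightarrow> nat multiset)" "\<And>j. n j = nm (e j)" and s: "Re s > \<theta>" "s \<noteq> 1"
  shows "zorder (beurling_zeta_cont n A \<theta>) s = zorder Z s"
proof -
  let ?H = "{s. Re s > \<theta>}"
  have "connected ?H" by (intro convex_connected convex_halfspace_Re_gt)
  moreover have "\<exists>w\<in>?H. Z w \<noteq> 0" using Z_1 A_pos th_less by (intro bexI[of _ 1]) auto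
  ultimately have z: "(if Z s = 0 then zorder Z s > 0 else zorder Z s = 0) \<and> (\<exists>r. r > 0 \<and> cball s r \<subseteq> ?H \<and> zor_poly Z s holomorphic_on cball s r
    \<and> (\<forall>w\<in>cball s r. Z w = zor_poly Z s w * (w - s) ^ nat (zorder Z s) \<and> zor_poly Z s w \<noteq> 0))"
    using zorder_exist_zero[OF holomorphic_Z open_halfplane, of s] s by auto
  then obtain r where r: "r > 0" "cball s r \<subseteq> ?H" "zor_poly Z s holomorphic_on cball s r"
    "\<And>w. w \<in> cball s r \<Longrightarrow> Z w = zor_poly Z s w * (w - s) ^ nat (zorder Z s) \<and> zor_poly Z s w \<noteq> 0" by blast
  have zo: "zorder Z s \<ge> 0" using z by (cases "Z s = 0") auto
  let ?B = "ball s r - {1}"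
  show ?thesis
  proof (rule zorder_eqI[of ?B])
    show "open ?B" by (intro open_Diff) auto
    show "s \<in> ?B" using r s by simp
    show "(\<lambda>w. zor_poly Z s w / (w - 1)) holomorphic_on ?B"
      by (intro holomorphic_intros holomorphic_on_subset[OF r(3)]) auto
    show "zor_poly Z s s / (s - 1) \<noteq> 0" using r(1) r(4)[of s] s by simp
    fix w assume w: "w \<in> ?B"
    then have "w \<in> cball s r" by auto
    moreover have "Re w > \<theta>" using r(2) \<open>w \<in> cball s r\<close> by blast
    ultimately show "beurling_zeta_cont n A \<theta> w = zor_poly Z s w / (w - 1) * (w - s) powi zorder Z s"
      using beurling_zeta_cont_eq[OF e, of w] r(4)[of w] w zo by (simp add: power_int_def)
  qed
qed

end

text \<open>As p 0 > 1 the number of factors is bounded, and as p tends to infinity so are their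
  indices; only finitely many lists remain.\<close>

lemma finite_nrm_le:
  assumes p: "mono p" "1 < p 0" "filterlim p at_top sequentially"
  shows "finite {m. nrm p m \<le> x}"
proof -
  have p1: "p i \<ge> p 0" for i using p(1) by (simp add: monoD)
  have ge1: "nrm p m \<ge> 1" for m
  proof (induction m)
    case (add i m)
    have "1 * 1 \<le> p i * nrm p m" using add p1[of i] p(2) by (intro mult_mono) auto
    then show ?case by (simp add: nrm_def)
  qed simp
  have size: "p 0 ^ size m \<le> nrm p m" for m
  proof (induction m)
    case (add i m)
    have "p 0 * p 0 ^ size m \<le> p i * nrm p m" using add p1[of i] p(2) by (intro mult_mono) auto
    then show ?case by (simp add: nrm_def)
  qed simp
  have elem: "p i \<le> nrm p m" if i: "i \<in># m" for i m
  proof -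
    obtain m' where m: "m = add_mset i m'" using i by (metis multi_member_split)
    have "p i * 1 \<le> p i * nrm p m'" using p1[of i] p(2) ge1 by (intro mult_left_mono) auto
    then show ?thesis by (simp add: m nrm_def)
  qed
  obtain B where B: "x < p 0 ^ B" using real_arch_pow[OF p(2)] by blast
  have "eventually (\<lambda>i. p i > x) sequentially" using p(3) by (simp add: filterlim_at_top_dense)
  then obtain I where I: "\<And>i. i \<ge> I \<Longrightarrow> p i > x" by (auto simp: eventually_sequentially)
  have "{m. nrm p m \<le> x} \<subseteq> mset ` {xs. set xs \<subseteq> {..<I} \<and> length xs \<le> B}"
  proof
    fix m assume m: "m \<in> {m. nrm p m \<le> x}"
    obtain xs where xs: "m = mset xs" by (metis ex_mset)
    have "p 0 ^ size m < p 0 ^ B" using size[of m] m B by auto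
    then have "size m < B" using p(2) by (simp add: power_strict_increasing_iff)
    moreover have "i < I" if "i \<in> set xs" for i
    proof (rule ccontr)
      assume "\<not> i < I"
      then have "p i > x" using I by simp
      moreover have "p i \<le> nrm p m" using that xs by (intro elem) auto
      ultimately show False using m by simp
    qed
    ultimately show "m \<in> mset ` {xs. set xs \<subseteq> {..<I} \<and> length xs \<le> B}" using xs by auto
  qed
  moreover have "finite {xs. set xs \<subseteq> {..<I} \<and> length xs \<le> B}" by (rule finite_lists_length_le) simp
  ultimately show ?thesis by (meson finite_imageI finite_subset)
qed

lemma beurling_locale_exists:
  fixes p n :: "nat \<Rightarrow> real" and A \<theta> :: real
  assumes sys: "beurling_system p n" and A: "A > 0" and th: "0 \<le> \<theta>" "\<theta> < 1"
    and O: "(\<lambda>x. real (beurling_count n x) - A * x) \<in> O[at_top](\<lambda>x. x powr \<theta>)"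
  obtains c0 e where "beurling p A \<theta> c0" "bij (e :: nat \<Rightarrow> nat multiset)" "\<And>j. n j = nrm p (e j)"
proof -
  obtain e :: "nat \<Rightarrow> nat multiset" where p: "1 < p 0" "mono p" "filterlim p at_top sequentially"
    and e: "bij e" "\<And>j. n j = nrm p (e j)"
    using sys unfolding beurling_system_def nrm_def by blast
  have fin: "finite {m. nrm p m \<le> x}" for x by (rule finite_nrm_le[OF p(2,1,3)])
  have cnt: "beurling_count n x = card {m. nrm p m \<le> x}" for x
  proof -
    have "bij_betw e {j. n j \<le> x} {m. nrm p m \<le> x}"
      using e by (auto simp: bij_betw_def bij_def inj_on_def image_iff)
    then show ?thesis unfolding beurling_count_def by (rule bij_betw_same_card)
  qed
  obtain c where c: "c > 0" "eventually (\<lambda>x. norm (real (beurling_count n x) - A * x) \<le> c * norm (x powr \<theta>)) at_top"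
    using landau_o.bigE[OF O] by blast
  then obtain x0 where x0: "\<And>x. x \<ge> x0 \<Longrightarrow> \<bar>real (beurling_count n x) - A * x\<bar> \<le> c * x powr \<theta>"
    by (auto simp: eventually_at_top_linorder)
  define x1 where "x1 = max x0 1"
  \<comment> \<open>Besides the asymptotic constant, c0 contains the trivial size of both terms on
    the bounded range below x1, where the asymptotic bound may not apply.\<close>
  define c0 where "c0 = 1 + c + real (card {m. nrm p m \<le> x1}) + A * x1"
  have "beurling p A \<theta> c0"
  proof
    show "1 < p i" for i using p monoD[OF p(2), of 0 i] by simp
    show "c0 \<ge> 1" using c A by (simp add: c0_def x1_def)
    fix x :: real
    assume x: "x \<ge> 1"
    have xt: "x powr \<theta> \<ge> 1" using x th by (simp add: ge_one_powr_ge_zero)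
    show "\<bar>real (card {m. nrm p m \<le> x}) - A * x\<bar> \<le> c0 * x powr \<theta>"
    proof (cases "x \<ge> x1")
      case True
      then have "\<bar>real (card {m. nrm p m \<le> x}) - A * x\<bar> \<le> c * x powr \<theta>" using x0[of x] by (simp add: x1_def cnt)
      also have "\<dots> \<le> c0 * x powr \<theta>" using A by (intro mult_right_mono) (auto simp: c0_def x1_def)
      finally show ?thesis .
    next
      case False
      have "real (card {m. nrm p m \<le> x}) \<le> real (card {m. nrm p m \<le> x1})"
        using False by (intro of_nat_mono card_mono fin) auto
      moreover have "A * x \<le> A * x1" "A * x \<ge> 0" using False A x by auto
      ultimately have "\<bar>real (card {m. nrm p m \<le> x}) - A * x\<bar> \<le> c0" using c by (simp add: c0_def abs_le_iff)
      also have "c0 * 1 \<le> c0 * x powr \<theta>" using xt c A by (intro mult_left_mono) (auto simp: c0_def x1_def)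
      finally show ?thesis by simp
    qed
  qed (use A th fin in auto)
  with e show thesis using that by blast
qed

theorem theorem1p2:
  fixes p n :: "nat \<Rightarrow> real" and A \<theta> :: real
  assumes "beurling_system p n"
    and "A > 0" and "0 \<le> \<theta>" and "\<theta> < 1"
    and "(\<lambda>x. real (beurling_count n x) - A * x) \<in> O[at_top](\<lambda>x. x powr \<theta>)"
  shows "\<exists>C::real. \<forall>\<alpha> T::real. \<alpha> \<ge> (1 + \<theta>) / 2 \<longrightarrow> T \<ge> 2 \<longrightarrow>
           finite (beurling_zeros n A \<theta> \<alpha> T) \<and>
           real (beurling_zero_count n A \<theta> \<alpha> T)
             \<le> C * T powr (4 * (1 - \<alpha>) / (3 - 2 * \<alpha> - \<theta>)) * ln T ^ 9"
proof -
  obtain c0 e where loc: "beurling p A \<theta> c0" and e: "bij (e :: nat \<Rightarrow> nat multiset)" "\<And>j. n j = nrm p (e j)"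
    using beurling_locale_exists[OF assms] by blast
  interpret beurling p A \<theta> c0 by (rule loc)
  obtain C where C: "\<And>\<alpha> T. (1 + \<theta>) / 2 \<le> \<alpha> \<Longrightarrow> T \<ge> 2 \<Longrightarrow> finite (zeros_upto \<alpha> T) \<and>
     mult_sum (zeros_upto \<alpha> T) \<le> C * T powr (4 * (1 - \<alpha>) / (3 - 2 * \<alpha> - \<theta>)) * ln T ^ 9"
    using zero_density by blast
  have "finite (beurling_zeros n A \<theta> \<alpha> T) \<and> real (beurling_zero_count n A \<theta> \<alpha> T)
      \<le> C * T powr (4 * (1 - \<alpha>) / (3 - 2 * \<alpha> - \<theta>)) * ln T ^ 9"
    if \<alpha>: "\<alpha> \<ge> (1 + \<theta>) / 2" and T: "T \<ge> 2" for \<alpha> T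
  proof -
    have \<alpha>\<theta>: "\<alpha> > \<theta>" using \<alpha> \<open>\<theta> < 1\<close> by (simp add: field_simps)
    have zeros: "beurling_zeros n A \<theta> \<alpha> T = zeros_upto \<alpha> T"
    proof (intro set_eqI iffI)
      fix s assume s: "s \<in> beurling_zeros n A \<theta> \<alpha> T"
      then have "Re s > \<theta>" "s \<noteq> 1" using \<alpha>\<theta> by (auto simp: beurling_zeros_def)
      then show "s \<in> zeros_upto \<alpha> T"
        using s beurling_zeta_cont_eq[OF e] by (auto simp: beurling_zeros_def zeros_upto_def Zzeros_def)
    next
      fix s assume s: "s \<in> zeros_upto \<alpha> T"
      \<comment> \<open>Z 1 = A > 0, so 1 is not a zero of Z, in accordance with its exclusion from
        \<open>beurling_zeros\<close>.\<close>
      then have "Re s > \<theta>" "s \<noteq> 1" using \<alpha>\<theta> Z_1 \<open>A > 0\<close> by (auto simp: zeros_upto_def Zzeros_def)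
      then show "s \<in> beurling_zeros n A \<theta> \<alpha> T"
        using s beurling_zeta_cont_eq[OF e] by (auto simp: beurling_zeros_def zeros_upto_def Zzeros_def)
    qed
    have "real (beurling_zero_count n A \<theta> \<alpha> T) = (\<Sum>s\<in>zeros_upto \<alpha> T. real (nat (zorder (beurling_zeta_cont n A \<theta>) s)))"
      by (simp add: beurling_zero_count_def zeros)
    also have "\<dots> = mult_sum (zeros_upto \<alpha> T)"
    proof (rule sum.cong[OF refl])
      fix s assume "s \<in> zeros_upto \<alpha> T"
      then have "Re s > \<theta>" "s \<noteq> 1" using \<alpha>\<theta> Z_1 \<open>A > 0\<close> by (auto simp: zeros_upto_def Zzeros_def)
      then show "real (nat (zorder (beurling_zeta_cont n A \<theta>) s)) = real (nat (zorder Z s))"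
        by (simp add: zorder_cont_eq[OF e])
    qed
    finally show ?thesis using C[OF \<alpha> T] zeros by simp
  qed
  then show ?thesis by blast
qed

end
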